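(* Let $X_1,\ldots,X_n$ be i.i.d. with c.d.f. $F\in\Im$, and consider testing $F=F_0$, $F_0(x)=x$, $x\in[0,1]$, by Cramer–von Mises tests, with $T^2(G)=\int_0^1G^2(x)\,dx$. The following three statements hold. (i) For a sequence of alternatives $F_n\in\Im$, there is a sequence of Cramer–von Mises tests $K_n$ such that $\lim_{n\to\infty}(\alpha(K_n)+\beta_{F_n}(K_n))=0$ if and only if $$\lim_{n\to\infty}n\,T^2(F_n-F_0)=\infty .$$ (ii) Cramer–von Mises tests are asymptotically unbiased: for any $a>0$ and any $\alpha$, $0<\alpha<1$, for Cramer–von Mises tests $K_n$ with $\alpha(K_n)=\alpha+o(1)$, $$\limsup_{n\to\infty}\ \sup_{F\in\Upsilon_n(a)}\beta_F(K_n)<1-\alpha,\qquad \Upsilon_n(a)=\{F\in\Im:\ T^2(F-F_0)>a n^{-1}\}.$$ (iii) For a sequence of alternatives $F_n\in\Im$, the relation $\lim_{n\to\infty}(\alpha(K_n)+\beta_{F_n}(K_n))\ge1$ holds for any sequence of Cramer–von Mises tests $K_n$ if and only if $$\lim_{n\to\infty}n\,T^2(F_n-F_0)=0 .$$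
   Context: $\Im$ is the set of all distribution functions of random variables with values in the interval $(0,1)$. $\hat F_n$ is the empirical distribution function of $X_1,\ldots,X_n$. The Cramer–von Mises statistic is $T^2(\hat F_n-F_0)=\int_0^1(\hat F_n(x)-F_0(x))^2\,dF_0(x)$; a Cramer–von Mises test $K_n$ rejects the hypothesis when this statistic exceeds a threshold. $\alpha(K_n)$ is the type I error probability of $K_n$ and $\beta_F(K_n)$ its type II error probability when the c.d.f. is $F$. *)

theory Defs
  imports "HOL-Probability.Probability"
begin

text \<open>The class of distribution functions of random variables with values in \<open>(0,1)\<close>.
  As in the library, \<open>cdf M x = measure M {..x}\<close>; only the law \<open>M\<close> of the random variable
  matters.\<close>

definition dist_funs01 :: "(real \<Rightarrow> real) set" where
  "dist_funs01 = {cdf M | M. real_distribution M \<and> (AE x in M. x \<in> {0<..<1})}"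

text \<open>The hypothesis \<open>F\<^sub>0(x) = x\<close> on \<open>[0,1]\<close>, extended to a distribution function on the
  whole real line.\<close>

definition F0 :: "real \<Rightarrow> real" where
  "F0 x = max 0 (min 1 x)"

definition T2 :: "(real \<Rightarrow> real) \<Rightarrow> real" where
  "T2 G = (LBINT x:{0..1}. (G x)\<^sup>2)"

text \<open>A sample \<open>X\<^sub>1, \<dots>, X\<^sub>n\<close> is a function \<open>X\<close> on the index set \<open>{1..n}\<close>.\<close>

definition emp_cdf :: "nat \<Rightarrow> (nat \<Rightarrow> real) \<Rightarrow> real \<Rightarrow> real" where
  "emp_cdf n X x = real (card {i \<in> {1..n}. X i \<le> x}) / real n"

text \<open>The joint law of \<open>n\<close> independent random variables with distribution function \<open>F\<close>.\<close>

definition sample_law :: "nat \<Rightarrow> (real \<Rightarrow> real) \<Rightarrow> (nat \<Rightarrow> real) measure" where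
  "sample_law n F = PiM {1..n} (\<lambda>_. interval_measure F)"

text \<open>A (non-randomised) test is given by its rejection event as a predicate on samples.
  The threshold may be any real number and may depend on \<open>n\<close>.\<close>

definition cvm_test :: "nat \<Rightarrow> ((nat \<Rightarrow> real) \<Rightarrow> bool) \<Rightarrow> bool" where
  "cvm_test n K \<longleftrightarrow> (\<exists>c::real. K = (\<lambda>X. T2 (\<lambda>x. emp_cdf n X x - F0 x) > c))"

definition type1_error :: "nat \<Rightarrow> ((nat \<Rightarrow> real) \<Rightarrow> bool) \<Rightarrow> real" where
  "type1_error n K = measure (sample_law n F0) {X \<in> space (sample_law n F0). K X}"

definition type2_error :: "nat \<Rightarrow> (real \<Rightarrow> real) \<Rightarrow> ((nat \<Rightarrow> real) \<Rightarrow> bool) \<Rightarrow> real" where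
  "type2_error n F K = measure (sample_law n F) {X \<in> space (sample_law n F). \<not> K X}"

definition Upsilon :: "nat \<Rightarrow> real \<Rightarrow> (real \<Rightarrow> real) set" where
  "Upsilon n a = {F \<in> dist_funs01. T2 (\<lambda>x. F x - F0 x) > a / real n}"

text \<open>The measure \<open>interval_measure F\<close> used in \<open>sample_law\<close> is indeed the law with
  distribution function \<open>F\<close>, and \<open>F\<^sub>0\<close> belongs to the class.\<close>

lemma interval_measure_dist_funs01:
  assumes "F \<in> dist_funs01"
  shows "real_distribution (interval_measure F)" "cdf (interval_measure F) = F"
    "AE x in interval_measure F. x \<in> {0<..<1}"
proof -
  obtain M where M: "real_distribution M" "AE x in M. x \<in> {0<..<1}" "F = cdf M"
    using assms by (auto simp: dist_funs01_def)
  interpret real_distribution M by fact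
  have F: "\<And>x y. x \<le> y \<Longrightarrow> F x \<le> F y" "\<And>a. continuous (at_right a) F"
    "(F \<longlongrightarrow> 0) at_bot" "(F \<longlongrightarrow> 1) at_top"
    unfolding M(3) using cdf_nondecreasing cdf_is_right_cont cdf_lim_at_bot cdf_lim_at_top_prob
    by auto
  show 1: "real_distribution (interval_measure F)"
    using F by (intro real_distribution_interval_measure) auto
  show 2: "cdf (interval_measure F) = F"
    using F by (intro cdf_interval_measure) auto
  have "interval_measure F = M"
    using 1 2 M by (intro cdf_unique) auto
  then show "AE x in interval_measure F. x \<in> {0<..<1}"
    using M(2) by (simp only:)
qed

lemma F0_in_dist_funs01: "F0 \<in> dist_funs01"
proof -
  define M where "M = uniform_measure lborel {0<..<1::real}"
  have p: "prob_space M"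
    unfolding M_def by (rule prob_space_uniform_measure) auto
  then interpret prob_space M .
  have rd: "real_distribution M"
    by unfold_locales (auto simp: M_def)
  have "cdf M x = F0 x" for x
  proof -
    have "cdf M x = measure lborel ({0<..<1} \<inter> {..x})"
      by (simp add: cdf_def M_def)
    also have "\<dots> = F0 x"
    proof (cases "x < 1")
      case True
      then have "{0<..<1} \<inter> {..x} = {0<..x}" by auto
      then show ?thesis using True by (cases "0 \<le> x") (auto simp: F0_def)
    next
      case False
      then have "{0<..<1} \<inter> {..x} = {0<..<1}" by auto
      then show ?thesis using False by (auto simp: F0_def)
    qed
    finally show ?thesis .
  qed
  then have "F0 = cdf M" by auto
  moreover have "AE x in M. x \<in> {0<..<1}"
    unfolding M_def by (rule AE_uniform_measureI) auto
  ultimately show ?thesis using rd by (auto simp: dist_funs01_def)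
qed

end

theory Submission
  imports Defs "HOL-Library.Diagonal_Subsequence"
begin

text \<open>
  Write \<open>S = sqrt n (emp_cdf - F)\<close> and \<open>h = sqrt n (F - F0)\<close>, so that \<open>n\<close> times the
  Cramer-von Mises statistic is the squared norm of \<open>S + h\<close> in \<open>L\<^sup>2[0,1]\<close>. Its mean square fluctuation
  \<open>E |S|\<^sup>2 = \<integral> F (1 - F)\<close> is at most \<open>1/4\<close> for every \<open>F\<close>, so the size \<open>|h|\<^sup>2 = n T2 (F - F0)\<close> alone decides
  about detection, up to what happens when \<open>|h|\<close> stays bounded. There a limit law is needed.

  In the orthonormal basis \<open>e\<^sub>j = sqrt 2 sin (pi j x)\<close> the coefficients of \<open>S\<close> are normalised sums of
  \<open>sqrt 2 cos (pi j X\<^sub>i) / (pi j)\<close>. Under \<open>F0\<close> these are uncorrelated with variances \<open>1 / (pi j)\<^sup>2\<close>,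
  and the same holds asymptotically whenever \<open>F\<close> approaches \<open>F0\<close>. If the coefficients of \<open>h\<close> converge to
  \<open>h\<^sub>j\<close> and \<open>|h|\<^sup>2\<close> converges to \<open>b\<close>, the statistic converges in law to
  \<open>(\<Sum>j. (\<sigma>\<^sub>j \<xi>\<^sub>j + h\<^sub>j)\<^sup>2) + (b - (\<Sum>j. h\<^sub>j\<^sup>2))\<close> with independent standard normal \<open>\<xi>\<^sub>j\<close>: the squared norm of
  a shifted Brownian bridge, plus the part of \<open>|h|\<^sup>2\<close> that escapes to high frequencies (\<open>cvm_cdf_lim\<close>).
  The proof goes through Laplace transforms. Since \<open>exp (- s |a|\<^sup>2)\<close> is the characteristic function of a
  Gaussian vector, the Laplace transform of the norm of the first \<open>d\<close> coefficients is a Gaussian average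
  of characteristic functions of scalar sums (\<open>laplace_sq_norm_eq_char\<close>). The remaining coefficients are
  negligible because their total variance tends to \<open>1/6 - (\<Sum>j\<le>d. 1 / (pi j)\<^sup>2)\<close>, which by
  \<open>(\<Sum>j. 1 / j\<^sup>2) = pi\<^sup>2 / 6\<close> vanishes as \<open>d\<close> grows; by Bessel's inequality what remains is non-negative,
  so its mean controls its size.

  The limit laws are compared by a strict form of Anderson's inequality: if some \<open>h\<^sub>j \<noteq> 0\<close> or mass has
  escaped, the limit exceeds any level \<open>t > 0\<close> with larger probability than in the null case
  (\<open>prob_gauss_norm2_shift_less\<close>). As the coordinates are independent, this follows from the
  one-dimensional inequality by removing the shifts one coordinate at a time.

  The three statements follow. For (i), a threshold proportional to \<open>T2 (F\<^sub>n - F0)\<close> separates the two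
  laws by Markov's inequality if \<open>|h| \<rightarrow> \<infinity>\<close>; conversely a vanishing type I error forces the scaled
  threshold to infinity, because the null limit is unbounded, and then \<open>|h|\<close> cannot stay bounded. For
  (ii), a violating sequence of alternatives either has \<open>|h|\<close> large, where Markov's inequality applies, or
  has a subsequence along which all coefficients and \<open>|h|\<^sup>2\<close> converge, where Anderson's inequality
  contradicts the violation (\<open>alternatives_frequently_detected\<close>). For (iii), if \<open>|h| \<rightarrow> 0\<close> both laws have
  the same continuous limit, hence uniformly close distribution functions; if not, the argument for (ii)
  applies to a subsequence.
\<close>

section \<open>Independent coordinates and Laplace transforms of squared norms\<close>

text \<open>The coordinates of a product measure are independent, also for infinite index sets. Integrals of
  finite products cover the two uses made of this: characteristic functions of sums and second moments.\<close>

lemma integral_prod_coordinates: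
  fixes f :: "'i \<Rightarrow> 'a \<Rightarrow> 'b::{real_normed_field, banach, second_countable_topology}"
  assumes M: "prob_space M" and J: "J \<subseteq> I" "finite J"
    and f: "\<And>j. j \<in> J \<Longrightarrow> integrable M (f j)"
  shows "(\<integral>\<omega>. (\<Prod>j\<in>J. f j (\<omega> j)) \<partial>PiM I (\<lambda>_. M)) = (\<Prod>j\<in>J. \<integral>x. f j x \<partial>M)"
    and "integrable (PiM I (\<lambda>_. M)) (\<lambda>\<omega>. \<Prod>j\<in>J. f j (\<omega> j))"
proof -
  interpret M: prob_space M by fact
  interpret P: product_prob_space "\<lambda>_. M" I by unfold_locales
  let ?P = "PiM I (\<lambda>_. M)"
  have comp: "distr ?P M (\<lambda>\<omega>. \<omega> j) = M" if "j \<in> J" for j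
    using P.PiM_component[of j] that J by auto
  have meas: "(\<lambda>\<omega>. \<omega> j) \<in> measurable ?P M" if "j \<in> J" for j
    using that J by (intro measurable_component_singleton) auto
  have ind: "P.indep_vars (\<lambda>_. M) (\<lambda>j \<omega>. \<omega> j) J"
  proof (cases "J = {}")
    case True then show ?thesis by (simp add: P.indep_vars_def P.indep_sets_def)
  next
    case False
    have "distr ?P (PiM J (\<lambda>_. M)) (\<lambda>x. \<lambda>i\<in>J. x i) = PiM J (\<lambda>_. M)"
      using P.distr_PiM_restrict_finite[of J] J by (simp add: restrict_def)
    also have "\<dots> = (\<Pi>\<^sub>M i\<in>J. distr ?P M (\<lambda>\<omega>. \<omega> i))"
      by (intro PiM_cong) (auto simp: comp)
    finally show ?thesis
      by (subst P.indep_vars_iff_distr_eq_PiM'[OF False]) (auto intro!: meas)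
  qed
  have fm: "f j \<in> borel_measurable M" if "j \<in> J" for j using f[OF that] by auto
  have ind': "P.indep_vars (\<lambda>_. borel) (\<lambda>j \<omega>. f j (\<omega> j)) J"
    by (rule P.indep_vars_compose2[OF ind]) (use fm in auto)
  have int: "integrable ?P (\<lambda>\<omega>. f j (\<omega> j))" "(\<integral>\<omega>. f j (\<omega> j) \<partial>?P) = (\<integral>x. f j x \<partial>M)" if "j \<in> J" for j
    using f[OF that] integrable_distr_eq[OF meas[OF that] fm[OF that]]
      integral_distr[OF meas[OF that] fm[OF that]] comp[OF that] by auto
  show "(\<integral>\<omega>. (\<Prod>j\<in>J. f j (\<omega> j)) \<partial>?P) = (\<Prod>j\<in>J. \<integral>x. f j x \<partial>M)"
    by (subst P.indep_vars_lebesgue_integral[OF J(2) ind']) (auto simp: int)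
  show "integrable ?P (\<lambda>\<omega>. \<Prod>j\<in>J. f j (\<omega> j))"
    by (rule P.indep_vars_integrable[OF J(2) ind']) (auto simp: int)
qed

lemma integral_coordinate:
  fixes f :: "'a \<Rightarrow> 'b::{real_normed_field, banach, second_countable_topology}"
  assumes "prob_space M" "i \<in> I" "integrable M f"
  shows "(\<integral>\<omega>. f (\<omega> i) \<partial>PiM I (\<lambda>_. M)) = (\<integral>x. f x \<partial>M)"
    and "integrable (PiM I (\<lambda>_. M)) (\<lambda>\<omega>. f (\<omega> i))"
  using integral_prod_coordinates[of M "{i}" I "\<lambda>_. f"] assms by auto

abbreviation "stdN \<equiv> std_normal_distribution"

definition gauss_seq :: "(nat \<Rightarrow> real) measure" where
  "gauss_seq = PiM UNIV (\<lambda>_. stdN)"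

lemma prob_space_std_normal: "prob_space stdN"
  by (rule prob_space_normal_density) simp

lemma prob_space_gauss_seq: "prob_space gauss_seq"
  unfolding gauss_seq_def by (intro prob_space_PiM prob_space_std_normal)

interpretation N: prob_space stdN by (rule prob_space_std_normal)

interpretation G: prob_space gauss_seq by (rule prob_space_gauss_seq)

lemma sets_gauss_seq [measurable_cong]: "sets gauss_seq = sets (PiM UNIV (\<lambda>_. borel))"
  unfolding gauss_seq_def by (intro sets_PiM_cong) auto

lemma space_gauss_seq [simp]: "space gauss_seq = UNIV"
  by (simp add: gauss_seq_def space_PiM)

lemma gauss_seq_char:
  "(\<integral>w. iexp (\<Sum>j<d. u j * w j) \<partial>gauss_seq) = complex_of_real (exp (- (\<Sum>j<d. (u j)\<^sup>2) / 2))"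
proof -
  have "(\<integral>w. iexp (\<Sum>j<d. u j * w j) \<partial>gauss_seq) = (\<integral>w. (\<Prod>j<d. iexp (u j * w j)) \<partial>gauss_seq)"
    by (simp add: sum_distrib_left exp_sum)
  also have "\<dots> = (\<Prod>j<d. (\<integral>x. iexp (u j * x) \<partial>stdN))"
    unfolding gauss_seq_def
    by (rule integral_prod_coordinates) (auto intro!: N.integrable_const_bound[of _ 1] prob_space_std_normal)
  also have "\<dots> = (\<Prod>j<d. complex_of_real (exp (- ((u j)\<^sup>2) / 2)))"
    using char_std_normal_distribution by (simp add: char_def fun_eq_iff)
  also have "\<dots> = complex_of_real (exp (- (\<Sum>j<d. (u j)\<^sup>2) / 2))"
    by (simp add: exp_sum[symmetric] sum_negf sum_divide_distrib flip: of_real_prod)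
  finally show ?thesis .
qed

text \<open>The characteristic function of the vector \<open>A\<close> at \<open>sqrt (2 s) w\<close>. The scaling makes its mean over Gaussian
  \<open>w\<close> a Laplace transform at \<open>s\<close>.\<close>

definition gauss_char :: "nat \<Rightarrow> real \<Rightarrow> 'a measure \<Rightarrow> (nat \<Rightarrow> 'a \<Rightarrow> real) \<Rightarrow> (nat \<Rightarrow> real) \<Rightarrow> complex" where
  "gauss_char d s P A w = (\<integral>\<omega>. iexp (\<Sum>j<d. (sqrt (2 * s) * w j) * A j \<omega>) \<partial>P)"

text \<open>For a Gaussian vector \<open>W\<close> the mean of \<open>exp (i sqrt (2 s) \<langle>W, a\<rangle>)\<close> is \<open>exp (- s |a|\<^sup>2)\<close>. With \<open>a = A \<omega>\<close>
  and Fubini's theorem, the Laplace transform of \<open>|A|\<^sup>2\<close> becomes a mixture of characteristic functions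
  of linear forms in \<open>A\<close>.\<close>

lemma laplace_sq_norm_eq_char:
  fixes A :: "nat \<Rightarrow> 'a \<Rightarrow> real"
  assumes P: "prob_space P" and A [measurable]: "\<And>j. A j \<in> borel_measurable P" and "s \<ge> 0"
  shows "complex_of_real (\<integral>\<omega>. exp (- s * (\<Sum>j<d. (A j \<omega>)\<^sup>2)) \<partial>P) =
    (\<integral>w. gauss_char d s P A w \<partial>gauss_seq)"
proof -
  interpret P: prob_space P by fact
  interpret PG: pair_prob_space P gauss_seq by unfold_locales
  have "complex_of_real (\<integral>\<omega>. exp (- s * (\<Sum>j<d. (A j \<omega>)\<^sup>2)) \<partial>P) =
     (\<integral>\<omega>. complex_of_real (exp (- s * (\<Sum>j<d. (A j \<omega>)\<^sup>2))) \<partial>P)"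
    by (rule integral_complex_of_real[symmetric])
  also have "\<dots> = (\<integral>\<omega>. (\<integral>w. iexp (\<Sum>j<d. (sqrt (2 * s) * A j \<omega>) * w j) \<partial>gauss_seq) \<partial>P)"
    using \<open>s \<ge> 0\<close> by (simp only: gauss_seq_char) (simp add: power_mult_distrib flip: sum_distrib_left)
  also have "\<dots> = (\<integral>\<omega>. (\<integral>w. iexp (\<Sum>j<d. (sqrt (2 * s) * w j) * A j \<omega>) \<partial>gauss_seq) \<partial>P)"
    by (simp add: mult_ac)
  also have "\<dots> = (\<integral>w. (\<integral>\<omega>. iexp (\<Sum>j<d. (sqrt (2 * s) * w j) * A j \<omega>) \<partial>P) \<partial>gauss_seq)"
    by (rule PG.Fubini_integral[symmetric]) (intro PG.P.integrable_const_bound[of _ 1]; simp add: split_beta)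
  finally show ?thesis unfolding gauss_char_def .
qed

lemma measurable_gauss_char:
  assumes P: "prob_space P" and A [measurable]: "\<And>j. A j \<in> borel_measurable P"
  shows "gauss_char d s P A \<in> borel_measurable gauss_seq"
proof -
  interpret P: prob_space P by (rule P)
  show ?thesis unfolding gauss_char_def[abs_def] by measurable
qed

lemma norm_gauss_char_le: "prob_space P \<Longrightarrow> norm (gauss_char d s P A w) \<le> 1"
  unfolding gauss_char_def
  by (rule order_trans[OF integral_norm_bound]) (simp add: prob_space.prob_space)

text \<open>By the preceding formula and dominated convergence in the Gaussian weights, convergence of the scalar
  linear forms carries over to the squared norm.\<close>

lemma laplace_sq_norm_convergence:
  fixes A :: "nat \<Rightarrow> nat \<Rightarrow> 'a \<Rightarrow> real" and A' :: "nat \<Rightarrow> 'b \<Rightarrow> real"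
  assumes P: "\<And>k::nat. prob_space (P k)" "prob_space P'"
    and A: "\<And>k j. A k j \<in> borel_measurable (P k)" "\<And>j. A' j \<in> borel_measurable P'"
    and char: "\<And>w. (\<lambda>k. \<integral>\<omega>. iexp (\<Sum>j<d. w j * A k j \<omega>) \<partial>P k) \<longlonglongrightarrow> (\<integral>\<omega>. iexp (\<Sum>j<d. w j * A' j \<omega>) \<partial>P')"
    and s: "s \<ge> 0"
  shows "(\<lambda>k. \<integral>\<omega>. exp (- s * (\<Sum>j<d. (A k j \<omega>)\<^sup>2)) \<partial>P k) \<longlonglongrightarrow> (\<integral>\<omega>. exp (- s * (\<Sum>j<d. (A' j \<omega>)\<^sup>2)) \<partial>P')"
proof -
  have "(\<lambda>k. \<integral>w. gauss_char d s (P k) (A k) w \<partial>gauss_seq) \<longlonglongrightarrow> (\<integral>w. gauss_char d s P' A' w \<partial>gauss_seq)"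
  proof (rule integral_dominated_convergence[where w="\<lambda>_. 1"])
    show "AE w in gauss_seq. (\<lambda>k. gauss_char d s (P k) (A k) w) \<longlonglongrightarrow> gauss_char d s P' A' w"
      unfolding gauss_char_def by (intro AE_I2 char)
    show "AE w in gauss_seq. norm (gauss_char d s (P k) (A k) w) \<le> 1" for k
      by (intro AE_I2 norm_gauss_char_le P)
  qed (intro measurable_gauss_char P A | simp)+
  then have "(\<lambda>k. complex_of_real (\<integral>\<omega>. exp (- s * (\<Sum>j<d. (A k j \<omega>)\<^sup>2)) \<partial>P k)) \<longlonglongrightarrow>
      complex_of_real (\<integral>\<omega>. exp (- s * (\<Sum>j<d. (A' j \<omega>)\<^sup>2)) \<partial>P')"
    unfolding laplace_sq_norm_eq_char[OF P(1) A(1) s] laplace_sq_norm_eq_char[OF P(2) A(2) s] .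
  then show ?thesis by (simp only: tendsto_of_real_iff)
qed

section \<open>Convergence in distribution\<close>

text \<open>In the variable \<open>u = exp (- x)\<close> the half line becomes a subset of \<open>[0,1]\<close> and the Laplace transform at
  \<open>i\<close> becomes the \<open>i\<close>-th moment. Polynomials in \<open>u\<close> approximate continuous functions uniformly, so moments at
  integers suffice.\<close>

lemma laplace_convergence_imp_weak_conv:
  assumes M: "\<And>k. real_distribution (M k)" "real_distribution M'"
    and pos: "\<And>k. AE x in M k. 0 \<le> x" "AE x in M'. 0 \<le> x"
    and lap: "\<And>i::nat. i > 0 \<Longrightarrow> (\<lambda>k. \<integral>x. exp (- real i * x) \<partial>M k) \<longlonglongrightarrow> (\<integral>x. exp (- real i * x) \<partial>M')"
  shows "weak_conv_m M M'"
proof (rule integral_cts_step_conv_imp_weak_conv[OF M])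
  fix x y :: real assume xy: "x < y"
  \<comment> \<open>The step function vanishes beyond \<open>y\<close>, so cutting the logarithm off near \<open>u = 0\<close> does not change
    it but makes \<open>f\<close> continuous at \<open>0\<close>.\<close>
  define f where "f u = cts_step x y (- ln (max u (exp (- \<bar>y\<bar> - 1))))" for u
  have ctsu: "continuous_on UNIV (cts_step x y)"
    using cts_step_uniformly_continuous[OF xy] by (rule uniformly_continuous_imp_continuous)
  have "continuous_on {0..1} f"
    unfolding f_def
    by (intro continuous_on_compose2[OF ctsu] continuous_intros) (auto simp: max_def dest: sym)
  have f_exp: "f (exp (- z)) = cts_step x y z" for z
  proof (cases "z \<le> \<bar>y\<bar> + 1")
    case True
    then have "max (exp (- z)) (exp (- \<bar>y\<bar> - 1)) = exp (- z)" by (simp add: max_def)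
    then show ?thesis by (simp add: f_def)
  next
    case False
    then have "max (exp (- z)) (exp (- \<bar>y\<bar> - 1)) = exp (- \<bar>y\<bar> - 1)" by (simp add: max_def)
    then show ?thesis using False xy by (simp add: f_def cts_step_def)
  qed
  show "(\<lambda>k. integral\<^sup>L (M k) (cts_step x y)) \<longlonglongrightarrow> integral\<^sup>L M' (cts_step x y)"
  proof (rule LIMSEQ_I)
    fix e :: real assume e: "e > 0"
    obtain g where g: "real_polynomial_function g" "\<And>u. u \<in> {0..1} \<Longrightarrow> \<bar>f u - g u\<bar> < e / 4"
      using Stone_Weierstrass_real_polynomial_function[of "{0..1::real}" f "e / 4"] \<open>continuous_on {0..1} f\<close> e
      by auto
    obtain a n where g_eq: "g = (\<lambda>u. \<Sum>i\<le>n. a i * u ^ i)"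
      using g(1) by (auto simp: real_polynomial_function_iff_sum)
    define p where "p z = (\<Sum>i\<le>n. a i * exp (- real i * z))" for z :: real
    have p_eq: "p z = g (exp (- z))" for z
      by (simp add: p_def g_eq exp_of_nat_mult[symmetric])
    have near: "\<bar>cts_step x y z - p z\<bar> \<le> e / 4" if "z \<ge> 0" for z
      using g(2)[of "exp (- z)"] that by (simp add: p_eq f_exp)
    have int_exp: "integrable N (\<lambda>z. exp (- real i * z))" if "real_distribution N" "AE z in N. 0 \<le> z" for N i
    proof -
      interpret real_distribution N by fact
      show ?thesis
        by (rule integrable_const_bound[of _ 1]) (use that(2) in auto)
    qed
    have ip: "integrable N p" "integral\<^sup>L N p = (\<Sum>i\<le>n. a i * (\<integral>z. exp (- real i * z) \<partial>N))"
      if "real_distribution N" "AE z in N. 0 \<le> z" for N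
      unfolding p_def using int_exp[OF that] by (auto simp: Bochner_Integration.integral_sum)
    have bound: "\<bar>integral\<^sup>L N (cts_step x y) - integral\<^sup>L N p\<bar> \<le> e / 4"
      if "real_distribution N" "AE z in N. 0 \<le> z" for N
    proof -
      interpret real_distribution N by fact
      have "\<bar>integral\<^sup>L N (cts_step x y) - integral\<^sup>L N p\<bar> = \<bar>\<integral>z. cts_step x y z - p z \<partial>N\<bar>"
        using ip(1)[OF that] integrable_cts_step[OF xy] by simp
      also have "\<dots> \<le> (\<integral>z. \<bar>cts_step x y z - p z\<bar> \<partial>N)" by (rule integral_abs_bound)
      also have "\<dots> \<le> (\<integral>z. e / 4 \<partial>N)"
        using ip(1)[OF that] integrable_cts_step[OF xy] near that(2)
        by (intro integral_mono_AE) (auto elim: eventually_mono)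
      finally show ?thesis using prob_space by simp
    qed
    have "(\<lambda>k. \<integral>z. exp (- real i * z) \<partial>M k) \<longlonglongrightarrow> (\<integral>z. exp (- real i * z) \<partial>M')" for i
    proof (cases "i = 0")
      case True
      have "prob_space (M k)" "prob_space M'" for k using M by (auto simp: real_distribution_def)
      then show ?thesis using True by (simp add: prob_space.prob_space)
    qed (use lap in auto)
    then have "(\<lambda>k. integral\<^sup>L (M k) p) \<longlonglongrightarrow> integral\<^sup>L M' p"
      unfolding ip(2)[OF M(1) pos(1)] ip(2)[OF M(2) pos(2)] by (intro tendsto_intros)
    from LIMSEQ_D[OF this, of "e / 4"] e
    obtain K where K: "\<forall>k\<ge>K. \<bar>integral\<^sup>L (M k) p - integral\<^sup>L M' p\<bar> < e / 4"
      by auto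
    show "\<exists>K. \<forall>k\<ge>K. norm (integral\<^sup>L (M k) (cts_step x y) - integral\<^sup>L M' (cts_step x y)) < e"
    proof (intro exI allI impI)
      fix k assume "K \<le> k"
      then show "norm (integral\<^sup>L (M k) (cts_step x y) - integral\<^sup>L M' (cts_step x y)) < e"
        using K[rule_format, of k] bound[OF M(1) pos(1), of k] bound[OF M(2) pos(2)] e unfolding real_norm_def by linarith
    qed
  qed
qed

text \<open>Polya's theorem: pointwise convergence of distribution functions to a continuous one is uniform, so
  that the argument may vary with \<open>k\<close>. By monotonicity it is enough to control finitely many points at
  which the limit takes the values \<open>i / N\<close>.\<close>

lemma weak_conv_continuous_cdf_uniform:
  assumes M: "\<And>k. real_distribution (M k)" "real_distribution M'"
    and conv: "weak_conv_m M M'" and cont: "\<And>x. isCont (cdf M') x"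
  shows "(\<lambda>k. cdf (M k) (t k) - cdf M' (t k)) \<longlonglongrightarrow> 0"
proof (rule LIMSEQ_I)
  fix e :: real assume e: "e > 0"
  interpret M': real_distribution M' by fact
  define G where "G = cdf M'"
  have G_mono: "x \<le> y \<Longrightarrow> G x \<le> G y" for x y unfolding G_def by (rule M'.cdf_nondecreasing)
  have G01: "0 \<le> G x" "G x \<le> 1" for x unfolding G_def by (auto simp: M'.cdf_nonneg M'.cdf_bounded_prob)
  obtain N :: nat where N: "N > 0" "3 / real N < e"
    using reals_Archimedean2[of "3 / e"] e
    by (metis (no_types, opaque_lifting) divide_pos_pos less_trans mult.commute of_nat_0_less_iff
        pos_divide_less_eq zero_less_numeral)
  have "\<exists>x. G x = real i / N" if i: "0 < i" "i < N" for i
  proof -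
    have "0 < real i / N" "real i / N < 1" using i N by auto
    have "\<forall>\<^sub>F x in at_bot. G x < real i / N"
      using M'.cdf_lim_at_bot \<open>0 < real i / N\<close> unfolding G_def by (rule order_tendstoD)
    then obtain a where a: "G a < real i / N" by (auto simp: eventually_at_bot_linorder)
    have "\<forall>\<^sub>F x in at_top. real i / N < G x"
      using M'.cdf_lim_at_top_prob \<open>real i / N < 1\<close> unfolding G_def by (rule order_tendstoD)
    then obtain b where b: "real i / N < G b" by (auto simp: eventually_at_top_linorder)
    have "a \<le> b" using a b G_mono[of b a] by linarith
    then show ?thesis using IVT[of G a "real i / N" b] a b cont by (auto simp: G_def)
  qed
  then obtain q where q: "\<And>i. 0 < i \<Longrightarrow> i < N \<Longrightarrow> G (q i) = real i / N" by metis
  have "\<forall>\<^sub>F k in sequentially. \<forall>i\<in>{0<..<N}. \<bar>cdf (M k) (q i) - G (q i)\<bar> < 1 / N"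
  proof (rule eventually_ball_finite; safe)
    fix i
    have "(\<lambda>k. cdf (M k) (q i)) \<longlonglongrightarrow> G (q i)"
      using conv cont unfolding weak_conv_m_def weak_conv_def G_def by auto
    then show "\<forall>\<^sub>F k in sequentially. \<bar>cdf (M k) (q i) - G (q i)\<bar> < 1 / N"
      using N by (auto dest!: tendstoD[where e="1/N"] simp: dist_real_def)
  qed
  then obtain K where K: "\<And>k i. k \<ge> K \<Longrightarrow> 0 < i \<Longrightarrow> i < N \<Longrightarrow> \<bar>cdf (M k) (q i) - G (q i)\<bar> < 1 / N"
    unfolding eventually_sequentially by (meson greaterThanLessThan_iff)
  show "\<exists>K. \<forall>k\<ge>K. norm (cdf (M k) (t k) - cdf M' (t k) - 0) < e"
  proof (intro exI allI impI)
    fix k assume k: "K \<le> k"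
    interpret Mk: real_distribution "M k" by fact
    define T where "T = t k"
    \<comment> \<open>The neighbouring grid values \<open>(i - 1) / N\<close> and \<open>(i + 1) / N\<close> differ strictly from \<open>G T\<close>; this
      fixes the order of the grid points and \<open>T\<close> although \<open>G\<close> may be constant somewhere.\<close>
    define i where "i = nat \<lfloor>N * G T\<rfloor>"
    have i: "real i \<le> N * G T" "N * G T < real i + 1"
      using G01 by (auto simp: i_def)
    have iN: "real i / N \<le> G T" "G T < real i / N + 1 / N"
      using i N by (auto simp: field_simps)
    have lower: "G T - 3 / N < cdf (M k) T"
    proof (cases "1 < i")
      case True
      have "i \<le> N" using i(1) G01(2)[of T] N by (smt (verit) mult_left_le of_nat_0_le_iff of_nat_le_iff)
      then have qi: "G (q (i - 1)) = real i / N - 1 / N"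
        using q[of "i-1"] True by (simp add: diff_divide_distrib of_nat_diff)
      have "q (i - 1) \<le> T"
        using G_mono[of T "q (i - 1)"] qi iN N by (smt (verit) divide_pos_pos of_nat_0_less_iff)
      then have "cdf (M k) (q (i-1)) \<le> cdf (M k) T" by (rule Mk.cdf_nondecreasing)
      moreover have "\<bar>cdf (M k) (q (i-1)) - G (q (i-1))\<bar> < 1 / N"
        using K[OF k, of "i-1"] \<open>i \<le> N\<close> True by simp
      moreover have "3 / real N = 3 * (1 / N)" by simp
      ultimately show ?thesis using iN qi by linarith
    next
      case False
      then have "real i / N \<le> 1 / N" using N by (simp add: divide_right_mono)
      then show ?thesis using iN Mk.cdf_nonneg[of T] N
        by (smt (verit) add_divide_distrib divide_pos_pos of_nat_0_less_iff)
    qed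
    have upper: "cdf (M k) T < G T + 3 / N"
    proof (cases "i + 1 < N")
      case True
      then have qi: "G (q (i + 1)) = real i / N + 1 / N"
        using q[of "i+1"] by (simp add: add_divide_distrib)
      have "T \<le> q (i + 1)"
        using G_mono[of "q (i + 1)" T] qi iN by linarith
      then have "cdf (M k) T \<le> cdf (M k) (q (i+1))" by (rule Mk.cdf_nondecreasing)
      moreover have "\<bar>cdf (M k) (q (i+1)) - G (q (i+1))\<bar> < 1 / N"
        using K[OF k, of "i+1"] True by simp
      moreover have "3 / real N = 3 * (1 / N)" by simp
      ultimately show ?thesis using iN qi by linarith
    next
      case False
      then have "real N - 1 \<le> real i" by linarith
      then have "(real N - 1) / N \<le> real i / N" using N by (intro divide_right_mono) auto
      then have "1 - 1 / N \<le> real i / N" using N by (simp add: field_simps)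
      then show ?thesis using iN Mk.cdf_bounded_prob[of T] N
        by (smt (verit) divide_strict_right_mono of_nat_0_less_iff)
    qed
    show "norm (cdf (M k) (t k) - cdf M' (t k) - 0) < e"
      using lower upper N(2) unfolding T_def G_def real_norm_def by linarith
  qed
qed

section \<open>Shifted normal variables in dimension one\<close>

lemma std_normal_interval_measure:
  obtains \<Phi> :: "real \<Rightarrow> real" where
    "\<And>x. (\<Phi> has_real_derivative std_normal_density x) (at x)"
    "\<And>a b. a \<le> b \<Longrightarrow> measure stdN {a..b} = \<Phi> b - \<Phi> a"
proof -
  let ?\<Phi> = "\<lambda>u::real. LBINT y=ereal 0..u. std_normal_density y"
  have cont: "continuous_on S std_normal_density" for S
    unfolding std_normal_density_def by (intro continuous_intros) auto
  have der: "(?\<Phi> has_real_derivative std_normal_density x) (at x)" for x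
  proof -
    define B where "B = \<bar>x\<bar> + 1"
    have "(?\<Phi> has_vector_derivative std_normal_density x) (at x within {-B..B})"
      by (rule interval_integral_FTC2) (auto simp: B_def intro: cont)
    moreover have "at x within {-B..B} = at x"
      by (rule at_within_interior) (auto simp: B_def)
    ultimately show ?thesis by (simp add: has_real_derivative_iff_has_vector_derivative)
  qed
  have "measure stdN {a..b} = ?\<Phi> b - ?\<Phi> a" if "a \<le> b" for a b
  proof -
    have "emeasure stdN {a..b} = (\<integral>\<^sup>+x. ennreal (std_normal_density x) * indicator {a..b} x \<partial>lborel)"
      by (subst emeasure_density) auto
    also have "\<dots> = ennreal (?\<Phi> b - ?\<Phi> a)"
      using that by (intro nn_integral_FTC_Icc) (auto intro: has_field_derivative_at_within[OF der])
    finally have *: "emeasure stdN {a..b} = ennreal (?\<Phi> b - ?\<Phi> a)" .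
    have "?\<Phi> a \<le> ?\<Phi> b"
      by (rule DERIV_nonneg_imp_nondecreasing[OF that]) (use der normal_density_nonneg in blast)
    with * show ?thesis by (simp add: measure_def)
  qed
  with der show thesis by (rule that)
qed

text \<open>Anderson's inequality in dimension one. The mass of the interval shifted by \<open>y\<close> has derivative
  \<open>\<phi> (- \<rho> - y) - \<phi> (\<rho> - y)\<close> in \<open>y\<close>, which has the sign opposite to \<open>y\<close> because the density \<open>\<phi>\<close> decreases
  in the distance from \<open>0\<close>.\<close>

lemma std_normal_interval_shift_less:
  assumes "0 < \<rho>" "\<eta> \<noteq> 0"
  shows "measure stdN {-\<rho>-\<eta>..\<rho>-\<eta>} < measure stdN {-\<rho>..\<rho>}"
proof -
  obtain \<Phi> where der: "\<And>x. (\<Phi> has_real_derivative std_normal_density x) (at x)"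
    and \<Phi>: "\<And>a b. a \<le> b \<Longrightarrow> measure stdN {a..b} = \<Phi> b - \<Phi> a"
    using std_normal_interval_measure by metis
  define g where "g y = \<Phi> (\<rho> - y) - \<Phi> (- \<rho> - y)" for y
  have dg: "(g has_real_derivative (std_normal_density (- \<rho> - y) - std_normal_density (\<rho> - y))) (at y)" for y
  proof -
    have "((\<lambda>y. \<Phi> (c - y)) has_real_derivative std_normal_density (c - y) * (- 1)) (at y)" for c
      by (rule DERIV_chain2[OF der]) (auto intro!: derivative_eq_intros)
    from DERIV_diff[OF this[of \<rho>] this[of "- \<rho>"]] show ?thesis by (simp add: g_def[abs_def])
  qed
  have cont: "continuous_on S g" for S
    by (intro continuous_at_imp_continuous_on ballI DERIV_isCont[OF dg])
  have sgn: "std_normal_density a < std_normal_density b" if "b\<^sup>2 < a\<^sup>2" for a b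
    using that by (simp add: std_normal_density_def divide_strict_right_mono)
  have "g \<eta> < g 0"
  proof (cases "\<eta> > 0")
    case True
    show ?thesis
    proof (rule DERIV_neg_imp_decreasing_open[OF True _ cont])
      fix y assume "0 < y" "y < \<eta>"
      then have "(\<rho> - y)\<^sup>2 < (- \<rho> - y)\<^sup>2" using \<open>0 < \<rho>\<close> by (simp add: power2_eq_square algebra_simps)
      then show "\<exists>z. (g has_real_derivative z) (at y) \<and> z < 0" using dg[of y] sgn[of "\<rho> - y" "- \<rho> - y"] by (metis diff_less_0_iff_less)
    qed
  next
    case False
    then have "\<eta> < 0" using assms by simp
    then show ?thesis
    proof (rule DERIV_pos_imp_increasing_open[OF _ _ cont])
      fix y assume "\<eta> < y" "y < 0"
      then have "(- \<rho> - y)\<^sup>2 < (\<rho> - y)\<^sup>2" using \<open>0 < \<rho>\<close> \<open>y < 0\<close> by (simp add: power2_eq_square algebra_simps mult_pos_neg)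
      then show "\<exists>z. (g has_real_derivative z) (at y) \<and> 0 < z" using dg[of y] sgn[of "- \<rho> - y" "\<rho> - y"] by (metis diff_gt_0_iff_gt)
    qed
  qed
  then show ?thesis using \<Phi> assms by (simp add: g_def)
qed

text \<open>The distribution function of the square of a normal variable with mean \<open>h\<close> and standard deviation \<open>\<sigma>\<close>,
  i.e. of one summand of the limit of the statistic.\<close>

definition sq_cdf :: "real \<Rightarrow> real \<Rightarrow> real \<Rightarrow> real" where
  "sq_cdf \<sigma> h u = measure stdN {x. (\<sigma> * x + h)\<^sup>2 \<le> u}"

lemma sq_le_interval:
  assumes "\<sigma> > 0" "u \<ge> 0"
  shows "{x. (\<sigma> * x + h)\<^sup>2 \<le> u} = {- (sqrt u / \<sigma>) - h / \<sigma> .. sqrt u / \<sigma> - h / \<sigma>}"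
proof -
  have "(\<sigma> * x + h)\<^sup>2 \<le> u \<longleftrightarrow> \<bar>\<sigma> * x + h\<bar> \<le> sqrt u" for x
    using real_sqrt_le_iff[of "(\<sigma> * x + h)\<^sup>2" u] by simp
  moreover have "\<bar>\<sigma> * x + h\<bar> \<le> sqrt u \<longleftrightarrow> (- sqrt u - h) / \<sigma> \<le> x \<and> x \<le> (sqrt u - h) / \<sigma>" for x
    unfolding pos_divide_le_eq[OF \<open>\<sigma> > 0\<close>] pos_le_divide_eq[OF \<open>\<sigma> > 0\<close>] by (simp add: mult.commute) linarith
  ultimately show ?thesis by (simp add: diff_divide_distrib set_eq_iff)
qed

lemma sq_cdf_neg: "u < 0 \<Longrightarrow> sq_cdf \<sigma> h u = 0"
proof -
  assume "u < 0"
  then have "\<not> (\<sigma> * x + h)\<^sup>2 \<le> u" for x using zero_le_power2[of "\<sigma> * x + h"] by linarith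
  then show ?thesis by (simp add: sq_cdf_def)
qed

lemma sq_cdf_nonneg: "0 \<le> sq_cdf \<sigma> h u"
  by (simp add: sq_cdf_def)

lemma sq_cdf_mono: "u \<le> v \<Longrightarrow> sq_cdf \<sigma> h u \<le> sq_cdf \<sigma> h v"
proof -
  assume "u \<le> v"
  then show ?thesis unfolding sq_cdf_def by (intro N.finite_measure_mono) (auto intro: order_trans)
qed

lemma sq_cdf_shift_less:
  assumes "\<sigma> > 0" "u > 0" "h \<noteq> 0"
  shows "sq_cdf \<sigma> h u < sq_cdf \<sigma> 0 u"
  using std_normal_interval_shift_less[of "sqrt u / \<sigma>" "h / \<sigma>"] assms
  by (simp add: sq_cdf_def sq_le_interval sq_le_interval[where h=0, simplified])

lemma sq_cdf_no_atom:
  assumes "\<sigma> > 0"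
  shows "measure stdN {x. (\<sigma> * x + h)\<^sup>2 = u} = 0"
proof -
  have "{x. (\<sigma> * x + h)\<^sup>2 = u} \<subseteq> {(sqrt u - h) / \<sigma>, (- sqrt u - h) / \<sigma>}"
  proof
    fix x assume "x \<in> {x. (\<sigma> * x + h)\<^sup>2 = u}"
    then have "\<bar>\<sigma> * x + h\<bar> = sqrt u" using real_sqrt_abs[of "\<sigma> * x + h"] by simp
    then have "\<sigma> * x = sqrt u - h \<or> \<sigma> * x = - sqrt u - h" by linarith
    then show "x \<in> {(sqrt u - h) / \<sigma>, (- sqrt u - h) / \<sigma>}" using assms by (auto simp: eq_divide_eq mult.commute)
  qed
  then have "finite {x. (\<sigma> * x + h)\<^sup>2 = u}" by (rule finite_subset) auto
  then have "{x. (\<sigma> * x + h)\<^sup>2 = u} \<in> null_sets lborel"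
    by (rule finite_imp_null_set_lborel)
  then have "AE x in stdN. x \<notin> {x. (\<sigma> * x + h)\<^sup>2 = u}"
    by (subst AE_density) (auto dest: AE_not_in)
  then have "emeasure stdN {x. (\<sigma> * x + h)\<^sup>2 = u} = 0"
    by (subst (asm) AE_iff_measurable[OF _ refl]) auto
  then show ?thesis by (simp add: measure_def)
qed

lemma sq_cdf_shift_le:
  assumes "\<sigma> > 0"
  shows "sq_cdf \<sigma> h u \<le> sq_cdf \<sigma> 0 u"
proof -
  consider "u < 0" | "u = 0" | "u > 0" by linarith
  then show ?thesis
  proof cases
    case 1 then show ?thesis by (simp add: sq_cdf_neg)
  next
    case 2
    then show ?thesis using sq_cdf_no_atom[OF assms, of h 0] sq_cdf_nonneg[of \<sigma> 0 u] by (simp add: sq_cdf_def)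
  next
    case 3
    then show ?thesis using sq_cdf_shift_less[OF assms 3, of h] by (cases "h = 0") auto
  qed
qed

lemma sq_cdf_less:
  assumes "\<sigma> > 0" "u > 0" "r \<ge> 0" "h \<noteq> 0 \<or> r > 0"
  shows "sq_cdf \<sigma> h (u - r) < sq_cdf \<sigma> 0 u"
proof (cases "h = 0")
  case False
  then show ?thesis using sq_cdf_mono[of "u - r" u \<sigma> h] sq_cdf_shift_less[of \<sigma> u h] assms by simp
next
  case True
  then have r: "r > 0" using assms by simp
  obtain \<Phi> where der: "\<And>x. (\<Phi> has_real_derivative std_normal_density x) (at x)"
    and \<Phi>: "\<And>a b. a \<le> b \<Longrightarrow> measure stdN {a..b} = \<Phi> b - \<Phi> a"
    using std_normal_interval_measure by metis
  have mono: "a < b \<Longrightarrow> \<Phi> a < \<Phi> b" for a b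
    by (rule DERIV_pos_imp_increasing[of a b \<Phi>]) (auto intro!: exI[of _ "std_normal_density _"] der normal_density_pos)
  show ?thesis
  proof (cases "u - r \<ge> 0")
    case True
    have "sqrt (u - r) / \<sigma> < sqrt u / \<sigma>" using r assms by (intro divide_strict_right_mono) auto
    then have "\<Phi> (sqrt (u - r) / \<sigma>) < \<Phi> (sqrt u / \<sigma>)" "\<Phi> (- (sqrt u / \<sigma>)) < \<Phi> (- (sqrt (u - r) / \<sigma>))"
      by (auto intro: mono)
    then show ?thesis using True assms \<open>h = 0\<close> by (simp add: sq_cdf_def sq_le_interval sq_le_interval[where h=0, simplified] \<Phi>)
  next
    case False
    have "sqrt u / \<sigma> > 0" using assms by simp
    then have "\<Phi> (- (sqrt u / \<sigma>)) < \<Phi> (sqrt u / \<sigma>)" by (intro mono) linarith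
    then show ?thesis using False assms by (simp add: sq_cdf_neg) (simp add: sq_cdf_def sq_le_interval sq_le_interval[where h=0, simplified] \<Phi>)
  qed
qed

lemma sq_cdf_pos: "\<sigma> > 0 \<Longrightarrow> u > 0 \<Longrightarrow> 0 < sq_cdf \<sigma> 0 u"
  using sq_cdf_less[of \<sigma> u 1 0] sq_cdf_nonneg[of \<sigma> 0 "u - 1"] by simp

lemma std_normal_second_moment:
  "integrable stdN (\<lambda>x. (\<sigma> * x + h)\<^sup>2)"
  "(\<integral>x. (\<sigma> * x + h)\<^sup>2 \<partial>stdN) = \<sigma>\<^sup>2 + h\<^sup>2"
proof -
  have i2: "integrable stdN (\<lambda>x. x\<^sup>2)" using integrable_std_normal_distribution_moment[of 2] .
  have i1: "integrable stdN (\<lambda>x. x)" using integrable_std_normal_distribution_moment[of 1] by simp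
  have e: "(\<sigma> * x + h)\<^sup>2 = \<sigma>\<^sup>2 * x\<^sup>2 + (2 * \<sigma> * h) * x + h\<^sup>2" for x :: real
    by (simp add: power2_eq_square algebra_simps)
  show "integrable stdN (\<lambda>x. (\<sigma> * x + h)\<^sup>2)"
    unfolding e using i1 i2 by (intro Bochner_Integration.integrable_add integrable_mult_right) auto
  have m2: "(\<integral>x. x\<^sup>2 \<partial>stdN) = 1"
    using std_normal_distribution_even_moments(1)[of 1] by (simp add: fact_numeral)
  have m1: "(\<integral>x. x \<partial>stdN) = 0"
    using integral_std_normal_distribution_moment_odd[of 1] by simp
  show "(\<integral>x. (\<sigma> * x + h)\<^sup>2 \<partial>stdN) = \<sigma>\<^sup>2 + h\<^sup>2"
    unfolding e using i1 i2 m1 m2 N.prob_space by simp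
qed

section \<open>The squared norm of a shifted Brownian bridge\<close>

text \<open>Standard deviations of the coefficients of a Brownian bridge in the basis of sine functions
  (its Karhunen-Loeve expansion). Index \<open>j\<close> belongs to frequency \<open>j + 1\<close>.\<close>

definition sig :: "nat \<Rightarrow> real" where "sig j = 1 / (pi * (real j + 1))"

lemma sig_pos: "sig j > 0" by (simp add: sig_def add_pos_nonneg)

lemma sig_sq_sums: "(\<lambda>j. (sig j)\<^sup>2) sums (1 / 6)"
proof -
  have "(\<lambda>j. (1 / pi\<^sup>2) * (1 / (real j + 1)\<^sup>2)) sums ((1 / pi\<^sup>2) * (pi\<^sup>2 / 6))"
    using inverse_squares_sums by (intro sums_mult) (simp add: add.commute)
  then show ?thesis by (simp add: sig_def power_mult_distrib power_divide)
qed

text \<open>The squared norm of a Brownian bridge shifted by a function with sine coefficients \<open>h\<close>. The series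
  converges for almost every \<open>w\<close> by \<open>AE_summable_gauss\<close>.\<close>

definition gauss_norm2 :: "(nat \<Rightarrow> real) \<Rightarrow> (nat \<Rightarrow> real) \<Rightarrow> real" where
  "gauss_norm2 h w = (\<Sum>j. (sig j * w j + h j)\<^sup>2)"

lemma measurable_gauss_norm2 [measurable]: "gauss_norm2 h \<in> borel_measurable (PiM UNIV (\<lambda>_. borel))"
  unfolding gauss_norm2_def[abs_def] by measurable

lemma measurable_gauss_norm2' [measurable]: "gauss_norm2 h \<in> borel_measurable gauss_seq"
  by measurable

text \<open>The expectation of the series is \<open>1/6 + (\<Sum>j. (h j)\<^sup>2)\<close>, hence finite.\<close>

lemma AE_summable_gauss:
  assumes h: "summable (\<lambda>j. (h j)\<^sup>2)"
  shows "AE w in gauss_seq. summable (\<lambda>j. (sig j * w j + h j)\<^sup>2)"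
proof -
  let ?f = "\<lambda>j w. (sig j * w j + h j)\<^sup>2"
  have int: "integrable gauss_seq (?f j)" "(\<integral>w. ?f j w \<partial>gauss_seq) = (sig j)\<^sup>2 + (h j)\<^sup>2" for j
    using integral_coordinate[OF prob_space_std_normal UNIV_I std_normal_second_moment(1)[of "sig j" "h j"], of j]
    by (auto simp: gauss_seq_def std_normal_second_moment)
  have "(\<integral>\<^sup>+w. (\<Sum>j. ennreal (?f j w)) \<partial>gauss_seq) = (\<Sum>j. \<integral>\<^sup>+w. ennreal (?f j w) \<partial>gauss_seq)"
    by (intro nn_integral_suminf) measurable
  also have "\<dots> = (\<Sum>j. ennreal ((sig j)\<^sup>2 + (h j)\<^sup>2))"
    using int by (subst nn_integral_eq_integral) auto
  also have "\<dots> < \<infinity>"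
    using summable_add[OF sums_summable[OF sig_sq_sums] h]
    by (subst suminf_ennreal2) (auto simp: less_top)
  finally have "AE w in gauss_seq. (\<Sum>j. ennreal (?f j w)) \<noteq> \<infinity>"
    by (intro nn_integral_PInf_AE) auto
  then show ?thesis
    by eventually_elim (auto intro: summable_suminf_not_top)
qed

text \<open>Redrawing one coordinate independently preserves the law. Thereby one coordinate of the infinite
  product can be integrated separately while all others are kept fixed.\<close>

lemma gauss_seq_resample:
  "distr (gauss_seq \<Otimes>\<^sub>M stdN) gauss_seq (\<lambda>(w, x). w(j := x)) = gauss_seq"
proof -
  let ?N = stdN
  interpret NG: pair_sigma_finite ?N gauss_seq by unfold_locales
  have m: "(\<lambda>(x, w). w(j := x)) \<in> measurable (?N \<Otimes>\<^sub>M gauss_seq) gauss_seq"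
    using measurable_fun_upd[of UNIV UNIV j "snd" "?N \<Otimes>\<^sub>M gauss_seq" "\<lambda>_. ?N" "fst"]
    by (simp add: split_beta' gauss_seq_def)
  have "distr (?N \<Otimes>\<^sub>M gauss_seq) gauss_seq (\<lambda>(x, w). w(j := x)) = gauss_seq"
    using distr_pair_PiM_eq_PiM[of UNIV "\<lambda>_. ?N" j] prob_space_std_normal by (simp add: gauss_seq_def)
  moreover have "?N \<Otimes>\<^sub>M gauss_seq = distr (gauss_seq \<Otimes>\<^sub>M ?N) (?N \<Otimes>\<^sub>M gauss_seq) (\<lambda>(x, y). (y, x))"
    by (rule NG.distr_pair_swap)
  ultimately have "gauss_seq = distr (distr (gauss_seq \<Otimes>\<^sub>M ?N) (?N \<Otimes>\<^sub>M gauss_seq) (\<lambda>(x, y). (y, x))) gauss_seq (\<lambda>(x, w). w(j := x))"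
    by metis
  also have "\<dots> = distr (gauss_seq \<Otimes>\<^sub>M ?N) gauss_seq ((\<lambda>(x, w). w(j := x)) \<circ> (\<lambda>(x, y). (y, x)))"
    by (rule distr_distr[OF m measurable_pair_swap'])
  also have "(\<lambda>(x, w). w(j := x)) \<circ> (\<lambda>(x, y). (y, x)) = (\<lambda>(w::nat \<Rightarrow> real, x). w(j := x))"
    by (simp add: comp_def split_beta')
  finally show ?thesis ..
qed

lemma measurable_resample: "(\<lambda>(w, x). w(j := x)) \<in> measurable (gauss_seq \<Otimes>\<^sub>M stdN) gauss_seq"
  using measurable_fun_upd[of UNIV UNIV j "fst" "gauss_seq \<Otimes>\<^sub>M stdN" "\<lambda>_. stdN" "snd"]
  by (simp add: split_beta' gauss_seq_def)

lemma AE_gauss_seq_resample: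
  assumes "AE w in gauss_seq. P w"
  shows "AE w in gauss_seq. AE x in stdN. P (w(j := x))"
proof -
  interpret GN: pair_sigma_finite gauss_seq stdN by unfold_locales
  have "AE z in distr (gauss_seq \<Otimes>\<^sub>M stdN) gauss_seq (\<lambda>(w, x). w(j := x)). P z"
    using assms by (simp only: gauss_seq_resample)
  from AE_distrD[OF measurable_resample this]
  have "AE z in gauss_seq \<Otimes>\<^sub>M stdN. P ((fst z)(j := snd z))" by (simp add: split_beta')
  from GN.AE_pair[OF this] show ?thesis by simp
qed

lemma prob_gauss_seq_resample:
  assumes A: "{w. P w} \<in> sets gauss_seq"
  shows "measure gauss_seq {w. P w} = (\<integral>w. measure stdN {x. P (w(j := x))} \<partial>gauss_seq)"
    and "integrable gauss_seq (\<lambda>w. measure stdN {x. P (w(j := x))})"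
proof -
  let ?GN = "gauss_seq \<Otimes>\<^sub>M stdN"
  let ?u = "\<lambda>(w::nat \<Rightarrow> real, x). w(j := x)"
  have B: "?u -` {w. P w} \<inter> space ?GN \<in> sets ?GN"
    by (rule measurable_sets[OF measurable_resample A])
  have sec: "Pair w -` (?u -` {w. P w} \<inter> space ?GN) = {x. P (w(j := x))}" for w
    by (auto simp: space_pair_measure)
  have "emeasure gauss_seq {w. P w} = emeasure (distr ?GN gauss_seq ?u) {w. P w}"
    by (simp only: gauss_seq_resample)
  also have "\<dots> = emeasure ?GN (?u -` {w. P w} \<inter> space ?GN)"
    by (rule emeasure_distr[OF measurable_resample A])
  also have "\<dots> = (\<integral>\<^sup>+w. emeasure stdN {x. P (w(j := x))} \<partial>gauss_seq)"
    by (subst N.emeasure_pair_measure_alt[OF B]) (simp only: sec)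
  finally have eq: "ennreal (measure gauss_seq {w. P w}) = (\<integral>\<^sup>+w. ennreal (measure stdN {x. P (w(j := x))}) \<partial>gauss_seq)"
    by (simp add: G.emeasure_eq_measure N.emeasure_eq_measure)
  have [measurable]: "(\<lambda>w. measure stdN {x. P (w(j := x))}) \<in> borel_measurable gauss_seq"
    using N.measurable_emeasure_Pair[OF B] unfolding sec measure_def by measurable
  show int: "integrable gauss_seq (\<lambda>w. measure stdN {x. P (w(j := x))})"
    by (rule G.integrable_const_bound[of _ 1]) (auto simp: N.prob_le_1)
  show "measure gauss_seq {w. P w} = (\<integral>w. measure stdN {x. P (w(j := x))} \<partial>gauss_seq)"
    using eq nn_integral_eq_integral[OF int] by (simp add: integral_nonneg_AE)
qed

text \<open>The terms of the series other than the \<open>j\<close>-th. It does not depend on \<open>w j\<close>, so that conditionally on it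
  the series has the law described by \<open>sq_cdf\<close>.\<close>

definition rest :: "nat \<Rightarrow> (nat \<Rightarrow> real) \<Rightarrow> (nat \<Rightarrow> real) \<Rightarrow> real" where
  "rest j h w = gauss_norm2 (h(j := 0)) (w(j := 0))"

lemma summable_gauss_upd:
  assumes "summable (\<lambda>i. (sig i * w i + h i)\<^sup>2)"
  shows "summable (\<lambda>i. (sig i * (w(j := x)) i + (h(j := c)) i)\<^sup>2)"
  using summable_add[OF assms sums_summable[OF sums_single[of j "\<lambda>i. (sig i * x + c)\<^sup>2 - (sig i * w i + h i)\<^sup>2"]]]
  by (rule summable_cong[THEN iffD1, rotated]) (auto intro!: always_eventually)

lemma gauss_norm2_upd:
  assumes "summable (\<lambda>i. (sig i * w i + h i)\<^sup>2)"
  shows "gauss_norm2 (h(j := c)) (w(j := x)) = (sig j * x + c)\<^sup>2 + rest j h w"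
proof -
  let ?f = "\<lambda>i. (sig i * (w(j := 0)) i + (h(j := 0)) i)\<^sup>2"
  have "(\<lambda>i. (if i = j then (sig i * x + c)\<^sup>2 else 0) + ?f i) sums ((sig j * x + c)\<^sup>2 + suminf ?f)"
    by (intro sums_add sums_single summable_sums summable_gauss_upd assms)
  moreover have "(\<lambda>i. (if i = j then (sig i * x + c)\<^sup>2 else 0) + ?f i) =
      (\<lambda>i. (sig i * (w(j := x)) i + (h(j := c)) i)\<^sup>2)"
    by auto
  ultimately show ?thesis
    unfolding gauss_norm2_def rest_def by (simp add: sums_iff)
qed

definition gauss_cdf :: "(nat \<Rightarrow> real) \<Rightarrow> real \<Rightarrow> real" where
  "gauss_cdf h t = measure gauss_seq {v. gauss_norm2 h v \<le> t}"

lemma prob_gauss_norm2_le: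
  assumes h: "summable (\<lambda>j. (h j)\<^sup>2)"
  shows "gauss_cdf (h(j := c)) t = (\<integral>w. sq_cdf (sig j) c (t - rest j h w) \<partial>gauss_seq)"
    "integrable gauss_seq (\<lambda>w. sq_cdf (sig j) c (t - rest j h w))"
proof -
  have S: "{w. gauss_norm2 (h(j := c)) w \<le> t} \<in> sets gauss_seq"
    using measurable_sets[OF measurable_gauss_norm2', of "{..t}" "h(j := c)"] by (simp add: vimage_def)
  note R = prob_gauss_seq_resample[OF S, of j]
  have ae: "AE w in gauss_seq. measure stdN {x. gauss_norm2 (h(j := c)) (w(j := x)) \<le> t} =
      sq_cdf (sig j) c (t - rest j h w)"
    using AE_summable_gauss[OF h]
  proof eventually_elim
    fix w assume "summable (\<lambda>j. (sig j * w j + h j)\<^sup>2)"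
    then have "{x. gauss_norm2 (h(j := c)) (w(j := x)) \<le> t} = {x. (sig j * x + c)\<^sup>2 \<le> t - rest j h w}"
      by (auto simp: gauss_norm2_upd algebra_simps)
    then show "measure stdN {x. gauss_norm2 (h(j := c)) (w(j := x)) \<le> t} =
      sq_cdf (sig j) c (t - rest j h w)" by (simp add: sq_cdf_def)
  qed
  have [measurable]: "rest j h \<in> borel_measurable gauss_seq"
  proof -
    have [measurable]: "(\<lambda>w. w(j := 0)) \<in> measurable (PiM UNIV (\<lambda>_. borel)) (PiM UNIV (\<lambda>_::nat. borel :: real measure))"
      using measurable_fun_upd[of UNIV UNIV j "\<lambda>w. w" "PiM UNIV (\<lambda>_. borel)" "\<lambda>_. borel" "\<lambda>_. 0"] by simp
    show ?thesis unfolding rest_def[abs_def] by measurable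
  qed
  have [measurable]: "sq_cdf (sig j) c \<in> borel_measurable borel"
    by (rule borel_measurable_mono) (auto simp: mono_def sq_cdf_mono)
  show "gauss_cdf (h(j := c)) t = (\<integral>w. sq_cdf (sig j) c (t - rest j h w) \<partial>gauss_seq)"
    unfolding gauss_cdf_def R(1) by (rule integral_cong_AE) (use ae R(2) in auto)
  show "integrable gauss_seq (\<lambda>w. sq_cdf (sig j) c (t - rest j h w))"
    using R(2) by (rule integrable_cong_AE_imp) (use ae in \<open>auto\<close>)
qed

text \<open>With all coordinates but one fixed, a quadratic equation determines the remaining one, which has a
  continuous distribution.\<close>

lemma gauss_norm2_no_atom:
  assumes h: "summable (\<lambda>j. (h j)\<^sup>2)"
  shows "AE w in gauss_seq. gauss_norm2 h w \<noteq> t"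
proof -
  have S: "{w. gauss_norm2 h w = t} \<in> sets gauss_seq"
    using measurable_sets[OF measurable_gauss_norm2', of "{t}" h] by (simp add: vimage_def)
  have ae: "AE w in gauss_seq. measure stdN {x. gauss_norm2 h (w(0 := x)) = t} = 0"
    using AE_summable_gauss[OF h]
  proof eventually_elim
    fix w assume s: "summable (\<lambda>j. (sig j * w j + h j)\<^sup>2)"
    have "{x. gauss_norm2 h (w(0 := x)) = t} = {x. (sig 0 * x + h 0)\<^sup>2 = t - rest 0 h w}"
      using gauss_norm2_upd[OF s, of 0 "h 0"] by (auto simp: algebra_simps)
    then show "measure stdN {x. gauss_norm2 h (w(0 := x)) = t} = 0"
      by (simp add: sq_cdf_no_atom sig_pos)
  qed
  have "measure gauss_seq {w. gauss_norm2 h w = t} = (\<integral>w. 0 \<partial>gauss_seq)"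
    unfolding prob_gauss_seq_resample(1)[OF S, of 0]
    by (rule integral_cong_AE) (use ae prob_gauss_seq_resample(2)[OF S, of 0] in auto)
  then have "emeasure gauss_seq {w. gauss_norm2 h w = t} = 0" by (simp add: G.emeasure_eq_measure)
  then show ?thesis using S by (subst AE_iff_measurable[OF S]) auto
qed

text \<open>Strictness in Anderson's inequality needs that the remaining coordinates leave room below the level
  with positive probability.\<close>

lemma gauss_norm2_small_ball:
  assumes u: "u > 0"
  shows "0 < measure gauss_seq {w. gauss_norm2 (\<lambda>_. 0) w < u}"
proof -
  \<comment> \<open>\<open>Q d\<close> says that the sum over the indices \<open>i \<ge> d\<close> avoids the interval below \<open>u\<close>. It passes from
    \<open>d\<close> to \<open>d + 1\<close>, since coordinate \<open>d\<close> can be arbitrarily small, but it fails for large \<open>d\<close>.\<close>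
  define tl where "tl d w = gauss_norm2 (\<lambda>_. 0) (\<lambda>i. if i < d then 0 else w i)" for d and w :: "nat \<Rightarrow> real"
  define Q where "Q d \<longleftrightarrow> (AE w in gauss_seq. \<not> tl d w < u)" for d
  have sm: "AE w in gauss_seq. summable (\<lambda>j. (sig j * w j)\<^sup>2)"
    using AE_summable_gauss[of "\<lambda>_. 0"] by simp
  have tl_eq: "tl d w = (\<Sum>i. if i < d then 0 else (sig i * w i)\<^sup>2)" for d w
    unfolding tl_def gauss_norm2_def by (intro suminf_cong) auto
  have sm_tl: "summable (\<lambda>i. if i < d then 0 else (sig i * w i)\<^sup>2)" if "summable (\<lambda>j. (sig j * w j)\<^sup>2)" for d w
    using that by (rule summable_comparison_test'[where N=0]) auto
  have step: "Q (Suc d)" if "Q d" for d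
  proof -
    have "AE w in gauss_seq. AE x in stdN. \<not> tl d (w(d := x)) < u"
      using that unfolding Q_def by (rule AE_gauss_seq_resample)
    then show ?thesis
      unfolding Q_def using sm
    proof eventually_elim
      fix w assume ae: "AE x in stdN. \<not> tl d (w(d := x)) < u"
        and s: "summable (\<lambda>j. (sig j * w j)\<^sup>2)"
      have eq: "tl d (w(d := x)) = (sig d * x)\<^sup>2 + tl (Suc d) w" for x
      proof -
        have "(\<lambda>i. (if i = d then (sig i * x)\<^sup>2 else 0) + (if i < Suc d then 0 else (sig i * w i)\<^sup>2)) sums
          ((sig d * x)\<^sup>2 + tl (Suc d) w)"
          unfolding tl_eq by (intro sums_add sums_single summable_sums sm_tl s)
        moreover have "(\<lambda>i. (if i = d then (sig i * x)\<^sup>2 else 0) + (if i < Suc d then 0 else (sig i * w i)\<^sup>2)) =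
           (\<lambda>i. if i < d then 0 else (sig i * (w(d := x)) i)\<^sup>2)" by auto
        ultimately show ?thesis unfolding tl_eq by (simp add: sums_iff)
      qed
      show "\<not> tl (Suc d) w < u"
      proof
        assume l: "tl (Suc d) w < u"
        define v where "v = (u - tl (Suc d) w) / 2"
        have v: "v > 0" "v + tl (Suc d) w < u" using l by (auto simp: v_def field_simps)
        have "AE x in stdN. x \<notin> {x. (sig d * x + 0)\<^sup>2 \<le> v}"
          using ae by eventually_elim (use v in \<open>auto simp: eq\<close>)
        then have "emeasure stdN {x. (sig d * x + 0)\<^sup>2 \<le> v} = 0"
          by (subst (asm) AE_iff_measurable[OF _ refl]) auto
        then show False using sq_cdf_pos[OF sig_pos[of d] v(1)] by (simp add: sq_cdf_def measure_def)
      qed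
    qed
  qed
  have "\<not> Q 0"
  proof
    assume "Q 0"
    then have "Q d" for d by (induction d) (auto intro: step)
    then have "AE w in gauss_seq. \<forall>d. \<not> tl d w < u"
      unfolding Q_def by (subst AE_all_countable) auto
    then have "AE w in gauss_seq. False"
      using sm
    proof eventually_elim
      fix w assume a: "\<forall>d. \<not> tl d w < u" and s: "summable (\<lambda>j. (sig j * w j)\<^sup>2)"
      have "tl d w = (\<Sum>i. (sig i * w i)\<^sup>2) - (\<Sum>i<d. (sig i * w i)\<^sup>2)" for d
      proof -
        have "(\<lambda>i. (sig i * w i)\<^sup>2 - (if i \<in> {..<d} then (sig i * w i)\<^sup>2 else 0)) sums
          ((\<Sum>i. (sig i * w i)\<^sup>2) - (\<Sum>i<d. (sig i * w i)\<^sup>2))"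
          by (intro sums_diff summable_sums s sums_If_finite_set) auto
        moreover have "(\<lambda>i. (sig i * w i)\<^sup>2 - (if i \<in> {..<d} then (sig i * w i)\<^sup>2 else 0)) =
           (\<lambda>i. if i < d then 0 else (sig i * w i)\<^sup>2)" by auto
        ultimately show ?thesis unfolding tl_eq by (simp add: sums_iff)
      qed
      moreover have "(\<lambda>d. (\<Sum>i. (sig i * w i)\<^sup>2) - (\<Sum>i<d. (sig i * w i)\<^sup>2)) \<longlonglongrightarrow> (\<Sum>i. (sig i * w i)\<^sup>2) - (\<Sum>i. (sig i * w i)\<^sup>2)"
        by (intro tendsto_intros summable_LIMSEQ s)
      ultimately have "(\<lambda>d. tl d w) \<longlonglongrightarrow> 0" by simp
      then have "\<forall>\<^sub>F d in sequentially. tl d w < u" using u by (rule order_tendstoD)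
      then show False using a by (auto simp: eventually_sequentially)
    qed
    then show False by (simp add: G.AE_False)
  qed
  moreover have S: "{w. gauss_norm2 (\<lambda>_. 0) w < u} \<in> sets gauss_seq"
    using measurable_sets[OF measurable_gauss_norm2', of "{..<u}" "\<lambda>_. 0"] by (simp add: vimage_def)
  ultimately show ?thesis
    unfolding Q_def tl_def using AE_iff_measurable[OF S, of "\<lambda>w. \<not> gauss_norm2 (\<lambda>_. 0) w < u"]
    by (auto simp: G.emeasure_eq_measure zero_less_measure_iff)
qed

lemma prob_gauss_norm2_zero_coordinate:
  assumes h: "summable (\<lambda>j. (h j)\<^sup>2)"
  shows "gauss_cdf h t \<le> gauss_cdf (h(j := 0)) t"
  using prob_gauss_norm2_le[OF h, of j "h j" t] prob_gauss_norm2_le[OF h, of j 0 t]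
  by (auto intro!: integral_mono sq_cdf_shift_le sig_pos)

text \<open>Condition on the other coordinates. The one-dimensional inequality is strict as soon as these leave a
  positive amount of the level \<open>t\<close>, which happens with positive probability.\<close>

lemma prob_gauss_norm2_one_coordinate:
  assumes t: "t > 0" and r: "r \<ge> 0" and hr: "c \<noteq> 0 \<or> r > 0"
  shows "gauss_cdf ((\<lambda>_. 0)(j := c)) (t - r) < gauss_cdf (\<lambda>_. 0) t"
proof -
  have s0: "summable (\<lambda>j::nat. (0::real)\<^sup>2)" by simp
  have zero: "(\<lambda>_. 0)(j := 0) = (\<lambda>_::nat. 0::real)" by auto
  note 1 = prob_gauss_norm2_le[OF s0, of j c "t - r"] and 2 = prob_gauss_norm2_le[OF s0, of j 0 t]
  let ?R = "rest j (\<lambda>_. 0)"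
  let ?f = "\<lambda>w. sq_cdf (sig j) 0 (t - ?R w) - sq_cdf (sig j) c (t - r - ?R w)"
  have nn: "0 \<le> ?f w" for w
    using sq_cdf_shift_le[OF sig_pos, of j c "t - r - ?R w"] sq_cdf_mono[of "t - r - ?R w" "t - ?R w" "sig j" 0] r by simp
  have pos: "0 < ?f w" if "?R w < t" for w
    using sq_cdf_less[OF sig_pos, of "t - ?R w" r c j] that r hr by (simp add: algebra_simps)
  have int: "integrable gauss_seq ?f" using 1(2) 2(2) by simp
  have "(\<integral>w. ?f w \<partial>gauss_seq) \<noteq> 0"
  proof
    assume "(\<integral>w. ?f w \<partial>gauss_seq) = 0"
    then have "AE w in gauss_seq. ?f w = 0"
      using integral_nonneg_eq_0_iff_AE[OF int] nn by auto
    moreover have "AE w in gauss_seq. summable (\<lambda>j. (sig j * w j + 0)\<^sup>2)"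
      using AE_summable_gauss[OF s0] .
    ultimately have "AE w in gauss_seq. w \<notin> {w. gauss_norm2 (\<lambda>_. 0) w < t}"
    proof eventually_elim
      fix w assume f: "?f w = 0" and s: "summable (\<lambda>j. (sig j * w j + 0)\<^sup>2)"
      have "\<not> ?R w < t" using pos[of w] f by linarith
      moreover have "gauss_norm2 (\<lambda>_. 0) w = (sig j * w j + 0)\<^sup>2 + ?R w"
        using gauss_norm2_upd[OF s, of j 0 "w j"] zero by simp
      ultimately have "\<not> gauss_norm2 (\<lambda>_. 0) w < t"
        using zero_le_power2[of "sig j * w j + 0"] by linarith
      then show "w \<notin> {w. gauss_norm2 (\<lambda>_. 0) w < t}" by simp
    qed
    then have "measure gauss_seq {w. gauss_norm2 (\<lambda>_. 0) w < t} = 0"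
      using measurable_sets[OF measurable_gauss_norm2', of "{..<t}" "\<lambda>_. 0"]
      by (subst G.prob_eq_0) (auto simp: vimage_def)
    then show False using gauss_norm2_small_ball[OF t] by simp
  qed
  moreover have "0 \<le> (\<integral>w. ?f w \<partial>gauss_seq)" by (rule Bochner_Integration.integral_nonneg) (rule nn)
  ultimately show ?thesis using 1 2 zero by simp
qed

lemma prob_gauss_norm2_keep_one:
  assumes h: "summable (\<lambda>j. (h j)\<^sup>2)"
  shows "gauss_cdf h t \<le> gauss_cdf ((\<lambda>_. 0)(j := h j)) t"
proof -
  \<comment> \<open>Clear the shifts below \<open>d\<close> and let \<open>d\<close> tend to infinity.\<close>
  define hd where "hd d i = (if i < d \<and> i \<noteq> j then 0 else h i)" for d i
  let ?P = "\<lambda>g. gauss_cdf g t"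
  let ?g = "(\<lambda>_. 0)(j := h j)"
  have sm: "summable (\<lambda>i. (hd d i)\<^sup>2)" for d
    using h by (rule summable_comparison_test'[where N=0]) (auto simp: hd_def)
  have sg: "summable (\<lambda>i. (?g i)\<^sup>2)"
    using h by (rule summable_comparison_test'[where N=0]) (auto)
  have "?P h \<le> ?P (hd d)" for d
  proof (induction d)
    case 0
    have "hd 0 = h" by (auto simp: hd_def)
    then show ?case by simp
  next
    case (Suc d)
    have "hd (Suc d) = hd d \<or> hd (Suc d) = (hd d)(d := 0)" by (auto simp: hd_def fun_eq_iff less_Suc_eq)
    then show ?case
    proof
      assume "hd (Suc d) = hd d"
      then show ?case using Suc by simp
    next
      assume eq: "hd (Suc d) = (hd d)(d := 0)"
      show ?case unfolding eq using Suc prob_gauss_norm2_zero_coordinate[OF sm, of d t d] by linarith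
    qed
  qed
  moreover have "(\<lambda>d. ?P (hd d)) \<longlonglongrightarrow> ?P ?g"
  proof -
    have ind: "?P g = (\<integral>w. indicator {..t} (gauss_norm2 g w) \<partial>gauss_seq)" for g
    proof -
      have "{w. gauss_norm2 g w \<le> t} \<in> sets gauss_seq"
        using measurable_sets[OF measurable_gauss_norm2', of "{..t}" g] by (simp add: vimage_def)
      then have "?P g = (\<integral>w. indicator {w. gauss_norm2 g w \<le> t} w \<partial>gauss_seq)"
        unfolding gauss_cdf_def by simp
      also have "\<dots> = (\<integral>w. indicator {..t} (gauss_norm2 g w) \<partial>gauss_seq)"
        by (intro Bochner_Integration.integral_cong) (auto simp: indicator_def)
      finally show ?thesis .
    qed
    show ?thesis
      unfolding ind
    proof (rule integral_dominated_convergence[where w="\<lambda>_. 1"])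
      show "AE w in gauss_seq. (\<lambda>d. indicat_real {..t} (gauss_norm2 (hd d) w)) \<longlonglongrightarrow> indicator {..t} (gauss_norm2 ?g w)"
        using AE_summable_gauss[OF h] AE_summable_gauss[OF sg] gauss_norm2_no_atom[OF sg, of t]
      proof eventually_elim
        fix w assume 1: "summable (\<lambda>i. (sig i * w i + h i)\<^sup>2)" and 2: "summable (\<lambda>i. (sig i * w i + ?g i)\<^sup>2)"
          and 3: "gauss_norm2 ?g w \<noteq> t"
        let ?D = "\<lambda>i. (sig i * w i + h i)\<^sup>2 - (sig i * w i + ?g i)\<^sup>2"
        have eq: "gauss_norm2 (hd d) w = gauss_norm2 ?g w + (suminf ?D - (\<Sum>i<d. ?D i))" for d
        proof -
          have "(\<lambda>i. (sig i * w i + ?g i)\<^sup>2 + (?D i - (if i \<in> {..<d} then ?D i else 0))) sums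
             (gauss_norm2 ?g w + (suminf ?D - (\<Sum>i<d. ?D i)))"
            unfolding gauss_norm2_def
            by (intro sums_add sums_diff[of ?D] summable_sums summable_diff 1 2 sums_If_finite_set) auto
          moreover have "(\<lambda>i. (sig i * w i + ?g i)\<^sup>2 + (?D i - (if i \<in> {..<d} then ?D i else 0))) =
             (\<lambda>i. (sig i * w i + hd d i)\<^sup>2)" by (auto simp: hd_def)
          ultimately show ?thesis unfolding gauss_norm2_def by (simp only: sums_iff)
        qed
        have "(\<lambda>d. gauss_norm2 ?g w + (suminf ?D - (\<Sum>i<d. ?D i))) \<longlonglongrightarrow> gauss_norm2 ?g w + (suminf ?D - suminf ?D)"
          by (intro tendsto_intros summable_LIMSEQ summable_diff 1 2)
        then have lim: "(\<lambda>d. gauss_norm2 (hd d) w) \<longlonglongrightarrow> gauss_norm2 ?g w" unfolding eq by simp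
        show "(\<lambda>d. indicat_real {..t} (gauss_norm2 (hd d) w)) \<longlonglongrightarrow> indicator {..t} (gauss_norm2 ?g w)"
        proof (cases "gauss_norm2 ?g w < t")
          case True
          from order_tendstoD(2)[OF lim this] have "\<forall>\<^sub>F d in sequentially. indicat_real {..t} (gauss_norm2 (hd d) w) = 1"
            by eventually_elim auto
          then show ?thesis using True by (simp add: tendsto_eventually)
        next
          case False
          then have "t < gauss_norm2 ?g w" using 3 by simp
          from order_tendstoD(1)[OF lim this] have "\<forall>\<^sub>F d in sequentially. indicat_real {..t} (gauss_norm2 (hd d) w) = 0"
            by eventually_elim auto
          then show ?thesis using \<open>t < gauss_norm2 ?g w\<close> by (simp add: tendsto_eventually)
        qed
      qed
    qed (auto simp: indicator_def)
  qed
  ultimately show ?thesis by (intro LIMSEQ_le_const) auto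
qed

text \<open>A strict form of Anderson's inequality. The number \<open>r\<close> stands for energy of the shift that is
  invisible in the coefficients \<open>h\<close>.\<close>

lemma prob_gauss_norm2_shift_less:
  assumes h: "summable (\<lambda>j. (h j)\<^sup>2)" and t: "t > 0" and r: "r \<ge> 0" and hr: "h \<noteq> (\<lambda>_. 0) \<or> r > 0"
  shows "gauss_cdf h (t - r) < gauss_cdf (\<lambda>_. 0) t"
proof -
  obtain j where "h j \<noteq> 0 \<or> r > 0" using hr by auto
  then show ?thesis
    using prob_gauss_norm2_keep_one[OF h, of "t - r" j] prob_gauss_norm2_one_coordinate[OF t r, of "h j" j] by linarith
qed

section \<open>Fourier sine coefficients on the unit interval\<close>

text \<open>The uniform law on \<open>[0,1]\<close>, with the Borel sets of the whole line as measurable sets.\<close>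

definition U01 :: "real measure" where
  "U01 = density lborel (\<lambda>x. ennreal (indicator {0..1} x))"

lemma sets_U01 [measurable_cong, simp]: "sets U01 = sets borel"
  by (simp add: U01_def)

lemma space_U01 [simp]: "space U01 = UNIV"
  by (simp add: U01_def)

lemma prob_space_U01: "prob_space U01"
proof
  have "emeasure U01 (space U01) = (\<integral>\<^sup>+x. indicator {0..1::real} x \<partial>lborel)"
    unfolding U01_def by (subst emeasure_density) (auto simp: ennreal_indicator)
  then show "emeasure U01 (space U01) = 1" by simp
qed

lemma integral_U01:
  fixes f :: "real \<Rightarrow> real"
  assumes "f \<in> borel_measurable borel"
  shows "(\<integral>x. f x \<partial>U01) = (LBINT x:{0..1}. f x)"
  unfolding U01_def set_lebesgue_integral_def using assms by (subst integral_density) auto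

lemma AE_U01: "AE x in U01. 0 \<le> x \<and> x \<le> 1"
  unfolding U01_def by (subst AE_density) (auto split: split_indicator)

lemma integral_U01_FTC:
  assumes "0 \<le> a" "a \<le> 1" "\<And>x. (F has_real_derivative f x) (at x)" "\<And>x. isCont f x"
  shows "(\<integral>x. of_bool (a \<le> x) * f x \<partial>U01) = F 1 - F a"
proof -
  have [measurable]: "f \<in> borel_measurable borel"
    using assms(4) by (intro borel_measurable_continuous_onI continuous_at_imp_continuous_on) auto
  have "(\<integral>x. of_bool (a \<le> x) * f x \<partial>U01) = (\<integral>x. f x * indicator {a..1} x \<partial>lborel)"
    unfolding integral_U01[of "\<lambda>x. of_bool (a \<le> x) * f x", simplified] set_lebesgue_integral_def
    by (intro Bochner_Integration.integral_cong) (use assms(1) in \<open>auto split: split_indicator\<close>)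
  also have "\<dots> = F 1 - F a"
    using assms by (intro integral_FTC_Icc_real) auto
  finally show ?thesis .
qed

lemma integral_U01_FTC0:
  assumes "\<And>x. (F has_real_derivative f x) (at x)" "\<And>x. isCont f x"
  shows "(\<integral>x. f x \<partial>U01) = F 1 - F 0"
proof -
  have [measurable]: "f \<in> borel_measurable borel"
    using assms(2) by (intro borel_measurable_continuous_onI continuous_at_imp_continuous_on) auto
  have "(\<integral>x. f x \<partial>U01) = (\<integral>x. of_bool (0 \<le> x) * f x \<partial>U01)"
    by (intro integral_cong_AE) (use AE_U01 in auto)
  then show ?thesis using integral_U01_FTC[of 0 F f] assms by simp
qed

text \<open>Bounded Borel functions form an algebra and are integrable under every probability measure, so that
  this one condition discharges all integrability requirements.\<close>

definition bmeas :: "(real \<Rightarrow> real) \<Rightarrow> bool" where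
  "bmeas f \<longleftrightarrow> f \<in> borel_measurable borel \<and> (\<exists>B. \<forall>x. \<bar>f x\<bar> \<le> B)"

lemma bmeasD: "bmeas f \<Longrightarrow> f \<in> borel_measurable borel" by (simp add: bmeas_def)

lemma bmeasI: "f \<in> borel_measurable borel \<Longrightarrow> (\<And>x. \<bar>f x\<bar> \<le> B) \<Longrightarrow> bmeas f"
  by (auto simp: bmeas_def)

lemma bmeas_add: "bmeas f \<Longrightarrow> bmeas g \<Longrightarrow> bmeas (\<lambda>x. f x + g x)"
proof -
  assume f: "bmeas f" and g: "bmeas g"
  obtain B C where "\<And>x. \<bar>f x\<bar> \<le> B" "\<And>x. \<bar>g x\<bar> \<le> C" using f g unfolding bmeas_def by blast
  then have "\<bar>f x + g x\<bar> \<le> B + C" for x by (rule abs_triangle_ineq[THEN order_trans, OF add_mono])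
  then show ?thesis by (intro bmeasI[of _ "B + C"] borel_measurable_add bmeasD[OF f] bmeasD[OF g])
qed

lemma bmeas_mult: "bmeas f \<Longrightarrow> bmeas g \<Longrightarrow> bmeas (\<lambda>x. f x * g x)"
proof -
  assume f: "bmeas f" and g: "bmeas g"
  obtain B C where B: "\<And>x. \<bar>f x\<bar> \<le> B" "\<And>x. \<bar>g x\<bar> \<le> C" using f g unfolding bmeas_def by blast
  have "\<bar>f x * g x\<bar> \<le> B * C" for x
    unfolding abs_mult using B[of x] by (intro mult_mono) auto
  then show ?thesis by (intro bmeasI[of _ "B * C"] borel_measurable_times bmeasD[OF f] bmeasD[OF g])
qed

lemma bmeas_const: "bmeas (\<lambda>_. c)" by (intro bmeasI[of _ "\<bar>c\<bar>"]) auto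

lemma bmeas_cmult: "bmeas f \<Longrightarrow> bmeas (\<lambda>x. c * f x)" by (intro bmeas_mult bmeas_const)

lemma bmeas_diff: "bmeas f \<Longrightarrow> bmeas g \<Longrightarrow> bmeas (\<lambda>x. f x - g x)"
  using bmeas_add[of f "\<lambda>x. (-1) * g x"] bmeas_cmult[of g "-1"] by simp

lemma bmeas_sum: "(\<And>i. i \<in> I \<Longrightarrow> bmeas (f i)) \<Longrightarrow> bmeas (\<lambda>x. \<Sum>i\<in>I. f i x)"
  by (induction I rule: infinite_finite_induct) (auto intro: bmeas_add bmeas_const)

lemma bmeas_power: "bmeas f \<Longrightarrow> bmeas (\<lambda>x. (f x)\<^sup>2)"
  using bmeas_mult[of f f] by (simp add: power2_eq_square)

lemma bmeas_sin: "bmeas (\<lambda>x. sin (c * x))" by (intro bmeasI[of _ 1]) auto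
lemma bmeas_cos: "bmeas (\<lambda>x. cos (c * x))" by (intro bmeasI[of _ 1]) auto

lemmas bmeas_intros = bmeas_add bmeas_diff bmeas_mult bmeas_cmult bmeas_const bmeas_sum bmeas_power bmeas_sin bmeas_cos

lemma bmeas_integrable:
  assumes "bmeas f" "prob_space M" "sets M = sets borel"
  shows "integrable M f"
proof -
  interpret prob_space M by fact
  obtain B where "\<forall>x. \<bar>f x\<bar> \<le> B" using assms(1) by (auto simp: bmeas_def)
  moreover have "f \<in> borel_measurable M"
    using bmeasD[OF assms(1)] measurable_cong_sets[OF assms(3), of borel borel] by auto
  ultimately show ?thesis by (intro integrable_const_bound[of _ B]) auto
qed

lemma bmeas_integrable_U01: "bmeas f \<Longrightarrow> integrable U01 f"
  by (erule bmeas_integrable[OF _ prob_space_U01 sets_U01])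

definition ip :: "(real \<Rightarrow> real) \<Rightarrow> (real \<Rightarrow> real) \<Rightarrow> real" where
  "ip f g = (\<integral>x. f x * g x \<partial>U01)"

lemma T2_nonneg: "0 \<le> T2 f"
  by (simp add: T2_def set_lebesgue_integral_def)

lemma T2_eq_ip: "bmeas f \<Longrightarrow> T2 f = ip f f"
  using integral_U01[OF bmeasD[OF bmeas_mult[of f f]]] by (simp add: ip_def T2_def power2_eq_square)

lemma ip_commute: "ip f g = ip g f" by (simp add: ip_def mult.commute)

lemma ip_add_left: "bmeas f \<Longrightarrow> bmeas g \<Longrightarrow> bmeas h \<Longrightarrow> ip (\<lambda>x. f x + g x) h = ip f h + ip g h"
  unfolding ip_def distrib_right by (intro Bochner_Integration.integral_add bmeas_integrable_U01 bmeas_mult)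

lemma ip_diff_left: "bmeas f \<Longrightarrow> bmeas g \<Longrightarrow> bmeas h \<Longrightarrow> ip (\<lambda>x. f x - g x) h = ip f h - ip g h"
  unfolding ip_def left_diff_distrib by (intro Bochner_Integration.integral_diff bmeas_integrable_U01 bmeas_mult)

lemma ip_cmult_left: "ip (\<lambda>x. c * f x) h = c * ip f h"
  by (simp add: ip_def mult.assoc)

lemma ip_sum_left: "(\<And>i. i \<in> I \<Longrightarrow> bmeas (f i)) \<Longrightarrow> bmeas h \<Longrightarrow> ip (\<lambda>x. \<Sum>i\<in>I. f i x) h = (\<Sum>i\<in>I. ip (f i) h)"
  unfolding ip_def sum_distrib_right by (intro Bochner_Integration.integral_sum bmeas_integrable_U01 bmeas_mult)

lemma ip_self_nonneg: "0 \<le> ip f f" by (simp add: ip_def)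

definition sine :: "nat \<Rightarrow> real \<Rightarrow> real" where
  "sine j x = sqrt 2 * sin (pi * (real j + 1) * x)"

lemma bmeas_sine: "bmeas (sine j)" unfolding sine_def[abs_def] by (intro bmeas_intros)

lemma integral_cos_U01:
  "(\<integral>x. cos (pi * of_int k * x) \<partial>U01) = (if k = 0 then 1 else 0)"
proof (cases "k = 0")
  case True
  interpret prob_space U01 by (rule prob_space_U01)
  show ?thesis using True prob_space by simp
next
  case False
  have "(\<integral>x. cos (pi * of_int k * x) \<partial>U01) = sin (pi * of_int k * 1) / (pi * of_int k) - sin (pi * of_int k * 0) / (pi * of_int k)"
    using False by (intro integral_U01_FTC0[where F="\<lambda>x. sin (pi * of_int k * x) / (pi * of_int k)"])
      (auto intro!: derivative_eq_intros continuous_intros)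
  then show ?thesis using False sin_zero_iff_int2[of "pi * of_int k"] by (auto simp: mult.commute)
qed

lemma sine_orthonormal: "ip (sine i) (sine j) = (if i = j then 1 else 0)"
proof -
  have e: "sine i x * sine j x = cos (pi * of_int (int i - int j) * x) - cos (pi * of_int (int i + int j + 2) * x)" for x
  proof -
    have "sine i x * sine j x = 2 * (sin (pi * (real i + 1) * x) * sin (pi * (real j + 1) * x))"
      by (simp add: sine_def)
    also have "\<dots> = cos (pi * (real i + 1) * x - pi * (real j + 1) * x) - cos (pi * (real i + 1) * x + pi * (real j + 1) * x)"
      by (simp add: cos_diff cos_add)
    finally show ?thesis by (simp add: algebra_simps)
  qed
  have i: "integrable U01 (\<lambda>x. cos (c * x))" for c by (intro bmeas_integrable_U01 bmeas_intros)
  show ?thesis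
    unfolding ip_def e by (subst Bochner_Integration.integral_diff) (auto simp: i integral_cos_U01 simp del: of_int_diff of_int_add)
qed

definition coef :: "(real \<Rightarrow> real) \<Rightarrow> nat \<Rightarrow> real" where
  "coef f j = ip f (sine j)"

text \<open>The squared norm of the component of \<open>f\<close> orthogonal to the first \<open>d\<close> sine functions.\<close>

definition tail_norm2 :: "nat \<Rightarrow> (real \<Rightarrow> real) \<Rightarrow> real" where
  "tail_norm2 d f = ip f f - (\<Sum>j<d. (coef f j)\<^sup>2)"

text \<open>Bessel's inequality.\<close>

lemma tail_norm2_nonneg:
  assumes f: "bmeas f"
  shows "0 \<le> tail_norm2 d f"
proof -
  let ?p = "\<lambda>x. \<Sum>j<d. coef f j * sine j x"
  have p: "bmeas ?p" by (intro bmeas_intros bmeas_sine)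
  have fp: "ip ?p f = (\<Sum>j<d. (coef f j)\<^sup>2)"
    by (subst ip_sum_left)
      (auto intro!: f bmeas_cmult bmeas_sine simp: ip_cmult_left power2_eq_square coef_def ip_commute[of "sine _"])
  have sp: "ip (sine i) ?p = coef f i" if "i < d" for i
  proof -
    have "ip ?p (sine i) = (\<Sum>j<d. coef f j * ip (sine j) (sine i))"
      by (subst ip_sum_left) (auto intro!: bmeas_intros bmeas_sine simp: ip_cmult_left)
    also have "\<dots> = coef f i" using that by (simp add: sine_orthonormal sum.delta if_distrib cong: if_cong)
    finally show ?thesis by (simp add: ip_commute)
  qed
  have pp: "ip ?p ?p = (\<Sum>j<d. (coef f j)\<^sup>2)"
    by (subst ip_sum_left) (auto intro!: p bmeas_intros bmeas_sine simp: ip_cmult_left sp power2_eq_square)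
  have "0 \<le> ip (\<lambda>x. f x - ?p x) (\<lambda>x. f x - ?p x)" by (rule ip_self_nonneg)
  also have "\<dots> = ip f (\<lambda>x. f x - ?p x) - ip ?p (\<lambda>x. f x - ?p x)"
    by (intro ip_diff_left f p bmeas_diff)
  also have "\<dots> = (ip f f - ip ?p f) - (ip ?p f - ip ?p ?p)"
    using ip_diff_left[OF f p f] ip_diff_left[OF f p p] by (metis ip_commute)
  finally show ?thesis by (simp add: fp pp tail_norm2_def)
qed

lemma coef_add: "bmeas f \<Longrightarrow> bmeas g \<Longrightarrow> coef (\<lambda>x. f x + g x) j = coef f j + coef g j"
  by (simp add: coef_def ip_add_left bmeas_sine)

lemma coef_diff: "bmeas f \<Longrightarrow> bmeas g \<Longrightarrow> coef (\<lambda>x. f x - g x) j = coef f j - coef g j"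
  by (simp add: coef_def ip_diff_left bmeas_sine)

lemma coef_cmult: "coef (\<lambda>x. c * f x) j = c * coef f j"
  by (simp add: coef_def ip_cmult_left)

lemma coef_sq_le:
  assumes "bmeas f" shows "(coef f j)\<^sup>2 \<le> T2 f"
proof -
  have "(coef f j)\<^sup>2 \<le> (\<Sum>i<Suc j. (coef f i)\<^sup>2)"
    by (rule member_le_sum) auto
  then show ?thesis using tail_norm2_nonneg[OF assms, of "Suc j"] by (simp add: tail_norm2_def T2_eq_ip[OF assms])
qed

text \<open>Non-negativity of the quadratic form at \<open>f + l g\<close> and at \<open>f - l g\<close> bounds the cross term of \<open>f\<close> and \<open>g\<close>.
  With \<open>l\<close> small, \<open>g\<close> may have a large tail as long as \<open>f\<close> has a much smaller one.\<close>

lemma tail_norm2_perturb: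
  assumes f: "bmeas f" and g: "bmeas g" and l: "l > 0"
  shows "\<bar>tail_norm2 d (\<lambda>x. f x + g x) - tail_norm2 d g\<bar> \<le> (1 + 1 / l) * tail_norm2 d f + l * tail_norm2 d g"
proof -
  define B where "B = ip f g - (\<Sum>j<d. coef f j * coef g j)"
  have exp: "tail_norm2 d (\<lambda>x. f x + c * g x) = tail_norm2 d f + 2 * c * B + c\<^sup>2 * tail_norm2 d g" for c
  proof -
    have cg: "bmeas (\<lambda>x. c * g x)" by (intro bmeas_intros g)
    have "ip (\<lambda>x. f x + c * g x) (\<lambda>x. f x + c * g x) = ip f f + 2 * c * ip f g + c\<^sup>2 * ip g g"
    proof -
      have "ip (\<lambda>x. f x + c * g x) (\<lambda>x. f x + c * g x) = ip f (\<lambda>x. f x + c * g x) + c * ip g (\<lambda>x. f x + c * g x)"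
        by (subst ip_add_left) (auto intro!: f cg bmeas_add simp: ip_cmult_left)
      also have "ip f (\<lambda>x. f x + c * g x) = ip f f + c * ip f g"
        using ip_add_left[OF f cg f] ip_cmult_left[of c g f] by (simp add: ip_commute)
      also have "ip g (\<lambda>x. f x + c * g x) = ip f g + c * ip g g"
        using ip_add_left[OF f cg g] ip_cmult_left[of c g g] by (simp add: ip_commute)
      finally show ?thesis by (simp add: power2_eq_square algebra_simps)
    qed
    moreover have "(\<Sum>j<d. (coef (\<lambda>x. f x + c * g x) j)\<^sup>2) =
        (\<Sum>j<d. (coef f j)\<^sup>2) + 2 * c * (\<Sum>j<d. coef f j * coef g j) + c\<^sup>2 * (\<Sum>j<d. (coef g j)\<^sup>2)"
      by (simp add: coef_add[OF f cg] coef_cmult power2_sum power_mult_distrib sum.distrib sum_distrib_left algebra_simps)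
    ultimately show ?thesis by (simp add: tail_norm2_def B_def algebra_simps)
  qed
  have "0 \<le> tail_norm2 d (\<lambda>x. f x + l * g x)" "0 \<le> tail_norm2 d (\<lambda>x. f x + (- l) * g x)"
    by (intro tail_norm2_nonneg bmeas_intros f g)+
  then have "0 \<le> tail_norm2 d f + 2 * l * B + l\<^sup>2 * tail_norm2 d g" "0 \<le> tail_norm2 d f - 2 * l * B + l\<^sup>2 * tail_norm2 d g"
    by (simp_all only: exp) simp_all
  then have "0 \<le> tail_norm2 d f / l + 2 * B + l * tail_norm2 d g" "0 \<le> tail_norm2 d f / l - 2 * B + l * tail_norm2 d g"
    using l by (auto simp: field_simps power2_eq_square)
  moreover have "tail_norm2 d (\<lambda>x. f x + g x) - tail_norm2 d g = tail_norm2 d f + 2 * B"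
    using exp[of 1] by simp
  moreover have "0 \<le> tail_norm2 d f" by (rule tail_norm2_nonneg[OF f])
  ultimately show ?thesis by (simp add: algebra_simps)
qed

section \<open>Sine coefficients of the empirical distribution function\<close>

lemma F0_measurable [measurable]: "F0 \<in> borel_measurable borel"
  unfolding F0_def[abs_def] by measurable

lemma F0_bounds: "0 \<le> F0 x" "F0 x \<le> 1" by (auto simp: F0_def)

lemma bmeas_F0: "bmeas F0" using F0_bounds by (intro bmeasI[of _ 1]) auto

text \<open>The contribution of one observation \<open>X\<close> to the deviation of the empirical distribution function
  from \<open>F0\<close>.\<close>

definition kern :: "real \<Rightarrow> real \<Rightarrow> real" where
  "kern X x = of_bool (X \<le> x) - F0 x"

lemma kern_measurable [measurable]: "(\<lambda>(X, x). kern X x) \<in> borel_measurable (borel \<Otimes>\<^sub>M borel)"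
  unfolding kern_def by measurable

lemma kern_bound: "\<bar>kern X x\<bar> \<le> 1"
  using F0_bounds[of x] by (auto simp: kern_def)

lemma bmeas_kern: "bmeas (kern X)"
  by (rule bmeasI[OF _ kern_bound]) (unfold kern_def[abs_def], measurable)

definition kcoef :: "nat \<Rightarrow> real \<Rightarrow> real" where
  "kcoef j X = coef (kern X) j"

lemma bmeas_kcoef: "bmeas (kcoef j)"
proof (rule bmeasI)
  interpret U: prob_space U01 by (rule prob_space_U01)
  have [measurable]: "sine j \<in> borel_measurable borel" by (rule bmeasD[OF bmeas_sine])
  show "kcoef j \<in> borel_measurable borel"
    unfolding kcoef_def[abs_def] coef_def ip_def by measurable
  show "\<bar>kcoef j X\<bar> \<le> sqrt 2" for X
  proof -
    have "\<bar>kcoef j X\<bar> \<le> (\<integral>x. \<bar>kern X x * sine j x\<bar> \<partial>U01)"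
      unfolding kcoef_def coef_def ip_def by (rule integral_abs_bound)
    also have "\<dots> \<le> (\<integral>x. sqrt 2 \<partial>U01)"
    proof (rule integral_mono)
      show "integrable U01 (\<lambda>x. \<bar>kern X x * sine j x\<bar>)"
        by (intro integrable_abs bmeas_integrable_U01 bmeas_mult bmeas_kern bmeas_sine)
      fix x
      have "\<bar>sin (pi * (real j + 1) * x)\<bar> \<le> 1" by simp
      then have "\<bar>sine j x\<bar> \<le> sqrt 2 * 1" unfolding sine_def abs_mult by (intro mult_mono) auto
      then show "\<bar>kern X x * sine j x\<bar> \<le> sqrt 2"
        unfolding abs_mult using mult_mono[OF kern_bound[of X x], of "\<bar>sine j x\<bar>" "sqrt 2"] by simp
    qed simp
    finally show ?thesis using U.prob_space by simp
  qed
qed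

lemma sin_pi_nat: "sin (pi * (real j + 1)) = 0"
  using sin_npi2[of "Suc j"] by (simp add: add.commute)

text \<open>Integration by parts. This explains the values of \<open>sig\<close>: under the uniform law the functions
  \<open>sqrt 2 cos (pi (j + 1) X)\<close> are orthonormal.\<close>

lemma kcoef_eq_cos:
  assumes "0 \<le> X" "X \<le> 1"
  shows "kcoef j X = sqrt 2 * sig j * cos (pi * (real j + 1) * X)"
proof -
  let ?c = "pi * (real j + 1)"
  have c: "?c \<noteq> 0" "sig j = 1 / ?c" by (auto simp: sig_def add_nonneg_eq_0_iff)
  let ?G = "\<lambda>x. - (sqrt 2 * sig j * cos (?c * x))"
  have dG: "(?G has_real_derivative sine j x) (at x)" for x
    using c(1) unfolding c(2) sine_def by (auto intro!: derivative_eq_intros)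
  let ?H = "\<lambda>x. - (x * (sqrt 2 * sig j * cos (?c * x))) + sqrt 2 * (sig j)\<^sup>2 * sin (?c * x)"
  have dH: "(?H has_real_derivative x * sine j x) (at x)" for x
    using c(1) unfolding c(2) sine_def
    by (auto intro!: derivative_eq_intros simp: power2_eq_square divide_simps)
  have cont: "isCont (sine j) x" for x unfolding sine_def[abs_def] by (intro continuous_intros)
  have m [measurable]: "sine j \<in> borel_measurable borel" by (rule bmeasD[OF bmeas_sine])
  have 1: "(\<integral>x. of_bool (X \<le> x) * sine j x \<partial>U01) = ?G 1 - ?G X"
    by (rule integral_U01_FTC[OF assms dG cont])
  have "(\<integral>x. F0 x * sine j x \<partial>U01) = (\<integral>x. x * sine j x \<partial>U01)"
  proof (rule integral_cong_AE)
    show "AE x in U01. F0 x * sine j x = x * sine j x"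
      using AE_U01 by eventually_elim (simp add: F0_def)
  qed auto
  also have "\<dots> = ?H 1 - ?H 0"
    by (rule integral_U01_FTC0[OF dH]) (intro continuous_intros cont)
  also have "\<dots> = ?G 1" using sin_pi_nat[of j] by simp
  finally have 2: "(\<integral>x. F0 x * sine j x \<partial>U01) = ?G 1" .
  have "bmeas (\<lambda>x. of_bool (X \<le> x))" by (intro bmeasI[of _ 1]) auto
  then have "kcoef j X = (\<integral>x. of_bool (X \<le> x) * sine j x \<partial>U01) - (\<integral>x. F0 x * sine j x \<partial>U01)"
    using ip_diff_left[of "\<lambda>x. of_bool (X \<le> x)" F0 "sine j"] bmeas_sine bmeas_F0
    by (simp add: kcoef_def coef_def kern_def[abs_def] ip_def)
  then show ?thesis unfolding 1 2 by simp
qed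

lemma emp_cdf_deviation:
  assumes "n > 0"
  shows "emp_cdf n X x - F0 x = (1 / real n) * (\<Sum>i\<in>{1..n}. kern (X i) x)"
proof -
  have "real (card {i \<in> {1..n}. X i \<le> x}) = (\<Sum>i\<in>{1..n}. of_bool (X i \<le> x))"
    by (simp add: of_bool_def sum.If_cases Int_def)
  then show ?thesis using assms by (simp add: emp_cdf_def kern_def sum_subtractf field_simps)
qed

lemma bmeas_emp_deviation: "n > 0 \<Longrightarrow> bmeas (\<lambda>x. emp_cdf n X x - F0 x)"
  unfolding emp_cdf_deviation by (intro bmeas_cmult bmeas_sum bmeas_kern)

lemma coef_emp_deviation:
  "n > 0 \<Longrightarrow> coef (\<lambda>x. emp_cdf n X x - F0 x) j = (1 / real n) * (\<Sum>i\<in>{1..n}. kcoef j (X i))"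
  unfolding emp_cdf_deviation coef_cmult
  by (simp add: coef_def kcoef_def ip_sum_left bmeas_kern bmeas_sine)

text \<open>The laws whose distribution functions make up \<open>dist_funs01\<close>.\<close>

locale law01 = real_distribution M for M +
  assumes AE01: "AE x in M. x \<in> {0<..<1}"
begin

abbreviation F where "F \<equiv> cdf M"

lemma F_bounds: "0 \<le> F x" "F x \<le> 1"
  by (auto simp: cdf_nonneg cdf_bounded_prob)

lemma F_measurable [measurable]: "F \<in> borel_measurable borel"
  by (rule borel_measurable_mono) (auto simp: mono_def cdf_nondecreasing)

lemma bmeas_F: "bmeas F" using F_bounds by (intro bmeasI[of _ 1]) auto

lemma bmeas_F_F0: "bmeas (\<lambda>x. F x - F0 x)"
  by (rule bmeas_diff[OF bmeas_F bmeas_F0])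

lemma AE_closed: "AE X in M. 0 \<le> X \<and> X \<le> 1"
  using AE01 by eventually_elim auto

lemma integrable_bmeas: "bmeas f \<Longrightarrow> integrable M f"
  by (rule bmeas_integrable) (auto intro: prob_space_axioms)

lemma integral_step: "(\<integral>X. of_bool (X \<le> x) \<partial>M) = F x"
proof -
  have "(\<integral>X. of_bool (X \<le> x) \<partial>M) = (\<integral>X. indicator {..x} X \<partial>M)"
    by (intro Bochner_Integration.integral_cong) (auto simp: indicator_def)
  also have "\<dots> = measure M ({..x} \<inter> space M)" by (rule Bochner_Integration.integral_indicator)
  finally show ?thesis by (simp add: cdf_def)
qed

lemma integral_kern: "(\<integral>X. kern X x \<partial>M) = F x - F0 x"
proof -
  have "integrable M (\<lambda>X. of_bool (X \<le> x) :: real)"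
    by (intro integrable_bmeas bmeasI[of _ 1]) auto
  then show ?thesis unfolding kern_def using prob_space by (simp add: integral_step)
qed

lemma integral_kcoef: "(\<integral>X. kcoef j X \<partial>M) = coef (\<lambda>x. F x - F0 x) j"
proof -
  interpret U: prob_space U01 by (rule prob_space_U01)
  interpret MU: pair_prob_space M U01 by unfold_locales
  have [measurable]: "sine j \<in> borel_measurable borel" by (rule bmeasD[OF bmeas_sine])
  obtain B where B: "\<And>x. \<bar>sine j x\<bar> \<le> B" using bmeas_sine[of j] by (auto simp: bmeas_def)
  have "(\<integral>X. kcoef j X \<partial>M) = (\<integral>X. (\<integral>x. kern X x * sine j x \<partial>U01) \<partial>M)"
    by (simp add: kcoef_def coef_def ip_def)
  also have "\<dots> = (\<integral>x. (\<integral>X. kern X x * sine j x \<partial>M) \<partial>U01)"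
  proof (rule MU.Fubini_integral[symmetric])
    have "\<bar>kern X x * sine j x\<bar> \<le> B" for X x
      unfolding abs_mult using mult_mono[OF kern_bound[of X x] B[of x]] by simp
    then show "integrable (M \<Otimes>\<^sub>M U01) (\<lambda>(X, x). kern X x * sine j x)"
      by (intro MU.P.integrable_const_bound[of _ B]) auto
  qed
  also have "\<dots> = coef (\<lambda>x. F x - F0 x) j"
    by (simp add: integral_kern coef_def ip_def)
  finally show ?thesis .
qed

text \<open>The trigonometric moments of \<open>F\<close> are, up to factors, the sine coefficients of \<open>F - F0\<close>; so they tend to
  those of the uniform law when \<open>T2 (F - F0)\<close> tends to zero.\<close>

lemma integral_cos:
  "(\<integral>X. cos (pi * (real l + 1) * X) \<partial>M) = coef (\<lambda>x. F x - F0 x) l / (sqrt 2 * sig l)"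
proof -
  have "(\<integral>X. kcoef l X \<partial>M) = (\<integral>X. (sqrt 2 * sig l) * cos (pi * (real l + 1) * X) \<partial>M)"
  proof (rule integral_cong_AE)
    show "AE X in M. kcoef l X = (sqrt 2 * sig l) * cos (pi * (real l + 1) * X)"
      using AE_closed by eventually_elim (simp add: kcoef_eq_cos)
  qed (use bmeasD[OF bmeas_kcoef] in auto)
  then show ?thesis using sig_pos[of l] by (simp add: integral_kcoef)
qed

text \<open>A product of cosines is a sum of cosines, which reduces covariances to first moments.\<close>

lemma integral_kcoef_product:
  assumes "i \<le> j"
  shows "(\<integral>X. kcoef i X * kcoef j X \<partial>M) =
    sig i * sig j * ((\<integral>X. cos (pi * real (j - i) * X) \<partial>M) + (\<integral>X. cos (pi * (real (i + j + 1) + 1) * X) \<partial>M))"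
proof -
  have e: "kcoef i X * kcoef j X = sig i * sig j * (cos (pi * real (j - i) * X) + cos (pi * (real (i + j + 1) + 1) * X))"
    if "0 \<le> X" "X \<le> 1" for X
  proof -
    have "kcoef i X * kcoef j X = sig i * sig j * (2 * (cos (pi * (real j + 1) * X) * cos (pi * (real i + 1) * X)))"
      using that by (simp add: kcoef_eq_cos)
    also have "2 * (cos (pi * (real j + 1) * X) * cos (pi * (real i + 1) * X)) =
       cos (pi * (real j + 1) * X - pi * (real i + 1) * X) + cos (pi * (real j + 1) * X + pi * (real i + 1) * X)"
      by (simp add: cos_diff cos_add)
    also have "pi * (real j + 1) * X - pi * (real i + 1) * X = pi * real (j - i) * X"
      using assms by (simp add: of_nat_diff algebra_simps)
    also have "pi * (real j + 1) * X + pi * (real i + 1) * X = pi * (real (i + j + 1) + 1) * X"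
      by (simp add: algebra_simps)
    finally show ?thesis .
  qed
  have "(\<integral>X. kcoef i X * kcoef j X \<partial>M) =
     (\<integral>X. sig i * sig j * (cos (pi * real (j - i) * X) + cos (pi * (real (i + j + 1) + 1) * X)) \<partial>M)"
  proof (rule integral_cong_AE)
    show "AE X in M. kcoef i X * kcoef j X = sig i * sig j * (cos (pi * real (j - i) * X) + cos (pi * (real (i + j + 1) + 1) * X))"
      using AE_closed by eventually_elim (rule e, auto)
  qed (use bmeasD[OF bmeas_kcoef] in auto)
  moreover have "integrable M (\<lambda>X. cos (c * X))" for c by (intro integrable_bmeas bmeas_cos)
  ultimately show ?thesis by simp
qed

lemma sum_centered_second_moment:
  assumes f: "bmeas f" and mean: "(\<integral>x. f x \<partial>M) = 0"
  shows "(\<integral>X. (\<Sum>i\<in>{1..n}. f (X i))\<^sup>2 \<partial>PiM {1..n} (\<lambda>_. M)) = real n * (\<integral>x. (f x)\<^sup>2 \<partial>M)"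
    and "integrable (PiM {1..n} (\<lambda>_. M)) (\<lambda>X. (\<Sum>i\<in>{1..n}. f (X i))\<^sup>2)"
proof -
  let ?P = "PiM {1..n} (\<lambda>_. M)"
  note P = prob_space_axioms
  have prod: "integrable ?P (\<lambda>X. f (X i) * f (X k))"
    "(\<integral>X. f (X i) * f (X k) \<partial>?P) = (if i = k then (\<integral>x. (f x)\<^sup>2 \<partial>M) else 0)"
    if "i \<in> {1..n}" "k \<in> {1..n}" for i k
  proof -
    have "integrable ?P (\<lambda>X. f (X i) * f (X k)) \<and>
      (\<integral>X. f (X i) * f (X k) \<partial>?P) = (if i = k then (\<integral>x. (f x)\<^sup>2 \<partial>M) else 0)"
    proof (cases "i = k")
      case True
      then show ?thesis
        using integral_coordinate[OF P that(1), of "\<lambda>x. (f x)\<^sup>2"] integrable_bmeas[OF bmeas_power[OF f]]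
        by (simp add: power2_eq_square)
    next
      case False
      then show ?thesis
        using integral_prod_coordinates[OF P, of "{i,k}" "{1..n}" "\<lambda>_. f"] that integrable_bmeas[OF f] mean by simp
    qed
    then show "integrable ?P (\<lambda>X. f (X i) * f (X k))"
      "(\<integral>X. f (X i) * f (X k) \<partial>?P) = (if i = k then (\<integral>x. (f x)\<^sup>2 \<partial>M) else 0)" by auto
  qed
  have sq: "(\<Sum>i\<in>{1..n}. f (X i))\<^sup>2 = (\<Sum>i\<in>{1..n}. \<Sum>k\<in>{1..n}. f (X i) * f (X k))" for X
    by (simp add: power2_eq_square sum_product)
  show "integrable ?P (\<lambda>X. (\<Sum>i\<in>{1..n}. f (X i))\<^sup>2)"
    unfolding sq by (intro Bochner_Integration.integrable_sum prod)
  have "(\<integral>X. (\<Sum>i\<in>{1..n}. f (X i))\<^sup>2 \<partial>?P) = (\<Sum>i\<in>{1..n}. \<Sum>k\<in>{1..n}. \<integral>X. f (X i) * f (X k) \<partial>?P)"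
    unfolding sq by (subst Bochner_Integration.integral_sum, intro Bochner_Integration.integrable_sum prod, assumption+)
      (intro sum.cong refl Bochner_Integration.integral_sum prod)
  also have "\<dots> = (\<Sum>i\<in>{1..n}. \<Sum>k\<in>{1..n}. if i = k then (\<integral>x. (f x)\<^sup>2 \<partial>M) else 0)"
    by (intro sum.cong refl prod)
  also have "\<dots> = real n * (\<integral>x. (f x)\<^sup>2 \<partial>M)" by simp
  finally show "(\<integral>X. (\<Sum>i\<in>{1..n}. f (X i))\<^sup>2 \<partial>?P) = real n * (\<integral>x. (f x)\<^sup>2 \<partial>M)" .
qed

end

lemma scaled_centered_sum:
  fixes g :: "nat \<Rightarrow> real"
  assumes "n > 0"
  shows "sqrt (real n) * ((1 / real n) * (\<Sum>i\<in>{1..n}. g i) - c) = (1 / sqrt (real n)) * (\<Sum>i\<in>{1..n}. g i - c)"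
proof -
  have "(\<Sum>i\<in>{1..n}. g i - c) = (\<Sum>i\<in>{1..n}. g i) - real n * c" by (simp add: sum_subtractf)
  moreover have "sqrt (real n) * (1 / real n) = 1 / sqrt (real n)" "1 / sqrt (real n) * real n = sqrt (real n)"
    using assms by (simp_all add: real_div_sqrt field_simps)
  ultimately show ?thesis by (simp only: right_diff_distrib mult.assoc[symmetric])
qed

definition iid :: "real measure \<Rightarrow> nat \<Rightarrow> (nat \<Rightarrow> real) measure" where
  "iid M n = PiM {1..n} (\<lambda>_. M)"

text \<open>By \<open>expectation_tail_noise\<close>, the expected squared norm of the component of the empirical process that
  is orthogonal to the first \<open>d\<close> sine functions.\<close>

definition tail_mean :: "real measure \<Rightarrow> nat \<Rightarrow> real" where
  "tail_mean M d = (\<integral>x. cdf M x * (1 - cdf M x) \<partial>U01) -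
     (\<Sum>j<d. (\<integral>X. (kcoef j X)\<^sup>2 \<partial>M) - (coef (\<lambda>x. cdf M x - F0 x) j)\<^sup>2)"

context law01 begin

lemma prob_space_iid: "prob_space (iid M n)"
  unfolding iid_def by (intro prob_space_PiM prob_space_axioms)

lemma sets_iid [measurable_cong]: "sets (iid M n) = sets (PiM {1..n} (\<lambda>_. borel))"
  unfolding iid_def by (intro sets_PiM_cong) auto

lemma measurable_iid_component [measurable]: "i \<in> {1..n} \<Longrightarrow> (\<lambda>X. X i) \<in> borel_measurable (iid M n)"
  unfolding iid_def using measurable_component_singleton[of i "{1..n}" "\<lambda>_. M"] by simp

lemma measurable_emp_cdf [measurable]:
  "(\<lambda>(X, x). emp_cdf n X x) \<in> borel_measurable (iid M n \<Otimes>\<^sub>M borel)"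
proof -
  have eq: "(\<lambda>(X, x). emp_cdf n X x) = (\<lambda>(X, x). (\<Sum>i\<in>{1..n}. of_bool (X i \<le> x)) / real n)"
    by (auto simp: emp_cdf_def of_bool_def sum.If_cases Int_def fun_eq_iff)
  have [measurable]: "(\<lambda>p. fst p i) \<in> borel_measurable (iid M n \<Otimes>\<^sub>M borel)" if "i \<in> {1..n}" for i
    by (rule measurable_compose[OF measurable_fst measurable_iid_component[OF that]])
  show ?thesis unfolding eq unfolding split_beta' by measurable
qed

lemma measurable_T2_emp:
  assumes [measurable]: "G \<in> borel_measurable borel"
  shows "(\<lambda>X. T2 (\<lambda>x. emp_cdf n X x - G x)) \<in> borel_measurable (iid M n)"
proof -
  have e: "(\<lambda>p. emp_cdf n (fst p) (snd p)) \<in> borel_measurable (iid M n \<Otimes>\<^sub>M borel)"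
    using measurable_emp_cdf[of n] by (simp add: split_beta')
  have "(\<lambda>p. indicat_real {0..1} (snd p) *\<^sub>R (emp_cdf n (fst p) (snd p) - G (snd p))\<^sup>2) \<in> borel_measurable (iid M n \<Otimes>\<^sub>M borel)"
    by (intro borel_measurable_scaleR borel_measurable_power borel_measurable_diff e) measurable
  then have "(\<lambda>(X, x). indicat_real {0..1} x *\<^sub>R (emp_cdf n X x - G x)\<^sup>2) \<in> borel_measurable (iid M n \<Otimes>\<^sub>M lborel)"
    by (subst measurable_cong_sets[OF sets_pair_measure_cong[OF refl sets_lborel] refl]) (simp add: split_beta')
  then show ?thesis
    unfolding T2_def set_lebesgue_integral_def
    by (rule lborel.borel_measurable_lebesgue_integral)
qed

abbreviation "noise n X x \<equiv> sqrt (real n) * (emp_cdf n X x - F x)"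
abbreviation "drift n x \<equiv> sqrt (real n) * (F x - F0 x)"

lemma noise_eq:
  assumes "n > 0"
  shows "noise n X x = (1 / sqrt (real n)) * (\<Sum>i\<in>{1..n}. of_bool (X i \<le> x) - F x)"
proof -
  have "noise n X x = sqrt n * ((emp_cdf n X x - F0 x) - (F x - F0 x))" by simp
  also have "\<dots> = (1 / sqrt (real n)) * (\<Sum>i\<in>{1..n}. kern (X i) x - (F x - F0 x))"
    unfolding emp_cdf_deviation[OF assms] by (rule scaled_centered_sum[OF assms])
  also have "(\<Sum>i\<in>{1..n}. kern (X i) x - (F x - F0 x)) = (\<Sum>i\<in>{1..n}. of_bool (X i \<le> x) - F x)"
    by (simp add: kern_def)
  finally show ?thesis .
qed

lemma coef_noise:
  assumes "n > 0"
  shows "coef (noise n X) j = (1 / sqrt (real n)) * (\<Sum>i\<in>{1..n}. kcoef j (X i) - coef (\<lambda>x. F x - F0 x) j)"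
proof -
  have "coef (noise n X) j = sqrt n * (coef (\<lambda>x. emp_cdf n X x - F0 x) j - coef (\<lambda>x. F x - F0 x) j)"
    unfolding coef_cmult using coef_diff[OF bmeas_emp_deviation[OF assms, of X] bmeas_F_F0, of j] by simp
  also have "\<dots> = (1 / sqrt (real n)) * (\<Sum>i\<in>{1..n}. kcoef j (X i) - coef (\<lambda>x. F x - F0 x) j)"
    unfolding coef_emp_deviation[OF assms] by (rule scaled_centered_sum[OF assms])
  finally show ?thesis .
qed

lemma bmeas_noise: "n > 0 \<Longrightarrow> bmeas (noise n X)"
  using bmeas_cmult[OF bmeas_diff[OF bmeas_emp_deviation bmeas_F_F0], of n "sqrt n" X] by simp

lemma bmeas_drift: "bmeas (drift n)"
  by (intro bmeas_cmult bmeas_F_F0)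

text \<open>Pointwise, the squared empirical process has the variance of a Bernoulli variable as its mean.\<close>

lemma expectation_T2_noise:
  assumes "n > 0"
  shows "(\<integral>X. T2 (noise n X) \<partial>iid M n) = (\<integral>x. F x * (1 - F x) \<partial>U01)"
    and "integrable (iid M n) (\<lambda>X. T2 (noise n X))"
proof -
  interpret P: prob_space "iid M n" by (rule prob_space_iid)
  interpret U: prob_space U01 by (rule prob_space_U01)
  interpret PU: pair_prob_space "iid M n" U01 by unfold_locales
  have m [measurable]: "(\<lambda>(X, x). (noise n X x)\<^sup>2) \<in> borel_measurable (iid M n \<Otimes>\<^sub>M U01)"
    by measurable
  have bd: "\<bar>(noise n X x)\<^sup>2\<bar> \<le> real n" for X x
  proof -
    have "card {i \<in> {1..n}. X i \<le> x} \<le> card {1..n}" by (rule card_mono) auto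
    then have "0 \<le> emp_cdf n X x" "emp_cdf n X x \<le> 1" by (auto simp: emp_cdf_def divide_le_eq)
    then have "\<bar>emp_cdf n X x - F x\<bar> \<le> 1" using F_bounds[of x] by linarith
    then have "(emp_cdf n X x - F x)\<^sup>2 \<le> 1" by (simp add: abs_square_le_1)
    then show ?thesis by (simp add: power_mult_distrib mult_left_le)
  qed
  have int: "integrable (iid M n \<Otimes>\<^sub>M U01) (\<lambda>(X, x). (noise n X x)\<^sup>2)"
    using bd by (intro PU.P.integrable_const_bound[of _ "real n"] m) auto
  have T2: "T2 (noise n X) = (\<integral>x. (noise n X x)\<^sup>2 \<partial>U01)" for X
    using T2_eq_ip[OF bmeas_noise[OF assms, of X]] by (simp add: ip_def power2_eq_square)
  show "integrable (iid M n) (\<lambda>X. T2 (noise n X))"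
    unfolding T2 using PU.integrable_fst[OF int] by simp
  have pt: "(\<integral>X. (noise n X x)\<^sup>2 \<partial>iid M n) = F x * (1 - F x)" for x
  proof -
    have b: "bmeas (\<lambda>X. of_bool (X \<le> x))" by (intro bmeasI[of _ 1]) auto
    let ?f = "\<lambda>X. of_bool (X \<le> x) - F x"
    have bf: "bmeas ?f" by (intro bmeas_diff b bmeas_const)
    have "(\<integral>X. ?f X \<partial>M) = 0"
      using integrable_bmeas[OF b] prob_space by (simp add: integral_step)
    note S = sum_centered_second_moment[OF bf this, of n]
    have "(\<integral>X. (noise n X x)\<^sup>2 \<partial>iid M n) = (1 / real n) * (\<integral>X. (\<Sum>i\<in>{1..n}. ?f (X i))\<^sup>2 \<partial>iid M n)"
      unfolding noise_eq[OF assms] power_mult_distrib by (simp add: power_divide)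
    also have "\<dots> = (\<integral>X. (?f X)\<^sup>2 \<partial>M)" using S(1) assms by (simp add: iid_def)
    also have "\<dots> = (\<integral>X. (1 - 2 * F x) * of_bool (X \<le> x) + (F x)\<^sup>2 \<partial>M)"
      by (intro Bochner_Integration.integral_cong) (auto simp: power2_eq_square algebra_simps)
    also have "\<dots> = (1 - 2 * F x) * F x + (F x)\<^sup>2"
      using integrable_bmeas[OF b] prob_space by (simp add: integral_step)
    finally show ?thesis by (simp add: power2_eq_square algebra_simps)
  qed
  have "(\<integral>X. T2 (noise n X) \<partial>iid M n) = (\<integral>x. (\<integral>X. (noise n X x)\<^sup>2 \<partial>iid M n) \<partial>U01)"
    unfolding T2 by (rule PU.Fubini_integral[symmetric, OF int])
  then show "(\<integral>X. T2 (noise n X) \<partial>iid M n) = (\<integral>x. F x * (1 - F x) \<partial>U01)"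
    by (simp add: pt)
qed

lemma expectation_T2_noise_le:
  assumes "n > 0"
  shows "(\<integral>X. T2 (noise n X) \<partial>iid M n) \<le> 1 / 4"
proof -
  interpret U: prob_space U01 by (rule prob_space_U01)
  have "F x * (1 - F x) \<le> 1 / 4" for x
    using zero_le_power2[of "F x - 1 / 2"] by (simp add: power2_eq_square algebra_simps)
  moreover have "integrable U01 (\<lambda>x. F x * (1 - F x))"
    by (intro bmeas_integrable_U01 bmeas_intros bmeas_F)
  ultimately have "(\<integral>x. F x * (1 - F x) \<partial>U01) \<le> (\<integral>x. 1 / 4 \<partial>U01)"
    by (intro integral_mono) auto
  then show ?thesis using expectation_T2_noise(1)[OF assms] U.prob_space by simp
qed

lemma expectation_coef_noise_sq:
  assumes "n > 0"
  shows "(\<integral>X. (coef (noise n X) j)\<^sup>2 \<partial>iid M n) = (\<integral>X. (kcoef j X)\<^sup>2 \<partial>M) - (coef (\<lambda>x. F x - F0 x) j)\<^sup>2"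
    and "integrable (iid M n) (\<lambda>X. (coef (noise n X) j)\<^sup>2)"
proof -
  let ?c = "coef (\<lambda>x. F x - F0 x) j"
  let ?f = "\<lambda>X. kcoef j X - ?c"
  have bf: "bmeas ?f" by (intro bmeas_diff bmeas_kcoef bmeas_const)
  have ik: "integrable M (kcoef j)" "integrable M (\<lambda>X. (kcoef j X)\<^sup>2)"
    by (intro integrable_bmeas bmeas_power bmeas_kcoef)+
  have "(\<integral>X. ?f X \<partial>M) = 0" using ik prob_space by (simp add: integral_kcoef)
  note S = sum_centered_second_moment[OF bf this, of n]
  show "integrable (iid M n) (\<lambda>X. (coef (noise n X) j)\<^sup>2)"
    unfolding coef_noise[OF assms] power_mult_distrib using S(2) by (simp add: iid_def)
  have "(\<integral>X. (coef (noise n X) j)\<^sup>2 \<partial>iid M n) = (1 / real n) * (\<integral>X. (\<Sum>i\<in>{1..n}. ?f (X i))\<^sup>2 \<partial>iid M n)"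
    unfolding coef_noise[OF assms] power_mult_distrib by (simp add: power_divide)
  also have "\<dots> = (\<integral>X. (?f X)\<^sup>2 \<partial>M)" using S(1) assms by (simp add: iid_def)
  also have "\<dots> = (\<integral>X. (kcoef j X)\<^sup>2 - (2 * ?c) * kcoef j X + ?c\<^sup>2 \<partial>M)"
    by (intro Bochner_Integration.integral_cong) (auto simp: power2_eq_square algebra_simps)
  also have "\<dots> = (\<integral>X. (kcoef j X)\<^sup>2 \<partial>M) - ?c\<^sup>2"
    using ik prob_space by (simp add: integral_kcoef power2_eq_square)
  finally show "(\<integral>X. (coef (noise n X) j)\<^sup>2 \<partial>iid M n) = (\<integral>X. (kcoef j X)\<^sup>2 \<partial>M) - ?c\<^sup>2" .
qed

lemma expectation_tail_noise:
  assumes "n > 0"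
  shows "(\<integral>X. tail_norm2 d (noise n X) \<partial>iid M n) = tail_mean M d"
    and "integrable (iid M n) (\<lambda>X. tail_norm2 d (noise n X))"
proof -
  have eq: "tail_norm2 d (noise n X) = T2 (noise n X) - (\<Sum>j<d. (coef (noise n X) j)\<^sup>2)" for X
    using T2_eq_ip[OF bmeas_noise[OF assms, of X]] by (simp add: tail_norm2_def)
  show "integrable (iid M n) (\<lambda>X. tail_norm2 d (noise n X))"
    unfolding eq
    by (intro Bochner_Integration.integrable_diff Bochner_Integration.integrable_sum
        expectation_T2_noise expectation_coef_noise_sq assms)
  show "(\<integral>X. tail_norm2 d (noise n X) \<partial>iid M n) = tail_mean M d"
    unfolding eq tail_mean_def
    by (simp add: Bochner_Integration.integrable_sum expectation_T2_noise expectation_coef_noise_sq assms)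
qed

text \<open>A central limit theorem with an error bound that depends on the law only through \<open>B\<close>. The law may
  therefore change with \<open>n\<close>.\<close>

lemma char_sum_bound:
  assumes f: "bmeas f" and B: "\<And>x. \<bar>f x\<bar> \<le> B" and mean: "(\<integral>x. f x \<partial>M) = 0" and n: "n > 0"
  defines "v \<equiv> (\<integral>x. (f x)\<^sup>2 \<partial>M)"
  shows "cmod ((\<integral>X. iexp ((1 / sqrt (real n)) * (\<Sum>i\<in>{1..n}. f (X i))) \<partial>iid M n) - exp (- v / 2))
    \<le> B ^ 3 / (6 * sqrt (real n)) + B ^ 4 / (4 * real n)"
proof -
  let ?t = "1 / sqrt (real n)"
  have fm [measurable]: "f \<in> borel_measurable borel" by (rule bmeasD[OF f])
  have B0: "0 \<le> B" using B[of 0] by linarith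
  have fi: "integrable M f" "integrable M (\<lambda>x. (f x)\<^sup>2)" by (intro integrable_bmeas f bmeas_power)+
  define \<phi> where "\<phi> = (\<integral>x. iexp (?t * f x) \<partial>M)"
  define y where "y = v / (2 * real n)"
  have fsq: "(f x)\<^sup>2 \<le> B\<^sup>2" for x using B[of x] B0 by (simp add: abs_le_square_iff[symmetric])
  have v: "0 \<le> v" "v \<le> B\<^sup>2"
  proof -
    show "0 \<le> v" by (simp add: v_def)
    have "v \<le> (\<integral>x. B\<^sup>2 \<partial>M)" unfolding v_def by (intro integral_mono fi fsq) simp
    then show "v \<le> B\<^sup>2" using prob_space by simp
  qed
  then have y: "0 \<le> y" "y \<le> B\<^sup>2 / (2 * real n)" using n by (auto simp: y_def divide_right_mono)
  have prod: "(\<integral>X. iexp (?t * (\<Sum>i\<in>{1..n}. f (X i))) \<partial>iid M n) = \<phi> ^ n"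
  proof -
    have "(\<integral>X. iexp (?t * (\<Sum>i\<in>{1..n}. f (X i))) \<partial>iid M n) = (\<integral>X. (\<Prod>i\<in>{1..n}. iexp (?t * f (X i))) \<partial>iid M n)"
      by (simp add: sum_distrib_left exp_sum)
    also have "\<dots> = (\<Prod>i\<in>{1..n}. \<phi>)"
      unfolding iid_def \<phi>_def
      by (rule integral_prod_coordinates) (auto intro!: integrable_const_bound[of _ 1] prob_space_axioms)
    finally show ?thesis by simp
  qed
  have \<phi>_char: "\<phi> = char (distr M borel f) ?t"
    by (simp add: \<phi>_def char_def integral_distr)
  have \<phi>1: "cmod \<phi> \<le> 1"
    unfolding \<phi>_char by (intro real_distribution.cmod_char_le_1 real_distribution_distr) simp
  have 1: "cmod (\<phi> - complex_of_real (1 - y)) \<le> B ^ 3 / (6 * real n * sqrt (real n))"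
  proof -
    have "cmod (char (distr M borel f) ?t - (1 - ?t^2 * v / 2)) \<le>
      (?t^2 / 6) * expectation (\<lambda>x. min (6 * (f x)^2) (\<bar>?t\<bar> * \<bar>f x\<bar>^3))"
      by (rule char_approx3') (use fi mean in \<open>auto simp: v_def\<close>)
    also have "expectation (\<lambda>x. min (6 * (f x)^2) (\<bar>?t\<bar> * \<bar>f x\<bar>^3)) \<le> (\<integral>x. ?t * B ^ 3 \<partial>M)"
    proof (rule integral_mono)
      have "\<bar>min (6 * (f x)\<^sup>2) (\<bar>?t\<bar> * \<bar>f x\<bar> ^ 3)\<bar> \<le> 6 * B\<^sup>2" for x
        using fsq[of x] by (simp add: min_def)
      then show "integrable M (\<lambda>x. min (6 * (f x)\<^sup>2) (\<bar>?t\<bar> * \<bar>f x\<bar> ^ 3))"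
        by (intro integrable_bmeas bmeasI[of _ "6 * B\<^sup>2"]) auto
      fix x
      have "\<bar>f x\<bar> ^ 3 \<le> B ^ 3" using B by (intro power_mono) auto
      then show "min (6 * (f x)\<^sup>2) (\<bar>?t\<bar> * \<bar>f x\<bar> ^ 3) \<le> ?t * B ^ 3"
        by (intro min.coboundedI2) (auto simp: divide_right_mono)
    qed simp
    finally have "cmod (\<phi> - (1 - ?t^2 * v / 2)) \<le> (?t^2 / 6) * (?t * B ^ 3)"
      using prob_space by (simp add: \<phi>_char mult_left_mono)
    moreover have "?t^2 * v / 2 = y" using n by (simp add: y_def power_divide)
    moreover have "(?t^2 / 6) * (?t * B ^ 3) = B ^ 3 / (6 * real n * sqrt (real n))"
      using n by (simp add: power_divide)
    ultimately show ?thesis by simp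
  qed
  \<comment> \<open>Comparing with \<open>exp (- y)\<close> instead of \<open>1 - y\<close> keeps the base of the \<open>n\<close>-th power in the unit disc
    for every \<open>n\<close>, and turns the power into \<open>exp (- v / 2)\<close> exactly.\<close>
  have 2: "\<bar>(1 - y) - exp (- y)\<bar> \<le> y\<^sup>2"
  proof -
    have a: "1 - y \<le> exp (- y)" using exp_ge_add_one_self[of "- y"] by simp
    have "1 \<le> (1 - y + y\<^sup>2) * (1 + y)" using y by (simp add: power2_eq_square algebra_simps)
    also have "\<dots> \<le> (1 - y + y\<^sup>2) * exp y"
    proof (rule mult_left_mono)
      show "0 \<le> 1 - y + y\<^sup>2" using zero_le_power2[of "y - 1/2"] by (simp add: power2_eq_square algebra_simps)
    qed (rule exp_ge_add_one_self)
    finally have "exp (- y) \<le> 1 - y + y\<^sup>2" by (simp add: exp_minus field_simps)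
    with a show ?thesis by simp
  qed
  have "cmod (\<phi> ^ n - (complex_of_real (exp (- y))) ^ n) \<le> real n * cmod (\<phi> - complex_of_real (exp (- y)))"
    by (rule norm_power_diff) (use \<phi>1 y in auto)
  also have "\<dots> \<le> real n * (B ^ 3 / (6 * real n * sqrt (real n)) + y\<^sup>2)"
  proof (rule mult_left_mono)
    have "cmod (\<phi> - complex_of_real (exp (- y))) \<le> cmod (\<phi> - complex_of_real (1 - y)) + cmod (complex_of_real (1 - y) - complex_of_real (exp (- y)))"
      using norm_triangle_ineq[of "\<phi> - complex_of_real (1 - y)" "complex_of_real (1 - y) - complex_of_real (exp (- y))"] by simp
    also have "cmod (complex_of_real (1 - y) - complex_of_real (exp (- y))) = \<bar>(1 - y) - exp (- y)\<bar>"
      unfolding of_real_diff[symmetric] norm_of_real ..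
    finally show "cmod (\<phi> - complex_of_real (exp (- y))) \<le> B ^ 3 / (6 * real n * sqrt (real n)) + y\<^sup>2"
      using 1 2 by linarith
  qed simp
  also have "\<dots> \<le> B ^ 3 / (6 * sqrt (real n)) + B ^ 4 / (4 * real n)"
  proof -
    have "y\<^sup>2 \<le> (B\<^sup>2 / (2 * real n))\<^sup>2" using y by (intro power_mono) auto
    then have "real n * y\<^sup>2 \<le> real n * (B\<^sup>2 / (2 * real n))\<^sup>2" by (intro mult_left_mono) auto
    also have "\<dots> = B ^ 4 / (4 * real n)" using n by (simp add: power_divide power2_eq_square power4_eq_xxxx)
    finally show ?thesis using n by (simp add: distrib_left)
  qed
  also have "(complex_of_real (exp (- y))) ^ n = complex_of_real (exp (- v / 2))"
    using n by (simp add: y_def exp_of_nat_mult[symmetric] flip: of_real_power)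
  finally show ?thesis unfolding prod by simp
qed

end

section \<open>Limit law of the statistic along a sequence of alternatives\<close>

text \<open>Every sequence of alternatives with \<open>T2 (F - F0)\<close> of order \<open>1 / n\<close> has subsequences of this kind. Convergence
  of all coefficients is only weak convergence of the scaled deviations, so \<open>b\<close> can be larger than
  \<open>\<Sum>j. (h j)\<^sup>2\<close>. The sample sizes \<open>m k\<close> are kept separate from the index to allow subsequences.\<close>

locale law01_seq =
  fixes L :: "nat \<Rightarrow> real measure" and m :: "nat \<Rightarrow> nat" and h :: "nat \<Rightarrow> real" and b :: real
  assumes law: "\<And>k. law01 (L k)" and m_pos: "\<And>k. m k > 0"
    and m_lim: "filterlim m at_top sequentially"
    and coef_lim: "\<And>j. (\<lambda>k. sqrt (real (m k)) * coef (\<lambda>x. cdf (L k) x - F0 x) j) \<longlonglongrightarrow> h j"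
    and dist_lim: "(\<lambda>k. real (m k) * T2 (\<lambda>x. cdf (L k) x - F0 x)) \<longlonglongrightarrow> b"
begin

abbreviation "D k \<equiv> \<lambda>x. cdf (L k) x - F0 x"
abbreviation "nz k X \<equiv> (\<lambda>x. sqrt (real (m k)) * (emp_cdf (m k) X x - cdf (L k) x))"
abbreviation "dr k \<equiv> (\<lambda>x. sqrt (real (m k)) * D k x)"
abbreviation "tot k X \<equiv> (\<lambda>x. nz k X x + dr k x)"
abbreviation "sm k \<equiv> iid (L k) (m k)"

lemma bmeas_D: "bmeas (D k)" by (rule law01.bmeas_F_F0[OF law])

lemma bmeas_nz: "bmeas (nz k X)" by (rule law01.bmeas_noise[OF law m_pos])

lemma bmeas_dr: "bmeas (dr k)" by (rule law01.bmeas_drift[OF law])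

lemma real_m_lim: "filterlim (\<lambda>k. real (m k)) at_top sequentially"
  using filterlim_compose[OF filterlim_real_sequentially m_lim] .

lemma T2_D_lim: "(\<lambda>k. T2 (D k)) \<longlonglongrightarrow> 0"
proof -
  have "(\<lambda>k. (real (m k) * T2 (D k)) * (1 / real (m k))) \<longlonglongrightarrow> b * 0"
    by (intro tendsto_mult dist_lim tendsto_divide_0[OF tendsto_const] filterlim_at_top_imp_at_infinity real_m_lim)
  then show ?thesis using m_pos by (simp add: less_imp_neq[symmetric])
qed

lemma coef_D_lim: "(\<lambda>k. coef (D k) j) \<longlonglongrightarrow> 0"
proof -
  have "(\<lambda>k. (coef (D k) j)\<^sup>2) \<longlonglongrightarrow> 0"
    by (rule tendsto_sandwich[OF _ _ tendsto_const T2_D_lim]) (auto simp: coef_sq_le bmeas_D)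
  then have "(\<lambda>k. sqrt ((coef (D k) j)\<^sup>2)) \<longlonglongrightarrow> 0" using tendsto_real_sqrt by fastforce
  then show ?thesis by (simp add: tendsto_rabs_zero_iff)
qed

lemma cos_lim: "(\<lambda>k. \<integral>X. cos (pi * real l * X) \<partial>L k) \<longlonglongrightarrow> (if l = 0 then 1 else 0)"
proof (cases l)
  case 0
  have "prob_space (L k)" for k using law[of k] by (simp add: law01_def real_distribution_def)
  then have "(\<integral>X. 1 \<partial>L k) = (1::real)" for k by (simp add: prob_space.prob_space)
  then show ?thesis using 0 by simp
next
  case (Suc i)
  have "(\<lambda>k. coef (D k) i / (sqrt 2 * sig i)) \<longlonglongrightarrow> 0 / (sqrt 2 * sig i)"
    using sig_pos[of i] by (intro tendsto_intros coef_D_lim) auto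
  then show ?thesis using law01.integral_cos[OF law, of _ i] Suc by (simp add: add.commute)
qed

text \<open>Asymptotically the single-observation coefficients are uncorrelated, as under the uniform law.\<close>

lemma kcoef_product_lim: "(\<lambda>k. \<integral>X. kcoef i X * kcoef j X \<partial>L k) \<longlonglongrightarrow> (if i = j then (sig i)\<^sup>2 else 0)"
proof -
  have *: "(\<lambda>k. \<integral>X. kcoef i X * kcoef j X \<partial>L k) \<longlonglongrightarrow> (if i = j then (sig i)\<^sup>2 else 0)" if "i \<le> j" for i j
  proof -
    have "(\<lambda>k. sig i * sig j * ((\<integral>X. cos (pi * real (j - i) * X) \<partial>L k) + (\<integral>X. cos (pi * real (i + j + 2) * X) \<partial>L k)))
      \<longlonglongrightarrow> sig i * sig j * ((if j - i = 0 then 1 else 0) + (if i + j + 2 = 0 then 1 else 0))"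
      by (intro tendsto_intros cos_lim)
    moreover have "real (i + j + 2) = real (i + j + 1) + 1" by simp
    ultimately show ?thesis
      using law01.integral_kcoef_product[OF law that] that by (simp add: power2_eq_square split: if_splits)
  qed
  show ?thesis
  proof (cases "i \<le> j")
    case True then show ?thesis by (rule *)
  next
    case False
    then show ?thesis using *[of j i] by (simp add: mult.commute)
  qed
qed

text \<open>The total variance \<open>\<integral> F (1 - F)\<close> tends to \<open>\<integral> x (1 - x) = 1/6\<close> and the variances of the first
  coefficients tend to \<open>(sig j)\<^sup>2\<close>.\<close>

lemma tail_mean_lim: "(\<lambda>k. tail_mean (L k) d) \<longlonglongrightarrow> 1 / 6 - (\<Sum>j<d. (sig j)\<^sup>2)"
proof -
  interpret U: prob_space U01 by (rule prob_space_U01)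
  have F0i: "(\<integral>x. F0 x * (1 - F0 x) \<partial>U01) = 1 / 6"
  proof -
    have "(\<integral>x. F0 x * (1 - F0 x) \<partial>U01) = (\<integral>x. x * (1 - x) \<partial>U01)"
    proof (rule integral_cong_AE)
      show "AE x in U01. F0 x * (1 - F0 x) = x * (1 - x)"
        using AE_U01 by eventually_elim (simp add: F0_def)
    qed auto
    also have "\<dots> = (1\<^sup>2 / 2 - 1 ^ 3 / 3) - (0\<^sup>2 / 2 - 0 ^ 3 / 3)"
      by (rule integral_U01_FTC0[where F="\<lambda>x. x\<^sup>2 / 2 - x ^ 3 / 3"])
        (auto intro!: derivative_eq_intros continuous_intros simp: power2_eq_square algebra_simps)
    finally show ?thesis by simp
  qed
  have bd: "\<bar>(\<integral>x. cdf (L k) x * (1 - cdf (L k) x) \<partial>U01) - 1 / 6\<bar> \<le> sqrt (T2 (D k))" for k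
  proof -
    interpret law01 "L k" by (rule law)
    have b: "bmeas (\<lambda>x. F x * (1 - F x))" "bmeas (\<lambda>x. F0 x * (1 - F0 x))"
      by (intro bmeas_intros bmeas_F bmeas_F0)+
    have ba: "bmeas (\<lambda>x. \<bar>D k x\<bar>)" using bmeas_D[of k] by (auto simp: bmeas_def)
    define c where "c = (\<integral>x. \<bar>D k x\<bar> \<partial>U01)"
    have "0 \<le> (\<integral>x. (\<bar>D k x\<bar> - c)\<^sup>2 \<partial>U01)" by simp
    also have "(\<lambda>x. (\<bar>D k x\<bar> - c)\<^sup>2) = (\<lambda>x. D k x * D k x - 2 * c * \<bar>D k x\<bar> + c\<^sup>2)"
      by (auto simp: power2_eq_square algebra_simps fun_eq_iff)
    also have "(\<integral>x. D k x * D k x - 2 * c * \<bar>D k x\<bar> + c\<^sup>2 \<partial>U01) = ip (D k) (D k) - 2 * c * c + c\<^sup>2"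
      using bmeas_integrable_U01[OF ba] bmeas_integrable_U01[OF bmeas_mult[OF bmeas_D bmeas_D]] U.prob_space
      by (simp add: ip_def c_def)
    finally have "c\<^sup>2 \<le> T2 (D k)" by (simp add: T2_eq_ip[OF bmeas_D] power2_eq_square)
    then have cs: "c \<le> sqrt (T2 (D k))" by (rule real_le_rsqrt)
    have "(\<integral>x. F x * (1 - F x) \<partial>U01) - 1 / 6 = (\<integral>x. F x * (1 - F x) - F0 x * (1 - F0 x) \<partial>U01)"
      using F0i bmeas_integrable_U01[OF b(1)] bmeas_integrable_U01[OF b(2)] by simp
    also have "\<bar>\<dots>\<bar> \<le> (\<integral>x. \<bar>F x * (1 - F x) - F0 x * (1 - F0 x)\<bar> \<partial>U01)"
      by (rule integral_abs_bound)
    also have "\<dots> \<le> c"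
      unfolding c_def
    proof (rule integral_mono)
      show "integrable U01 (\<lambda>x. \<bar>F x * (1 - F x) - F0 x * (1 - F0 x)\<bar>)"
        using b by (intro integrable_abs bmeas_integrable_U01 bmeas_diff)
      show "integrable U01 (\<lambda>x. \<bar>D k x\<bar>)" by (rule bmeas_integrable_U01[OF ba])
      fix x
      have "F x * (1 - F x) - F0 x * (1 - F0 x) = D k x * (1 - F x - F0 x)" by (simp add: algebra_simps)
      moreover have "\<bar>1 - F x - F0 x\<bar> \<le> 1" using F_bounds[of x] F0_bounds[of x] by linarith
      ultimately show "\<bar>F x * (1 - F x) - F0 x * (1 - F0 x)\<bar> \<le> \<bar>D k x\<bar>"
        by (simp add: abs_mult mult_left_le)
    qed
    finally show ?thesis using cs by linarith
  qed
  have "(\<lambda>k. sqrt (T2 (D k))) \<longlonglongrightarrow> 0" using tendsto_real_sqrt[OF T2_D_lim] by simp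
  then have "(\<lambda>k. (\<integral>x. cdf (L k) x * (1 - cdf (L k) x) \<partial>U01) - 1 / 6) \<longlonglongrightarrow> 0"
    by (rule Lim_null_comparison[rotated]) (use bd in auto)
  then have 1: "(\<lambda>k. \<integral>x. cdf (L k) x * (1 - cdf (L k) x) \<partial>U01) \<longlonglongrightarrow> 1 / 6"
    by (simp add: LIM_zero_iff)
  have "(\<lambda>k. \<integral>X. (kcoef j X)\<^sup>2 \<partial>L k) \<longlonglongrightarrow> (sig j)\<^sup>2" for j
    using kcoef_product_lim[of j j] by (simp add: power2_eq_square)
  then have "(\<lambda>k. tail_mean (L k) d) \<longlonglongrightarrow> 1 / 6 - (\<Sum>j<d. (sig j)\<^sup>2 - 0\<^sup>2)"
    unfolding tail_mean_def by (intro tendsto_intros 1 coef_D_lim)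
  then show ?thesis by simp
qed

lemma sum_h_sq_le: "(\<Sum>j<d. (h j)\<^sup>2) \<le> b"
proof (rule LIMSEQ_le)
  show "(\<lambda>k. \<Sum>j<d. (sqrt (real (m k)) * coef (D k) j)\<^sup>2) \<longlonglongrightarrow> (\<Sum>j<d. (h j)\<^sup>2)"
    by (intro tendsto_intros coef_lim)
  show "\<exists>K. \<forall>k\<ge>K. (\<Sum>j<d. (sqrt (real (m k)) * coef (D k) j)\<^sup>2) \<le> real (m k) * T2 (D k)"
  proof (intro exI allI impI)
    fix k
    have "(\<Sum>j<d. (sqrt (real (m k)) * coef (D k) j)\<^sup>2) = real (m k) * (\<Sum>j<d. (coef (D k) j)\<^sup>2)"
      by (simp add: power_mult_distrib sum_distrib_left)
    also have "\<dots> \<le> real (m k) * T2 (D k)"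
      using tail_norm2_nonneg[OF bmeas_D, of d k] by (intro mult_left_mono) (auto simp: tail_norm2_def T2_eq_ip[OF bmeas_D])
    finally show "(\<Sum>j<d. (sqrt (real (m k)) * coef (D k) j)\<^sup>2) \<le> real (m k) * T2 (D k)" .
  qed
qed (rule dist_lim)

lemma summable_h_sq: "summable (\<lambda>j. (h j)\<^sup>2)"
  by (rule summableI_nonneg_bounded[OF _ sum_h_sq_le]) auto

lemma suminf_h_sq_le: "(\<Sum>j. (h j)\<^sup>2) \<le> b"
  by (rule suminf_le_const[OF summable_h_sq sum_h_sq_le])

lemma char_lim:
  "(\<lambda>k. \<integral>X. iexp (\<Sum>j<d. w j * coef (tot k X) j) \<partial>sm k) \<longlonglongrightarrow>
    (\<integral>v. iexp (\<Sum>j<d. w j * (sig j * v j + h j)) \<partial>gauss_seq)"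
proof -
  define U where "U X = (\<Sum>j<d. w j * kcoef j X)" for X
  have bU: "bmeas U" unfolding U_def[abs_def] by (intro bmeas_sum bmeas_cmult bmeas_kcoef)
  obtain C where C: "\<And>x. \<bar>U x\<bar> \<le> C" using bU by (auto simp: bmeas_def)
  define u where "u k = (\<Sum>j<d. w j * coef (D k) j)" for k
  have P: "prob_space (L k)" for k using law[of k] by (simp add: law01_def real_distribution_def)
  have EU: "(\<integral>X. U X \<partial>L k) = u k" for k
    unfolding U_def u_def using law01.integrable_bmeas[OF law bmeas_kcoef] law01.integral_kcoef[OF law]
    by (simp add: Bochner_Integration.integral_sum)
  have uC: "\<bar>u k\<bar> \<le> C" for k
  proof -
    interpret law01 "L k" by (rule law)
    have "\<bar>\<integral>X. U X \<partial>L k\<bar> \<le> (\<integral>X. \<bar>U X\<bar> \<partial>L k)" by (rule integral_abs_bound)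
    also have "\<dots> \<le> (\<integral>X. C \<partial>L k)" by (intro integral_mono integrable_abs integrable_bmeas bU C bmeas_const)
    finally show ?thesis using EU[of k] prob_space by simp
  qed
  define f where "f k X = U X - u k" for k X
  have bf: "bmeas (f k)" for k unfolding f_def[abs_def] by (intro bmeas_diff bU bmeas_const)
  have fC: "\<bar>f k x\<bar> \<le> 2 * C" for k x unfolding f_def using C[of x] uC[of k] by linarith
  have Ef: "(\<integral>x. f k x \<partial>L k) = 0" for k
  proof -
    interpret law01 "L k" by (rule law)
    show ?thesis unfolding f_def using integrable_bmeas[OF bU] EU[of k] prob_space by simp
  qed
  define v where "v k = (\<integral>x. (f k x)\<^sup>2 \<partial>L k)" for k
  have v_lim: "v \<longlonglongrightarrow> (\<Sum>j<d. (w j * sig j)\<^sup>2)"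
  proof -
    have v_eq: "v k = (\<Sum>i<d. \<Sum>j<d. (w i * w j) * (\<integral>X. kcoef i X * kcoef j X \<partial>L k)) - (u k)\<^sup>2" for k
    proof -
      interpret law01 "L k" by (rule law)
      have ii: "integrable (L k) (\<lambda>X. kcoef i X * kcoef j X)" for i j by (intro integrable_bmeas bmeas_mult bmeas_kcoef)
      have iU: "integrable (L k) U" "integrable (L k) (\<lambda>X. (U X)\<^sup>2)" by (intro integrable_bmeas bU bmeas_power)+
      have "v k = (\<integral>X. (U X)\<^sup>2 - 2 * u k * U X + (u k)\<^sup>2 \<partial>L k)"
        unfolding v_def f_def by (intro Bochner_Integration.integral_cong) (auto simp: power2_eq_square algebra_simps)
      also have "\<dots> = (\<integral>X. (U X)\<^sup>2 \<partial>L k) - (u k)\<^sup>2"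
        using iU EU[of k] prob_space by (simp add: power2_eq_square)
      also have "(\<integral>X. (U X)\<^sup>2 \<partial>L k) = (\<integral>X. (\<Sum>i<d. \<Sum>j<d. (w i * w j) * (kcoef i X * kcoef j X)) \<partial>L k)"
        unfolding U_def by (intro Bochner_Integration.integral_cong) (auto simp: power2_eq_square sum_product mult_ac)
      also have "\<dots> = (\<Sum>i<d. \<Sum>j<d. (w i * w j) * (\<integral>X. kcoef i X * kcoef j X \<partial>L k))"
        using ii by (simp add: Bochner_Integration.integral_sum)
      finally show ?thesis .
    qed
    have "v \<longlonglongrightarrow> (\<Sum>i<d. \<Sum>j<d. (w i * w j) * (if i = j then (sig i)\<^sup>2 else 0)) - (\<Sum>j<d. w j * 0)\<^sup>2"
      unfolding v_eq[abs_def] u_def by (intro tendsto_intros kcoef_product_lim coef_D_lim)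
    also have "(\<Sum>i<d. \<Sum>j<d. (w i * w j) * (if i = j then (sig i)\<^sup>2 else 0)) - (\<Sum>j<d. w j * 0)\<^sup>2 = (\<Sum>j<d. (w j * sig j)\<^sup>2)"
      by (simp add: if_distrib power_mult_distrib power2_eq_square mult_ac cong: if_cong)
    finally show ?thesis .
  qed
  let ?S = "\<lambda>k X. (1 / sqrt (real (m k))) * (\<Sum>i\<in>{1..m k}. f k (X i))"
  have S_lim: "(\<lambda>k. \<integral>X. iexp (?S k X) \<partial>sm k) \<longlonglongrightarrow> complex_of_real (exp (- (\<Sum>j<d. (w j * sig j)\<^sup>2) / 2))"
  proof -
    have "(\<lambda>k. (2 * C) ^ 3 / (6 * sqrt (real (m k))) + (2 * C) ^ 4 / (4 * real (m k))) \<longlonglongrightarrow> 0 + 0"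
      by (intro tendsto_add tendsto_divide_0[OF tendsto_const] filterlim_at_top_imp_at_infinity
          filterlim_tendsto_pos_mult_at_top[OF tendsto_const] real_m_lim
          filterlim_compose[OF sqrt_at_top real_m_lim]) auto
    then have z: "(\<lambda>k. (2 * C) ^ 3 / (6 * sqrt (real (m k))) + (2 * C) ^ 4 / (4 * real (m k))) \<longlonglongrightarrow> 0" by simp
    have "cmod ((\<integral>X. iexp (?S k X) \<partial>sm k) - complex_of_real (exp (- v k / 2))) \<le>
        (2 * C) ^ 3 / (6 * sqrt (real (m k))) + (2 * C) ^ 4 / (4 * real (m k))" for k
      unfolding v_def by (rule law01.char_sum_bound[OF law bf fC Ef m_pos])
    then have "(\<lambda>k. (\<integral>X. iexp (?S k X) \<partial>sm k) - complex_of_real (exp (- v k / 2))) \<longlonglongrightarrow> 0"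
      by (intro Lim_null_comparison[OF always_eventually z]) blast
    moreover have "(\<lambda>k. complex_of_real (exp (- v k / 2))) \<longlonglongrightarrow> complex_of_real (exp (- (\<Sum>j<d. (w j * sig j)\<^sup>2) / 2))"
      by (intro tendsto_intros v_lim) simp
    ultimately show ?thesis by (rule Lim_transform[rotated])
  qed
  have lhs: "(\<integral>X. iexp (\<Sum>j<d. w j * coef (tot k X) j) \<partial>sm k) =
     iexp (\<Sum>j<d. w j * (sqrt (real (m k)) * coef (D k) j)) * (\<integral>X. iexp (?S k X) \<partial>sm k)" for k
  proof -
    have "(\<Sum>j<d. w j * coef (tot k X) j) = (\<Sum>j<d. w j * (sqrt (real (m k)) * coef (D k) j)) + ?S k X" for X
    proof -
      have "(\<Sum>j<d. w j * coef (nz k X) j) = (\<Sum>j<d. (1 / sqrt (real (m k))) * (\<Sum>i\<in>{1..m k}. w j * (kcoef j (X i) - coef (D k) j)))"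
        unfolding law01.coef_noise[OF law m_pos]
        by (intro sum.cong refl, subst sum_distrib_left[symmetric], rule mult.left_commute)
      also have "\<dots> = (1 / sqrt (real (m k))) * (\<Sum>i\<in>{1..m k}. \<Sum>j<d. w j * (kcoef j (X i) - coef (D k) j))"
        by (subst sum.swap) (simp only: sum_distrib_left)
      also have "\<dots> = ?S k X"
        by (simp add: f_def U_def u_def right_diff_distrib sum_subtractf)
      finally have "(\<Sum>j<d. w j * coef (nz k X) j) = ?S k X" .
      then show ?thesis
        by (simp add: coef_add[OF bmeas_nz bmeas_dr] coef_cmult distrib_left sum.distrib)
    qed
    then show ?thesis by (simp add: distrib_left exp_add del: of_real_sum)
  qed
  have rhs: "(\<integral>v. iexp (\<Sum>j<d. w j * (sig j * v j + h j)) \<partial>gauss_seq) =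
     iexp (\<Sum>j<d. w j * h j) * complex_of_real (exp (- (\<Sum>j<d. (w j * sig j)\<^sup>2) / 2))"
  proof -
    have "(\<Sum>j<d. w j * (sig j * v j + h j)) = (\<Sum>j<d. w j * h j) + (\<Sum>j<d. (w j * sig j) * v j)" for v
      by (simp add: distrib_left sum.distrib mult.assoc)
    then have "(\<integral>v. iexp (\<Sum>j<d. w j * (sig j * v j + h j)) \<partial>gauss_seq) =
      (\<integral>v. iexp (\<Sum>j<d. w j * h j) * iexp (\<Sum>j<d. (w j * sig j) * v j) \<partial>gauss_seq)"
      by (simp add: distrib_left exp_add del: of_real_sum)
    then show ?thesis using gauss_seq_char[where u="\<lambda>j. w j * sig j" and d=d] by (simp del: of_real_sum)
  qed
  show ?thesis
    unfolding lhs rhs by (intro tendsto_mult S_lim tendsto_intros coef_lim)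
qed

end

lemma T2_cmult:
  assumes "bmeas f" shows "T2 (\<lambda>x. c * f x) = c\<^sup>2 * T2 f"
  using T2_eq_ip[OF bmeas_cmult[OF assms, of c]] T2_eq_ip[OF assms]
  by (simp add: ip_cmult_left ip_commute[of f "\<lambda>x. c * f x"] power2_eq_square)

lemma exp_minus_lipschitz:
  fixes x y :: real assumes "0 \<le> x" "0 \<le> y"
  shows "\<bar>exp (- x) - exp (- y)\<bar> \<le> \<bar>x - y\<bar>"
proof -
  have *: "exp (- u) - exp (- v) \<le> v - u" if "0 \<le> u" "u \<le> v" for u v :: real
  proof -
    have "exp (- u) - exp (- v) = exp (- u) * (1 - exp (- (v - u)))"
      by (simp add: right_diff_distrib exp_add[symmetric])
    also have "\<dots> \<le> 1 * (v - u)"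
    proof (rule mult_mono)
      show "1 - exp (- (v - u)) \<le> v - u" using exp_ge_add_one_self[of "- (v - u)"] by linarith
    qed (use that in auto)
    finally show ?thesis by simp
  qed
  show ?thesis
  proof (cases "x \<le> y")
    case True
    then show ?thesis using *[of x y] assms by simp
  next
    case False
    then show ?thesis using *[of y x] assms by simp
  qed
qed

context law01_seq begin

abbreviation "stat k X \<equiv> real (m k) * T2 (\<lambda>x. emp_cdf (m k) X x - F0 x)"
abbreviation "excess \<equiv> b - (\<Sum>j. (h j)\<^sup>2)"

lemma stat_eq: "stat k X = T2 (tot k X)"
proof -
  have "(tot k X) = (\<lambda>x. sqrt (real (m k)) * (emp_cdf (m k) X x - F0 x))"
    by (simp add: algebra_simps)
  then show ?thesis using T2_cmult[OF bmeas_emp_deviation[OF m_pos], of "sqrt (real (m k))" k X] by simp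
qed

lemma measurable_stat: "(\<lambda>X. stat k X) \<in> borel_measurable (sm k)"
  by (intro borel_measurable_times borel_measurable_const law01.measurable_T2_emp[OF law] F0_measurable)

lemma measurable_coef: "(\<lambda>X. coef (tot k X) j) \<in> borel_measurable (sm k)"
proof -
  have "(\<lambda>X. kcoef j (X i)) \<in> borel_measurable (sm k)" if "i \<in> {1..m k}" for i
    by (rule measurable_compose[OF law01.measurable_iid_component[OF law that] bmeasD[OF bmeas_kcoef]])
  then show ?thesis
    unfolding coef_add[OF bmeas_nz bmeas_dr] law01.coef_noise[OF law m_pos] by simp
qed

text \<open>For large \<open>d\<close> the first \<open>d\<close> coefficients determine the transform up to an error that stays small for all
  large \<open>k\<close>; letting first \<open>k\<close> and then \<open>d\<close> tend to infinity gives the limit.\<close>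

lemma laplace_lim:
  assumes s: "s > 0"
  shows "(\<lambda>k. \<integral>X. exp (- s * stat k X) \<partial>sm k) \<longlonglongrightarrow> (\<integral>v. exp (- s * (gauss_norm2 h v + excess)) \<partial>gauss_seq)"
proof (rule LIMSEQ_I)
  fix e :: real assume e: "e > 0"
  define P where "P d k X = (\<Sum>j<d. (coef (tot k X) j)\<^sup>2)" for d k X
  define R where "R d k = tail_norm2 d (dr k)" for d k
  define GP where "GP d v = (\<Sum>j<d. (sig j * v j + h j)\<^sup>2)" for d and v :: "nat \<Rightarrow> real"
  define \<Lambda> where "\<Lambda> = (\<integral>v. exp (- s * (gauss_norm2 h v + excess)) \<partial>gauss_seq)"
  define \<Lambda>d where "\<Lambda>d d = exp (- s * (b - (\<Sum>j<d. (h j)\<^sup>2))) * (\<integral>v. exp (- s * GP d v) \<partial>gauss_seq)" for d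
  have R_eq: "R d k = real (m k) * T2 (D k) - (\<Sum>j<d. (sqrt (real (m k)) * coef (D k) j)\<^sup>2)" for d k
    using T2_cmult[OF bmeas_D, of "sqrt (real (m k))" k]
    by (simp add: R_def tail_norm2_def T2_eq_ip[OF bmeas_dr] coef_cmult)
  have R0: "0 \<le> R d k" for d k unfolding R_def by (rule tail_norm2_nonneg[OF bmeas_dr])
  have R_le: "R d k \<le> real (m k) * T2 (D k)" for d k unfolding R_eq by (simp add: sum_nonneg)
  have R_lim: "(\<lambda>k. R d k) \<longlonglongrightarrow> b - (\<Sum>j<d. (h j)\<^sup>2)" for d
    unfolding R_eq by (intro tendsto_intros dist_lim coef_lim)
  have P0: "0 \<le> P d k X" for d k X unfolding P_def by (intro sum_nonneg) auto
  have P_meas: "P d k \<in> borel_measurable (sm k)" for d k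
    unfolding P_def[abs_def] by (intro borel_measurable_sum borel_measurable_power measurable_coef)
  have prob_sm: "prob_space (sm k)" for k by (rule law01.prob_space_iid[OF law])
  \<comment> \<open>For fixed \<open>d\<close>, replace the contribution of the coefficients from \<open>d\<close> on by the deterministic
    quantity \<open>R d k\<close>; the limit in \<open>k\<close> then only involves \<open>d\<close> coefficients.\<close>
  have fin: "(\<lambda>k. exp (- s * R d k) * (\<integral>X. exp (- s * P d k X) \<partial>sm k)) \<longlonglongrightarrow> \<Lambda>d d" for d
  proof -
    have "(\<lambda>k. \<integral>X. exp (- s * P d k X) \<partial>sm k) \<longlonglongrightarrow> (\<integral>v. exp (- s * GP d v) \<partial>gauss_seq)"
      unfolding P_def GP_def using s
      by (intro laplace_sq_norm_convergence prob_sm prob_space_gauss_seq measurable_coef char_lim) auto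
    then show ?thesis unfolding \<Lambda>d_def by (intro tendsto_intros R_lim)
  qed
  \<comment> \<open>The cost of this replacement is controlled by the mean tail of the noise. The parameter \<open>l\<close>
    balances it against the cross term with the drift, whose tail need not be small.\<close>
  have tail: "\<bar>(\<integral>X. exp (- s * stat k X) \<partial>sm k) - exp (- s * R d k) * (\<integral>X. exp (- s * P d k X) \<partial>sm k)\<bar> \<le>
      s * ((1 + 1 / l) * tail_mean (L k) d + l * R d k)" if l: "l > 0" for d k l
  proof -
    interpret law01 "L k" by (rule law)
    interpret S: prob_space "sm k" by (rule prob_sm)
    note tl = expectation_tail_noise[OF m_pos[of k], of d]
    have pt: "\<bar>exp (- s * stat k X) - exp (- s * (P d k X + R d k))\<bar> \<le> s * ((1 + 1 / l) * tail_norm2 d (nz k X) + l * R d k)" for X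
    proof -
      have bb: "bmeas (tot k X)" by (intro bmeas_add bmeas_nz bmeas_dr)
      have st: "stat k X = P d k X + tail_norm2 d (tot k X)"
        unfolding stat_eq T2_eq_ip[OF bb] by (simp add: P_def tail_norm2_def)
      have "\<bar>exp (- (s * stat k X)) - exp (- (s * (P d k X + R d k)))\<bar> \<le> \<bar>s * stat k X - s * (P d k X + R d k)\<bar>"
        using s P0 R0 by (intro exp_minus_lipschitz mult_nonneg_nonneg) (auto simp: T2_nonneg)
      also have "\<dots> = s * \<bar>tail_norm2 d (tot k X) - tail_norm2 d (dr k)\<bar>"
        unfolding st R_def using s by (simp add: right_diff_distrib[symmetric] abs_mult)
      also have "\<dots> \<le> s * ((1 + 1 / l) * tail_norm2 d (nz k X) + l * tail_norm2 d (dr k))"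
        using s by (intro mult_left_mono tail_norm2_perturb bmeas_nz bmeas_dr l) auto
      finally show ?thesis by (simp add: R_def)
    qed
    have i1: "integrable (sm k) (\<lambda>X. exp (- s * stat k X))"
      using s measurable_stat[of k] by (intro S.integrable_const_bound[of _ 1]) (auto simp: T2_nonneg)
    have i2: "integrable (sm k) (\<lambda>X. exp (- s * (P d k X + R d k)))"
      using s P_meas[of d k] P0 R0 by (intro S.integrable_const_bound[of _ 1]) auto
    have "exp (- s * (P d k X + R d k)) = exp (- s * R d k) * exp (- s * P d k X)" for X
      by (simp add: exp_add[symmetric] algebra_simps)
    then have "exp (- s * R d k) * (\<integral>X. exp (- s * P d k X) \<partial>sm k) = (\<integral>X. exp (- s * (P d k X + R d k)) \<partial>sm k)"
      by (simp only: integral_mult_right_zero)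
    then have "\<bar>(\<integral>X. exp (- s * stat k X) \<partial>sm k) - exp (- s * R d k) * (\<integral>X. exp (- s * P d k X) \<partial>sm k)\<bar> =
       \<bar>\<integral>X. exp (- s * stat k X) - exp (- s * (P d k X + R d k)) \<partial>sm k\<bar>"
      using i1 i2 by simp
    also have "\<dots> \<le> (\<integral>X. \<bar>exp (- s * stat k X) - exp (- s * (P d k X + R d k))\<bar> \<partial>sm k)"
      by (rule integral_abs_bound)
    also have "\<dots> \<le> (\<integral>X. s * ((1 + 1 / l) * tail_norm2 d (nz k X) + l * R d k) \<partial>sm k)"
      using i1 i2 tl(2) pt by (intro integral_mono) auto
    also have "\<dots> = s * ((1 + 1 / l) * tail_mean (L k) d + l * R d k)"
      using tl S.prob_space by simp
    finally show ?thesis .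
  qed
  have \<Lambda>d_lim: "\<Lambda>d \<longlonglongrightarrow> \<Lambda>"
  proof -
    have "(\<lambda>d. \<integral>v. exp (- s * GP d v) \<partial>gauss_seq) \<longlonglongrightarrow> (\<integral>v. exp (- s * gauss_norm2 h v) \<partial>gauss_seq)"
    proof (rule integral_dominated_convergence[where w="\<lambda>_. 1"])
      show "AE v in gauss_seq. (\<lambda>d. exp (- s * GP d v)) \<longlonglongrightarrow> exp (- s * gauss_norm2 h v)"
        using AE_summable_gauss[OF summable_h_sq]
        by eventually_elim (auto simp: GP_def gauss_norm2_def intro!: tendsto_intros summable_LIMSEQ)
      show "AE v in gauss_seq. norm (exp (- s * GP d v)) \<le> 1" for d
        using s by (auto simp: GP_def sum_nonneg)
      show "(\<lambda>v. exp (- s * GP d v)) \<in> borel_measurable gauss_seq" for d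
        unfolding GP_def by measurable
    qed auto
    then have "\<Lambda>d \<longlonglongrightarrow> exp (- s * excess) * (\<integral>v. exp (- s * gauss_norm2 h v) \<partial>gauss_seq)"
      unfolding \<Lambda>d_def[abs_def] by (intro tendsto_intros summable_LIMSEQ summable_h_sq)
    also have "exp (- s * excess) * (\<integral>v. exp (- s * gauss_norm2 h v) \<partial>gauss_seq) = \<Lambda>"
    proof -
      have "exp (- s * (gauss_norm2 h v + excess)) = exp (- s * excess) * exp (- s * gauss_norm2 h v)" for v
        unfolding exp_add[symmetric] by (simp only: distrib_left add.commute)
      then show ?thesis unfolding \<Lambda>_def by (simp only: integral_mult_right_zero)
    qed
    finally show ?thesis .
  qed
  have b0: "0 \<le> b" using sum_h_sq_le[of 0] by simp
  define l where "l = e / (8 * s * (b + 1))"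
  have l: "l > 0" "s * l * (b + 1) = e / 8" using e s b0 by (auto simp: l_def divide_simps)
  have "(\<lambda>d. s * (1 + 1 / l) * (1 / 6 - (\<Sum>j<d. (sig j)\<^sup>2))) \<longlonglongrightarrow> s * (1 + 1 / l) * (1 / 6 - 1 / 6)"
    using sig_sq_sums unfolding sums_def by (intro tendsto_intros)
  then have "\<forall>\<^sub>F d in sequentially. s * (1 + 1 / l) * (1 / 6 - (\<Sum>j<d. (sig j)\<^sup>2)) < e / 8"
    using e by (intro order_tendstoD(2)) auto
  moreover have "\<forall>\<^sub>F d in sequentially. \<bar>\<Lambda>d d - \<Lambda>\<bar> < e / 4"
    using tendstoD[OF \<Lambda>d_lim, of "e/4"] e by (simp add: dist_real_def)
  ultimately have "\<forall>\<^sub>F d in sequentially. s * (1 + 1 / l) * (1 / 6 - (\<Sum>j<d. (sig j)\<^sup>2)) < e / 8 \<and> \<bar>\<Lambda>d d - \<Lambda>\<bar> < e / 4"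
    by eventually_elim simp
  then obtain d where d: "s * (1 + 1 / l) * (1 / 6 - (\<Sum>j<d. (sig j)\<^sup>2)) < e / 8" "\<bar>\<Lambda>d d - \<Lambda>\<bar> < e / 4"
    by (auto simp: eventually_sequentially)
  have "(\<lambda>k. s * (1 + 1 / l) * tail_mean (L k) d) \<longlonglongrightarrow> s * (1 + 1 / l) * (1 / 6 - (\<Sum>j<d. (sig j)\<^sup>2))"
    by (intro tendsto_intros tail_mean_lim)
  then have E1: "\<forall>\<^sub>F k in sequentially. s * (1 + 1 / l) * tail_mean (L k) d < e / 8"
    using d(1) by (rule order_tendstoD)
  have E2: "\<forall>\<^sub>F k in sequentially. real (m k) * T2 (D k) < b + 1"
    using dist_lim by (rule order_tendstoD) simp
  have E3: "\<forall>\<^sub>F k in sequentially. \<bar>exp (- s * R d k) * (\<integral>X. exp (- s * P d k X) \<partial>sm k) - \<Lambda>d d\<bar> < e / 4"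
    using tendstoD[OF fin[of d], of "e/4"] e by (simp add: dist_real_def)
  have "\<forall>\<^sub>F k in sequentially. \<bar>(\<integral>X. exp (- s * stat k X) \<partial>sm k) - \<Lambda>\<bar> < e"
    using E1 E2 E3
  proof eventually_elim
    fix k
    assume k: "s * (1 + 1 / l) * tail_mean (L k) d < e / 8" "real (m k) * T2 (D k) < b + 1"
      "\<bar>exp (- s * R d k) * (\<integral>X. exp (- s * P d k X) \<partial>sm k) - \<Lambda>d d\<bar> < e / 4"
    have "s * l * R d k \<le> s * l * (b + 1)"
      using k(2) R_le[of d k] s l by (intro mult_left_mono) auto
    then have "s * ((1 + 1 / l) * tail_mean (L k) d + l * R d k) \<le> e / 4"
      using k(1) l(2) by (simp only: distrib_left mult.assoc[symmetric])
    with tail[OF l(1), of k d] k(3) d(2) e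
    show "\<bar>(\<integral>X. exp (- s * stat k X) \<partial>sm k) - \<Lambda>\<bar> < e" by linarith
  qed
  then show "\<exists>no. \<forall>k\<ge>no. norm ((\<integral>X. exp (- s * stat k X) \<partial>sm k) - (\<integral>v. exp (- s * (gauss_norm2 h v + excess)) \<partial>gauss_seq)) < e"
    unfolding \<Lambda>_def eventually_sequentially real_norm_def .
qed

lemma excess_nonneg: "0 \<le> excess" using suminf_h_sq_le by simp

end

lemma cdf_gauss_shift: "cdf (distr gauss_seq borel (\<lambda>v. gauss_norm2 h v + r)) t = gauss_cdf h (t - r)"
  unfolding cdf_def gauss_cdf_def
  by (subst measure_distr) (auto intro!: arg_cong[where f="measure gauss_seq"] simp: algebra_simps)

lemma isCont_cdf_gauss:
  assumes "summable (\<lambda>j. (h j)\<^sup>2)"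
  shows "isCont (cdf (distr gauss_seq borel (\<lambda>v. gauss_norm2 h v + r))) t"
proof -
  interpret real_distribution "distr gauss_seq borel (\<lambda>v. gauss_norm2 h v + r)"
    by (rule G.real_distribution_distr) simp
  have S: "{v. gauss_norm2 h v + r = t} \<in> sets gauss_seq"
    using measurable_sets[of "\<lambda>v. gauss_norm2 h v + r" gauss_seq borel "{t}"] by (simp add: vimage_def)
  have "measure gauss_seq {v. gauss_norm2 h v + r = t} = 0"
    using gauss_norm2_no_atom[OF assms, of "t - r"] S by (subst G.prob_eq_0) (auto elim!: eventually_mono)
  then have "measure (distr gauss_seq borel (\<lambda>v. gauss_norm2 h v + r)) {t} = 0"
    by (subst measure_distr) (auto simp: vimage_def)
  then show ?thesis by (simp add: isCont_cdf)
qed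

lemma isCont_gauss_cdf:
  assumes "summable (\<lambda>j. (h j)\<^sup>2)"
  shows "isCont (gauss_cdf h) t"
proof -
  have "gauss_cdf h = cdf (distr gauss_seq borel (\<lambda>v. gauss_norm2 h v + 0))"
    by (rule ext) (simp only: cdf_gauss_shift diff_0_right)
  then show ?thesis using isCont_cdf_gauss[OF assms, where r=0 and t=t] by (simp only:)
qed

context law01_seq begin

lemma stat_cdf_lim:
  "(\<lambda>k. measure (sm k) {X \<in> space (sm k). stat k X \<le> t k} - gauss_cdf h (t k - excess)) \<longlonglongrightarrow> 0"
proof -
  let ?M = "\<lambda>k. distr (sm k) borel (stat k)"
  let ?M' = "distr gauss_seq borel (\<lambda>v. gauss_norm2 h v + excess)"
  have rd: "real_distribution (?M k)" for k
    by (intro prob_space.real_distribution_distr law01.prob_space_iid[OF law] measurable_stat)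
  have rd': "real_distribution ?M'" by (rule G.real_distribution_distr) simp
  have "weak_conv_m ?M ?M'"
  proof (rule laplace_convergence_imp_weak_conv[OF rd rd'])
    show "AE x in ?M k. 0 \<le> x" for k
      using measurable_stat[of k] by (subst AE_distr_iff) (auto simp: T2_nonneg)
    have "AE v in gauss_seq. 0 \<le> gauss_norm2 h v + excess"
      using AE_summable_gauss[OF summable_h_sq]
      by eventually_elim (use excess_nonneg in \<open>auto simp: gauss_norm2_def intro!: add_nonneg_nonneg suminf_nonneg\<close>)
    then show "AE x in ?M'. 0 \<le> x" by (subst AE_distr_iff) auto
    show "(\<lambda>k. \<integral>x. exp (- real i * x) \<partial>?M k) \<longlonglongrightarrow> (\<integral>x. exp (- real i * x) \<partial>?M')" if "i > 0" for i
      using laplace_lim[of "real i"] that measurable_stat by (simp add: integral_distr)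
  qed
  from weak_conv_continuous_cdf_uniform[OF rd rd' this isCont_cdf_gauss[OF summable_h_sq], of t]
  have "(\<lambda>k. cdf (?M k) (t k) - gauss_cdf h (t k - excess)) \<longlonglongrightarrow> 0" by (simp only: cdf_gauss_shift)
  moreover have "cdf (?M k) (t k) = measure (sm k) {X \<in> space (sm k). stat k X \<le> t k}" for k
    unfolding cdf_def using measurable_stat[of k]
    by (subst measure_distr) (auto intro!: arg_cong[where f="measure (sm k)"])
  ultimately show ?thesis by simp
qed

end

section \<open>Error probabilities of Cramer-von Mises tests\<close>

lemma law01_interval_measure:
  assumes "F \<in> dist_funs01" shows "law01 (interval_measure F)"
  using interval_measure_dist_funs01[OF assms] by (intro law01.intro law01_axioms.intro)

lemma sample_law_eq_iid: "sample_law n F = iid (interval_measure F) n"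
  by (simp add: sample_law_def iid_def)

text \<open>The scaled statistic, which has a limit law.\<close>

definition cvm :: "nat \<Rightarrow> (nat \<Rightarrow> real) \<Rightarrow> real" where
  "cvm n X = real n * T2 (\<lambda>x. emp_cdf n X x - F0 x)"

definition cvm_cdf :: "nat \<Rightarrow> (real \<Rightarrow> real) \<Rightarrow> real \<Rightarrow> real" where
  "cvm_cdf n F t = measure (sample_law n F) {X \<in> space (sample_law n F). cvm n X \<le> t}"

abbreviation "dist2 F \<equiv> T2 (\<lambda>x. F x - F0 x)"

lemma prob_space_sample_law: "F \<in> dist_funs01 \<Longrightarrow> prob_space (sample_law n F)"
  unfolding sample_law_eq_iid by (rule law01.prob_space_iid[OF law01_interval_measure])

lemma measurable_cvm: "F \<in> dist_funs01 \<Longrightarrow> cvm n \<in> borel_measurable (sample_law n F)"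
  unfolding sample_law_eq_iid cvm_def[abs_def]
  by (intro borel_measurable_times borel_measurable_const law01.measurable_T2_emp[OF law01_interval_measure] F0_measurable)

lemma cvm_cdf_mono:
  assumes "F \<in> dist_funs01" "s \<le> t"
  shows "cvm_cdf n F s \<le> cvm_cdf n F t"
proof -
  interpret prob_space "sample_law n F" by (rule prob_space_sample_law[OF assms(1)])
  note [measurable] = measurable_cvm[OF assms(1), of n]
  show ?thesis unfolding cvm_cdf_def using assms(2) by (intro finite_measure_mono) auto
qed

lemma type_errors:
  assumes K: "K = (\<lambda>X. T2 (\<lambda>x. emp_cdf n X x - F0 x) > c)" and n: "n > 0" and F: "F \<in> dist_funs01"
  shows "type1_error n K = 1 - cvm_cdf n F0 (real n * c)" "type2_error n F K = cvm_cdf n F (real n * c)"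
proof -
  have eq: "\<not> K X \<longleftrightarrow> cvm n X \<le> real n * c" for X
    unfolding K cvm_def using n by auto
  show "type2_error n F K = cvm_cdf n F (real n * c)"
    unfolding type2_error_def cvm_cdf_def eq ..
  interpret prob_space "sample_law n F0" by (rule prob_space_sample_law[OF F0_in_dist_funs01])
  note [measurable] = measurable_cvm[OF F0_in_dist_funs01, of n]
  have "type1_error n K = prob (space (sample_law n F0) - {X \<in> space (sample_law n F0). cvm n X \<le> real n * c})"
    unfolding type1_error_def by (intro arg_cong[where f=prob]) (use eq in auto)
  then show "type1_error n K = 1 - cvm_cdf n F0 (real n * c)"
    unfolding cvm_cdf_def by (subst (asm) prob_compl) auto
qed

lemma bmeas_dist_fun: "F \<in> dist_funs01 \<Longrightarrow> bmeas F"
  using law01.bmeas_F[OF law01_interval_measure, of F] interval_measure_dist_funs01(2)[of F] by simp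

lemma bmeas_emp: "n > 0 \<Longrightarrow> bmeas (emp_cdf n X)"
  using bmeas_add[OF bmeas_emp_deviation bmeas_F0, of n X] by simp

abbreviation "noise2 F n X \<equiv> real n * T2 (\<lambda>x. emp_cdf n X x - F x)"

text \<open>Markov's inequality for the squared noise, whose mean is bounded uniformly over all laws.\<close>

lemma noise_tail_bound:
  assumes F: "F \<in> dist_funs01" and n: "n > 0" and \<delta>: "\<delta> > 0"
    and P: "\<And>X. P X \<Longrightarrow> \<delta> \<le> noise2 F n X"
  shows "measure (sample_law n F) {X \<in> space (sample_law n F). P X} \<le> 1 / (4 * \<delta>)"
proof -
  interpret law01 "interval_measure F" by (rule law01_interval_measure[OF F])
  have cF: "cdf (interval_measure F) = F" by (rule interval_measure_dist_funs01[OF F])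
  interpret S: prob_space "sample_law n F" by (rule prob_space_sample_law[OF F])
  note E = expectation_T2_noise[OF n] expectation_T2_noise_le[OF n]
  have eq: "T2 (\<lambda>x. sqrt (real n) * (emp_cdf n X x - F x)) = noise2 F n X" for X
    using T2_cmult[OF bmeas_diff[OF bmeas_emp[OF n] bmeas_dist_fun[OF F]]] by simp
  have [measurable]: "(\<lambda>X. T2 (\<lambda>x. emp_cdf n X x - F x)) \<in> borel_measurable (sample_law n F)"
    unfolding sample_law_eq_iid by (rule measurable_T2_emp[OF bmeasD[OF bmeas_dist_fun[OF F]]])
  have "S.prob {X \<in> space (sample_law n F). P X} \<le>
      S.prob {X \<in> space (sample_law n F). \<delta> \<le> noise2 F n X}"
    using P by (intro S.finite_measure_mono) auto
  also have "\<dots> \<le> (\<integral>X. noise2 F n X \<partial>sample_law n F) / \<delta>"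
    using E(2) \<delta> unfolding cF eq sample_law_eq_iid
    by (intro integral_Markov_inequality_measure[where A="space (iid (interval_measure F) n)"]) (auto simp: T2_nonneg)
  also have "\<dots> \<le> (1 / 4) / \<delta>"
    using E(3) \<delta> unfolding cF eq sample_law_eq_iid by (intro divide_right_mono) auto
  finally show ?thesis by simp
qed

lemma T2_triangle:
  assumes "bmeas f" "bmeas g"
  shows "T2 (\<lambda>x. f x + g x) \<le> 2 * T2 f + 2 * T2 g"
proof -
  have "T2 (\<lambda>x. f x + g x) = (\<integral>x. (f x + g x)\<^sup>2 \<partial>U01)"
    using T2_eq_ip[OF bmeas_add[OF assms]] by (simp add: ip_def power2_eq_square)
  also have "\<dots> \<le> (\<integral>x. 2 * (f x * f x) + 2 * (g x * g x) \<partial>U01)"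
  proof (rule integral_mono)
    fix x
    show "(f x + g x)\<^sup>2 \<le> 2 * (f x * f x) + 2 * (g x * g x)"
      using zero_le_power2[of "f x - g x"] by (simp add: power2_eq_square algebra_simps)
  qed (intro bmeas_integrable_U01 bmeas_intros assms)+
  also have "\<dots> = 2 * T2 f + 2 * T2 g"
    using bmeas_integrable_U01[OF bmeas_mult[OF assms(1) assms(1)]] bmeas_integrable_U01[OF bmeas_mult[OF assms(2) assms(2)]]
    by (simp add: T2_eq_ip assms ip_def)
  finally show ?thesis .
qed

text \<open>The statistic cannot be small unless the empirical distribution function is far from \<open>F\<close>. The factors
  \<open>2\<close> come from \<open>(a + b)\<^sup>2 \<le> 2 a\<^sup>2 + 2 b\<^sup>2\<close>.\<close>

lemma cvm_cdf_far:
  assumes F: "F \<in> dist_funs01" and n: "n > 0" and t: "2 * t < real n * dist2 F"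
  shows "cvm_cdf n F t \<le> 1 / (2 * (real n * dist2 F - 2 * t))"
proof -
  define \<delta> where "\<delta> = real n * dist2 F / 2 - t"
  have "cvm_cdf n F t \<le> 1 / (4 * \<delta>)"
    unfolding cvm_cdf_def
  proof (rule noise_tail_bound[OF F n])
    show "\<delta> > 0" using t by (simp add: \<delta>_def)
    fix X assume X: "cvm n X \<le> t"
    have b: "bmeas (\<lambda>x. emp_cdf n X x - F0 x)" "bmeas (\<lambda>x. (-1) * (emp_cdf n X x - F x))"
      by (intro bmeas_diff bmeas_cmult bmeas_emp n bmeas_F0 bmeas_dist_fun F)+
    have "dist2 F \<le> 2 * T2 (\<lambda>x. emp_cdf n X x - F0 x) + 2 * T2 (\<lambda>x. (-1) * (emp_cdf n X x - F x))"
      using T2_triangle[OF b] by simp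
    also have "T2 (\<lambda>x. (-1) * (emp_cdf n X x - F x)) = T2 (\<lambda>x. emp_cdf n X x - F x)"
      using T2_cmult[OF bmeas_diff[OF bmeas_emp[OF n] bmeas_dist_fun[OF F]], of "-1" X] by simp
    finally have "real n * dist2 F \<le> real n * (2 * T2 (\<lambda>x. emp_cdf n X x - F0 x) + 2 * T2 (\<lambda>x. emp_cdf n X x - F x))"
      by (intro mult_left_mono) auto
    also have "\<dots> = 2 * cvm n X + 2 * (noise2 F n X)"
      by (simp add: cvm_def algebra_simps)
    finally show "\<delta> \<le> noise2 F n X"
      using X by (simp add: \<delta>_def)
  qed
  also have "4 * \<delta> = 2 * (real n * dist2 F - 2 * t)" by (simp add: \<delta>_def)
  finally show ?thesis .
qed

lemma cvm_cdf_near: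
  assumes F: "F \<in> dist_funs01" and n: "n > 0" and t: "2 * (real n * dist2 F) < t"
  shows "1 - 1 / (2 * (t - 2 * (real n * dist2 F))) \<le> cvm_cdf n F t"
proof -
  interpret prob_space "sample_law n F" by (rule prob_space_sample_law[OF F])
  note [measurable] = measurable_cvm[OF F, of n]
  define \<delta> where "\<delta> = t / 2 - real n * dist2 F"
  have "1 - cvm_cdf n F t = prob (space (sample_law n F) - {X \<in> space (sample_law n F). cvm n X \<le> t})"
    unfolding cvm_cdf_def by (subst prob_compl) auto
  also have "space (sample_law n F) - {X \<in> space (sample_law n F). cvm n X \<le> t} = {X \<in> space (sample_law n F). t < cvm n X}"
    by auto
  also have "prob \<dots> \<le> 1 / (4 * \<delta>)"
  proof (rule noise_tail_bound[OF F n])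
    show "\<delta> > 0" using t by (simp add: \<delta>_def)
    fix X assume X: "t < cvm n X"
    have b: "bmeas (\<lambda>x. emp_cdf n X x - F x)" "bmeas (\<lambda>x. F x - F0 x)"
      by (intro bmeas_diff bmeas_emp n bmeas_F0 bmeas_dist_fun F)+
    have "cvm n X \<le> real n * (2 * T2 (\<lambda>x. emp_cdf n X x - F x) + 2 * dist2 F)"
      unfolding cvm_def using T2_triangle[OF b] by (intro mult_left_mono) auto
    also have "\<dots> = 2 * (noise2 F n X) + 2 * (real n * dist2 F)"
      by (simp add: algebra_simps)
    finally show "\<delta> \<le> noise2 F n X"
      using X by (simp add: \<delta>_def)
  qed
  also have "4 * \<delta> = 2 * (t - 2 * (real n * dist2 F))" by (simp add: \<delta>_def)
  finally show ?thesis by simp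
qed

text \<open>The thresholds \<open>t k\<close> may vary, because the limit law is continuous.\<close>

lemma cvm_cdf_lim:
  assumes F: "\<And>k. F k \<in> dist_funs01" and m: "\<And>k. m k > 0" "filterlim m at_top sequentially"
    and c: "\<And>j. (\<lambda>k. sqrt (real (m k)) * coef (\<lambda>x. F k x - F0 x) j) \<longlonglongrightarrow> h j"
    and b: "(\<lambda>k. real (m k) * dist2 (F k)) \<longlonglongrightarrow> b"
  shows "(\<lambda>k. cvm_cdf (m k) (F k) (t k) - gauss_cdf h (t k - (b - (\<Sum>j. (h j)\<^sup>2)))) \<longlonglongrightarrow> 0"
    and "summable (\<lambda>j. (h j)\<^sup>2)" "(\<Sum>j. (h j)\<^sup>2) \<le> b"
proof -
  have cF: "cdf (interval_measure (F k)) = F k" for k by (rule interval_measure_dist_funs01[OF F])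
  interpret law01_seq "\<lambda>k. interval_measure (F k)" m h b
  proof (rule law01_seq.intro)
    show "law01 (interval_measure (F k))" for k by (rule law01_interval_measure[OF F])
  qed (use m c b in \<open>simp_all only: cF\<close>)
  show "(\<lambda>k. cvm_cdf (m k) (F k) (t k) - gauss_cdf h (t k - (b - (\<Sum>j. (h j)\<^sup>2)))) \<longlonglongrightarrow> 0"
    using stat_cdf_lim[of t] by (simp add: cvm_cdf_def cvm_def sample_law_eq_iid)
  show "summable (\<lambda>j. (h j)\<^sup>2)" by (rule summable_h_sq)
  show "(\<Sum>j. (h j)\<^sup>2) \<le> b" by (rule suminf_h_sq_le)
qed

abbreviation "G0 \<equiv> gauss_cdf (\<lambda>_. 0)"

lemma coef_sq_scaled_le:
  assumes "F \<in> dist_funs01"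
  shows "(sqrt (real n) * coef (\<lambda>x. F x - F0 x) j)\<^sup>2 \<le> real n * dist2 F"
  using coef_sq_le[OF bmeas_diff[OF bmeas_dist_fun[OF assms] bmeas_F0], of j]
  by (simp add: power_mult_distrib mult_left_mono)

lemma cvm_cdf_lim_near:
  assumes F: "\<And>k. F k \<in> dist_funs01" and m: "\<And>k. m k > 0" "filterlim m at_top sequentially"
    and b: "(\<lambda>k. real (m k) * dist2 (F k)) \<longlonglongrightarrow> 0"
  shows "(\<lambda>k. cvm_cdf (m k) (F k) (t k) - G0 (t k)) \<longlonglongrightarrow> 0"
proof -
  have "(\<lambda>k. sqrt (real (m k)) * coef (\<lambda>x. F k x - F0 x) j) \<longlonglongrightarrow> 0" for j
  proof -
    have "(\<lambda>k. (sqrt (real (m k)) * coef (\<lambda>x. F k x - F0 x) j)\<^sup>2) \<longlonglongrightarrow> 0"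
      by (rule tendsto_sandwich[OF _ _ tendsto_const b]) (auto intro!: always_eventually coef_sq_scaled_le F)
    from tendsto_real_sqrt[OF this] show ?thesis by (simp only: real_sqrt_abs real_sqrt_zero tendsto_rabs_zero_iff)
  qed
  from cvm_cdf_lim(1)[OF F m this b, of t] show ?thesis by simp
qed

lemma cvm_cdf_lim_null:
  assumes m: "\<And>k. m k > 0" "filterlim m at_top sequentially"
  shows "(\<lambda>k. cvm_cdf (m k) F0 (t k) - G0 (t k)) \<longlonglongrightarrow> 0"
  by (rule cvm_cdf_lim_near[OF F0_in_dist_funs01 m]) (simp add: T2_def)

lemma G0_properties:
  shows "isCont G0 t" "s \<le> t \<Longrightarrow> G0 s \<le> G0 t" "G0 t < 1" "t > 0 \<Longrightarrow> 0 < G0 t" "t \<le> 0 \<Longrightarrow> G0 t = 0"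
    "(G0 \<longlongrightarrow> 1) at_top"
proof -
  interpret R: real_distribution "distr gauss_seq borel (\<lambda>v. gauss_norm2 (\<lambda>_. 0) v + 0)"
    by (rule G.real_distribution_distr) simp
  have eq: "cdf (distr gauss_seq borel (\<lambda>v. gauss_norm2 (\<lambda>_. 0) v + 0)) = G0"
    by (rule ext) (simp only: cdf_gauss_shift diff_0_right)
  show "isCont G0 t" by (rule isCont_gauss_cdf) simp
  have mono: "G0 u \<le> G0 v" if "u \<le> v" for u v
    using R.cdf_nondecreasing[OF that] unfolding eq .
  show "s \<le> t \<Longrightarrow> G0 s \<le> G0 t" by (rule mono)
  show "(G0 \<longlongrightarrow> 1) at_top" using R.cdf_lim_at_top_prob unfolding eq .
  have nonneg: "0 \<le> G0 u" for u unfolding gauss_cdf_def by (rule measure_nonneg)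
  have less: "G0 (u - 1) < G0 u" if "u > 0" for u
    by (rule prob_gauss_norm2_shift_less) (use that in auto)
  have "G0 t \<le> G0 ((max t 0 + 1) - 1)" by (rule mono) simp
  also have "\<dots> < G0 (max t 0 + 1)" by (rule less) simp
  also have "\<dots> \<le> 1" unfolding gauss_cdf_def by (rule G.prob_le_1)
  finally show "G0 t < 1" .
  show "t > 0 \<Longrightarrow> 0 < G0 t" using less[of t] nonneg[of "t - 1"] by linarith
  have s0: "summable (\<lambda>j::nat. (0::real)\<^sup>2)" by simp
  have "AE v in gauss_seq. v \<notin> {v. gauss_norm2 (\<lambda>_. 0) v \<le> 0}"
    using AE_summable_gauss[OF s0] gauss_norm2_no_atom[OF s0, of 0]
  proof eventually_elim
    fix v assume 1: "summable (\<lambda>j. (sig j * v j + 0)\<^sup>2)" and 2: "gauss_norm2 (\<lambda>_. 0) v \<noteq> 0"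
    have "0 \<le> gauss_norm2 (\<lambda>_. 0) v" unfolding gauss_norm2_def by (rule suminf_nonneg[OF 1]) simp
    with 2 show "v \<notin> {v. gauss_norm2 (\<lambda>_. 0) v \<le> 0}" by simp
  qed
  moreover have "{v. gauss_norm2 (\<lambda>_. 0) v \<le> 0} \<in> sets gauss_seq"
    using measurable_sets[OF measurable_gauss_norm2', of "{..0}" "\<lambda>_. 0"] by (simp add: vimage_def)
  ultimately have "G0 0 = 0" unfolding gauss_cdf_def by (subst G.prob_eq_0)
  then show "t \<le> 0 \<Longrightarrow> G0 t = 0" using mono[of t 0] nonneg[of t] by simp
qed

lemma bounded_coordinates_convergent_subseq:
  fixes X :: "nat \<Rightarrow> nat \<Rightarrow> real"
  assumes "\<And>j. bounded (range (\<lambda>k. X k j))"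
  obtains r where "strict_mono r" "\<And>j. convergent (\<lambda>k. X (r k) j)"
proof -
  interpret subseqs "\<lambda>j s. convergent (\<lambda>k. X (s k) j)"
  proof
    fix j and s :: "nat \<Rightarrow> nat"
    have "bounded (range (\<lambda>k. X (s k) j))"
      by (rule bounded_subset[OF assms[of j]]) auto
    from bounded_imp_convergent_subsequence[OF this]
    obtain l r where "strict_mono r" "((\<lambda>k. X (s k) j) \<circ> r) \<longlonglongrightarrow> l" by blast
    then show "\<exists>r'. strict_mono r' \<and> convergent (\<lambda>k. X ((s \<circ> r') k) j)"
      by (auto simp: convergent_def o_def)
  qed
  have "convergent (\<lambda>k. X (diagseq k) j)" for j
  proof -
    have "convergent (\<lambda>k. X ((diagseq \<circ> (+) (Suc j)) k) j)"
    proof (rule diagseq_holds)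
      fix r s :: "nat \<Rightarrow> nat" and n
      assume r: "strict_mono r" and "convergent (\<lambda>k. X (s k) n)"
      then obtain l where "(\<lambda>k. X (s k) n) \<longlonglongrightarrow> l" by (auto simp: convergent_def)
      from LIMSEQ_subseq_LIMSEQ[OF this r] show "convergent (\<lambda>k. X ((s \<circ> r) k) n)"
        by (auto simp: convergent_def o_def)
    qed
    then have "convergent (\<lambda>k. X (diagseq (k + Suc j)) j)" by (simp add: add.commute)
    then show ?thesis using convergent_ignore_initial_segment[of "\<lambda>k. X (diagseq k) j" "Suc j"] by simp
  qed
  then show thesis using that subseq_diagseq by blast
qed

text \<open>Compactness and Anderson's inequality combined. Either the scaled distances are frequently large, and
  then the statistic is large with high probability, or on a subsequence all data converge and the
  limiting acceptance probability is strictly smaller than its value \<open>\<gamma>\<close> under \<open>F0\<close>. Detection is claimed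
  for infinitely many indices only; this is what a proof by contradiction along sequences needs.\<close>

lemma alternatives_frequently_detected:
  fixes F :: "nat \<Rightarrow> real \<Rightarrow> real" and m :: "nat \<Rightarrow> nat" and t :: "nat \<Rightarrow> real"
  assumes F: "\<And>k. F k \<in> dist_funs01" and m: "\<And>k. m k > 0" "filterlim m at_top sequentially"
    and a: "a > 0" "\<And>k. a \<le> real (m k) * dist2 (F k)"
    and \<gamma>: "0 < \<gamma>" "\<gamma> < 1" and null: "(\<lambda>k. cvm_cdf (m k) F0 (t k)) \<longlonglongrightarrow> \<gamma>"
  shows "\<exists>\<beta><\<gamma>. \<exists>\<^sub>F k in sequentially. cvm_cdf (m k) (F k) (t k) \<le> \<beta>"
proof -
  have Gt: "(\<lambda>k. G0 (t k)) \<longlonglongrightarrow> \<gamma>"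
    using tendsto_diff[OF null cvm_cdf_lim_null[OF m, of t]] by simp
  have "\<forall>\<^sub>F s in at_top. \<gamma> < G0 s" using G0_properties(6) \<gamma>(2) by (rule order_tendstoD)
  then obtain \<tau> where \<tau>: "\<gamma> < G0 \<tau>" by (auto simp: eventually_at_top_linorder)
  have "\<forall>\<^sub>F k in sequentially. G0 (t k) < G0 \<tau>" "\<forall>\<^sub>F k in sequentially. 0 < G0 (t k)"
    using Gt \<tau> \<gamma> by (auto intro: order_tendstoD)
  then have t_bd: "\<forall>\<^sub>F k in sequentially. 0 < t k \<and> t k < \<tau>"
  proof eventually_elim
    fix k assume "G0 (t k) < G0 \<tau>" "0 < G0 (t k)"
    then show "0 < t k \<and> t k < \<tau>" using G0_properties(2)[of \<tau> "t k"] G0_properties(5)[of "t k"] by force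
  qed
  define w where "w = 1 / \<gamma>"
  have w: "w > 0" "1 / (2 * w) = \<gamma> / 2" using \<gamma> by (auto simp: w_def)
  \<comment> \<open>Chosen so that the bound of \<open>cvm_cdf_far\<close> gives \<open>\<gamma> / 2\<close> once the scaled distance exceeds \<open>B\<close>.\<close>
  define B where "B = 2 * \<tau> + w"
  show ?thesis
  proof (cases "\<exists>\<^sub>F k in sequentially. B \<le> real (m k) * dist2 (F k)")
    case True
    have "\<exists>\<^sub>F k in sequentially. cvm_cdf (m k) (F k) (t k) \<le> \<gamma> / 2"
      using frequently_eventually_conj[OF True t_bd]
    proof (rule frequently_elim1)
      fix k assume k: "(0 < t k \<and> t k < \<tau>) \<and> B \<le> real (m k) * dist2 (F k)"
      have *: "w \<le> real (m k) * dist2 (F k) - 2 * t k" using k by (simp add: B_def)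
      then have "cvm_cdf (m k) (F k) (t k) \<le> 1 / (2 * (real (m k) * dist2 (F k) - 2 * t k))"
        using w(1) by (intro cvm_cdf_far F m) linarith
      also have "\<dots> \<le> 1 / (2 * w)"
        using * w(1) by (intro divide_left_mono mult_pos_pos) auto
      finally show "cvm_cdf (m k) (F k) (t k) \<le> \<gamma> / 2" by (simp only: w(2))
    qed
    then show ?thesis using \<gamma> by (intro exI[of _ "\<gamma> / 2"]) auto
  next
    case False
    then have "\<forall>\<^sub>F k in sequentially. real (m k) * dist2 (F k) < B"
      by (simp add: not_frequently not_le)
    with t_bd have "\<forall>\<^sub>F k in sequentially. (0 < t k \<and> t k < \<tau>) \<and> real (m k) * dist2 (F k) < B"
      by eventually_elim simp
    then obtain K where K: "\<And>k. k \<ge> K \<Longrightarrow> 0 < t k \<and> t k < \<tau> \<and> real (m k) * dist2 (F k) < B"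
      by (auto simp: eventually_sequentially)
    define co where "co k j = sqrt (real (m k)) * coef (\<lambda>x. F k x - F0 x) j" for k j
    \<comment> \<open>Threshold, scaled distance and all sine coefficients in one array of bounded coordinates.\<close>
    define X where "X k j = (case j of 0 \<Rightarrow> t (k + K) | Suc 0 \<Rightarrow> real (m (k + K)) * dist2 (F (k + K)) | Suc (Suc i) \<Rightarrow> co (k + K) i)" for k j
    have X_simps: "X k 0 = t (k + K)" "X k 1 = real (m (k + K)) * dist2 (F (k + K))" "X k (i + 2) = co (k + K) i" for k i
      by (simp_all add: X_def)
    have co_bd: "\<bar>co k j\<bar> \<le> sqrt B" if "k \<ge> K" for k j
    proof (rule real_le_rsqrt)
      have "(co k j)\<^sup>2 \<le> real (m k) * dist2 (F k)" unfolding co_def by (rule coef_sq_scaled_le[OF F])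
      also have "\<dots> \<le> B" using K[OF that] by simp
      finally show "\<bar>co k j\<bar>\<^sup>2 \<le> B" by simp
    qed
    have "bounded (range (\<lambda>k. X k j))" for j
    proof -
      consider "j = 0" | "j = 1" | i where "j = i + 2"
        by (metis One_nat_def add_2_eq_Suc' not0_implies_Suc)
      then show ?thesis
      proof cases
        case 1
        have "\<bar>t (k + K)\<bar> \<le> \<tau>" for k using K[of "k + K"] by auto
        then show ?thesis unfolding 1 X_simps by (intro boundedI[where B=\<tau>]) auto
      next
        case 2
        have "\<bar>real (m (k + K)) * dist2 (F (k + K))\<bar> \<le> B" for k using K[of "k + K"] a(2)[of "k + K"] a(1) by auto
        then show ?thesis unfolding 2 X_simps by (intro boundedI[where B=B]) auto
      next
        case 3
        show ?thesis unfolding 3 X_simps by (intro boundedI[where B="sqrt B"]) (auto intro: co_bd)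
      qed
    qed
    then obtain r where r: "strict_mono r" and conv: "\<And>j. convergent (\<lambda>k. X (r k) j)"
      using bounded_coordinates_convergent_subseq[of X] by metis
    define s where "s k = r k + K" for k
    have s: "strict_mono s" using r by (auto simp: s_def strict_mono_def)
    have s_lim: "filterlim s at_top sequentially" by (rule filterlim_subseq[OF s])
    obtain u where u: "(\<lambda>k. t (s k)) \<longlonglongrightarrow> u"
      using conv[of 0] by (auto simp: X_simps s_def convergent_def)
    obtain b where b: "(\<lambda>k. real (m (s k)) * dist2 (F (s k))) \<longlonglongrightarrow> b"
      using conv[of 1] unfolding X_simps s_def convergent_def by blast
    have "\<exists>h. (\<lambda>k. co (s k) j) \<longlonglongrightarrow> h" for j
      using conv[of "j + 2"] unfolding X_simps s_def convergent_def .
    then obtain h where h: "\<And>j. (\<lambda>k. co (s k) j) \<longlonglongrightarrow> h j" by metis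
    have "filterlim (\<lambda>k. m (s k)) at_top sequentially"
      by (rule filterlim_compose[OF m(2) s_lim])
    note W = cvm_cdf_lim[OF F m(1) this h[unfolded co_def] b]
    define \<rho> where "\<rho> = b - (\<Sum>j. (h j)\<^sup>2)"
    have \<rho>: "\<rho> \<ge> 0" using W(3) by (simp add: \<rho>_def)
    have "a \<le> b" using a(2) by (intro LIMSEQ_le_const[OF b]) auto
    have "(\<lambda>k. G0 (t (s k))) \<longlonglongrightarrow> G0 u" by (rule isCont_tendsto_compose[OF G0_properties(1) u])
    moreover have "(\<lambda>k. G0 (t (s k))) \<longlonglongrightarrow> \<gamma>" by (rule filterlim_compose[OF Gt s_lim])
    ultimately have Gu: "G0 u = \<gamma>" by (rule LIMSEQ_unique)
    then have "u > 0" using G0_properties(5)[of u] \<gamma> by (cases "u \<le> 0") auto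
    have "h \<noteq> (\<lambda>_. 0) \<or> \<rho> > 0"
      using \<open>a \<le> b\<close> a(1) \<rho> by (auto simp: \<rho>_def)
    from prob_gauss_norm2_shift_less[OF W(2) \<open>u > 0\<close> \<rho> this]
    have less: "gauss_cdf h (u - \<rho>) < \<gamma>" unfolding Gu[symmetric] .
    have "(\<lambda>k. gauss_cdf h (t (s k) - \<rho>)) \<longlonglongrightarrow> gauss_cdf h (u - \<rho>)"
      by (intro isCont_tendsto_compose[OF isCont_gauss_cdf[OF W(2)]] tendsto_intros u)
    from tendsto_add[OF W(1)[of "\<lambda>k. t (s k)", folded \<rho>_def] this]
    have lim: "(\<lambda>k. cvm_cdf (m (s k)) (F (s k)) (t (s k))) \<longlonglongrightarrow> gauss_cdf h (u - \<rho>)" by simp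
    define \<beta> where "\<beta> = (gauss_cdf h (u - \<rho>) + \<gamma>) / 2"
    have \<beta>: "gauss_cdf h (u - \<rho>) < \<beta>" "\<beta> < \<gamma>" using less by (auto simp: \<beta>_def)
    have "\<forall>\<^sub>F k in sequentially. cvm_cdf (m (s k)) (F (s k)) (t (s k)) < \<beta>"
      using lim \<beta>(1) by (rule order_tendstoD)
    then have "\<exists>\<^sub>F k in sequentially. cvm_cdf (m (s k)) (F (s k)) (t (s k)) \<le> \<beta>"
      by (intro eventually_frequently) (auto elim: eventually_mono)
    then have "\<exists>\<^sub>F k in sequentially. cvm_cdf (m k) (F k) (t k) \<le> \<beta>"
      unfolding frequently_def using eventually_compose_filterlim[OF _ s_lim, of "\<lambda>k. \<not> cvm_cdf (m k) (F k) (t k) \<le> \<beta>"] by auto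
    then show ?thesis using \<beta>(2) by blast
  qed
qed

lemma cvm_tests_thresholds:
  assumes "\<forall>n. cvm_test n (K n)"
  obtains c where "\<And>n. n > 0 \<Longrightarrow> type1_error n (K n) = 1 - cvm_cdf n F0 (real n * c n)"
    "\<And>n F. n > 0 \<Longrightarrow> F \<in> dist_funs01 \<Longrightarrow> type2_error n F (K n) = cvm_cdf n F (real n * c n)"
proof -
  obtain c where c: "\<And>n. K n = (\<lambda>X. T2 (\<lambda>x. emp_cdf n X x - F0 x) > c n)"
    using assms unfolding cvm_test_def by metis
  show thesis
  proof (rule that[of c])
    fix n :: nat assume n: "n > 0"
    show "type1_error n (K n) = 1 - cvm_cdf n F0 (real n * c n)"
      by (rule type_errors(1)[OF c n F0_in_dist_funs01])
    fix F assume "F \<in> dist_funs01"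
    then show "type2_error n F (K n) = cvm_cdf n F (real n * c n)"
      by (rule type_errors(2)[OF c n])
  qed
qed

lemma cvm_cdf_lim_near_seq:
  assumes F: "\<And>n. F n \<in> dist_funs01" and b: "(\<lambda>n. real n * dist2 (F n)) \<longlonglongrightarrow> 0"
  shows "(\<lambda>n. cvm_cdf n (F n) (t n) - G0 (t n)) \<longlonglongrightarrow> 0"
proof -
  have "(\<lambda>k. cvm_cdf (Suc k) (F (Suc k)) (t (Suc k)) - G0 (t (Suc k))) \<longlonglongrightarrow> 0"
    using b by (intro cvm_cdf_lim_near F filterlim_Suc) (auto dest: LIMSEQ_Suc)
  then show ?thesis by (rule LIMSEQ_imp_Suc)
qed

lemma cvm_cdf_lim_null_seq: "(\<lambda>n. cvm_cdf n F0 (t n) - G0 (t n)) \<longlonglongrightarrow> 0"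
  by (rule cvm_cdf_lim_near_seq[OF F0_in_dist_funs01]) (simp add: T2_def)

abbreviation "errors F K \<equiv> (\<lambda>n. type1_error n (K n) + type2_error n (F n) (K n))"

text \<open>The threshold is a quarter of the distance of the alternative; both errors are then of order
  \<open>1 / (n T2 (F\<^sub>n - F0))\<close>.\<close>

lemma consistent_if_distance_diverges:
  assumes F: "\<And>n. F n \<in> dist_funs01"
    and inf: "filterlim (\<lambda>n. real n * dist2 (F n)) at_top sequentially"
  shows "\<exists>K. (\<forall>n. cvm_test n (K n)) \<and> errors F K \<longlonglongrightarrow> 0"
proof -
  define c where "c n = dist2 (F n) / 4" for n
  define K where "K n X \<longleftrightarrow> T2 (\<lambda>x. emp_cdf n X x - F0 x) > c n" for n X
  have K: "K n = (\<lambda>X. T2 (\<lambda>x. emp_cdf n X x - F0 x) > c n)" for n by (rule ext) (simp add: K_def)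
  let ?b = "\<lambda>n. real n * dist2 (F n)"
  have "(\<lambda>n. 3 / ?b n) \<longlonglongrightarrow> 0"
    by (intro tendsto_divide_0[OF tendsto_const] filterlim_at_top_imp_at_infinity inf)
  moreover have "\<forall>\<^sub>F n in sequentially. norm (errors F K n) \<le> 3 / ?b n"
    using eventually_gt_at_top[of 0] filterlim_at_top_dense[THEN iffD1, OF inf, rule_format, of 0]
  proof eventually_elim
    fix n :: nat assume n: "0 < n" and b: "0 < ?b n"
    have "type2_error n (F n) (K n) = cvm_cdf n (F n) (?b n / 4)"
      using type_errors(2)[OF K n F] by (simp add: c_def)
    also have "\<dots> \<le> 1 / (2 * (?b n - 2 * (?b n / 4)))" using b by (intro cvm_cdf_far F n) simp
    finally have 2: "type2_error n (F n) (K n) \<le> 1 / ?b n" by (simp add: field_simps)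
    have z: "real n * dist2 F0 = 0" by (simp add: T2_def)
    have "1 - 1 / (2 * (?b n / 4)) \<le> cvm_cdf n F0 (?b n / 4)"
      using cvm_cdf_near[OF F0_in_dist_funs01 n, of "?b n / 4"] b unfolding z by simp
    then have 1: "type1_error n (K n) \<le> 2 / ?b n"
      using type_errors(1)[OF K n F0_in_dist_funs01] by (simp add: c_def field_simps)
    have "0 \<le> type1_error n (K n)" "0 \<le> type2_error n (F n) (K n)"
      by (auto simp: type1_error_def type2_error_def)
    then show "norm (errors F K n) \<le> 3 / ?b n"
      using 1 2 by (simp add: add_divide_distrib[symmetric])
  qed
  ultimately have "errors F K \<longlonglongrightarrow> 0"
    by (rule Lim_null_comparison[rotated])
  moreover have "cvm_test n (K n)" for n unfolding cvm_test_def using K by blast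
  ultimately show ?thesis by blast
qed

text \<open>The null limit law gives positive mass to every half line, so a vanishing type I error drives the
  scaled threshold above any constant \<open>M\<close>. An alternative at bounded scaled distance stays below \<open>M\<close> with
  probability at least \<open>1/2\<close>.\<close>

lemma distance_diverges_if_consistent:
  assumes F: "\<And>n. F n \<in> dist_funs01" and K: "\<forall>n. cvm_test n (K n)"
    and lim: "errors F K \<longlonglongrightarrow> 0"
  shows "filterlim (\<lambda>n. real n * dist2 (F n)) at_top sequentially"
proof (rule ccontr)
  let ?b = "\<lambda>n. real n * dist2 (F n)"
  assume "\<not> filterlim ?b at_top sequentially"
  then obtain C where C: "\<exists>\<^sub>F n in sequentially. ?b n < C"
    unfolding filterlim_at_top not_all not_eventually by (auto simp: not_le)
  obtain c where c: "\<And>n. n > 0 \<Longrightarrow> type1_error n (K n) = 1 - cvm_cdf n F0 (real n * c n)"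
    "\<And>n F. n > 0 \<Longrightarrow> F \<in> dist_funs01 \<Longrightarrow> type2_error n F (K n) = cvm_cdf n F (real n * c n)"
    using cvm_tests_thresholds[OF K] by metis
  have nn: "0 \<le> type1_error n (K n)" "0 \<le> type2_error n (F n) (K n)" for n
    by (auto simp: type1_error_def type2_error_def)
  define M where "M = 2 * \<bar>C\<bar> + 1"
  have gap: "0 < (1 - G0 M) / 2" "(0::real) < 1 / 2" using G0_properties(3)[of M] by auto
  have "\<forall>\<^sub>F n in sequentially. errors F K n < (1 - G0 M) / 2"
    "\<forall>\<^sub>F n in sequentially. errors F K n < 1 / 2"
    "\<forall>\<^sub>F n in sequentially. \<bar>cvm_cdf n F0 M - G0 M\<bar> < (1 - G0 M) / 2"
    using order_tendstoD(2)[OF lim gap(1)] order_tendstoD(2)[OF lim gap(2)]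
      tendstoD[OF cvm_cdf_lim_null_seq[of "\<lambda>_. M"] gap(1)] by (simp_all add: dist_real_def)
  with eventually_gt_at_top[of "0::nat"]
  have "\<forall>\<^sub>F n in sequentially. \<not> ?b n < C"
  proof eventually_elim
    fix n :: nat assume n: "0 < n"
      and 1: "errors F K n < (1 - G0 M) / 2"
      and 2: "errors F K n < 1 / 2"
      and 3: "\<bar>cvm_cdf n F0 M - G0 M\<bar> < (1 - G0 M) / 2"
    have "cvm_cdf n F0 M - G0 M < (1 - G0 M) / 2" using 3 by (simp only: abs_less_iff)
    then have "cvm_cdf n F0 M < cvm_cdf n F0 (real n * c n)"
      using 1 nn[of n] c(1)[OF n] by argo
    then have "M \<le> real n * c n"
      using cvm_cdf_mono[OF F0_in_dist_funs01, of "real n * c n" M n] by force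
    then have le: "cvm_cdf n (F n) M \<le> type2_error n (F n) (K n)"
      using cvm_cdf_mono[OF F[of n], of M "real n * c n" n] c(2)[OF n F[of n]] by simp
    show "\<not> ?b n < C"
    proof
      assume b: "?b n < C"
      have "2 * ?b n < M" and g: "1 \<le> M - 2 * ?b n" using b by (auto simp: M_def)
      from cvm_cdf_near[OF F n this(1)]
      have "1 - 1 / (2 * (M - 2 * ?b n)) \<le> cvm_cdf n (F n) M" .
      moreover have "1 / (2 * (M - 2 * ?b n)) \<le> 1 / (2 * 1)"
        using g by (intro divide_left_mono) auto
      ultimately show False using le 2 nn(1)[of n] by simp
    qed
  qed
  with C show False by (simp add: frequently_def)
qed

text \<open>If the bound failed, there would be alternatives at growing sample sizes whose type II errors come
  arbitrarily close to \<open>1 - \<alpha>\<close> or exceed it, against \<open>alternatives_frequently_detected\<close>.\<close>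

lemma asymptotically_unbiased:
  assumes a: "a > 0" and \<alpha>: "0 < \<alpha>" "\<alpha> < 1" and K: "\<forall>n. cvm_test n (K n)"
    and lim: "(\<lambda>n. type1_error n (K n)) \<longlonglongrightarrow> \<alpha>"
  shows "limsup (\<lambda>n. SUP F \<in> Upsilon n a. ereal (type2_error n F (K n))) < ereal (1 - \<alpha>)"
proof (rule ccontr)
  let ?S = "\<lambda>n. SUP F \<in> Upsilon n a. ereal (type2_error n F (K n))"
  assume neg: "\<not> limsup ?S < ereal (1 - \<alpha>)"
  obtain c where c: "\<And>n. n > 0 \<Longrightarrow> type1_error n (K n) = 1 - cvm_cdf n F0 (real n * c n)"
    "\<And>n F. n > 0 \<Longrightarrow> F \<in> dist_funs01 \<Longrightarrow> type2_error n F (K n) = cvm_cdf n F (real n * c n)"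
    using cvm_tests_thresholds[OF K] by metis
  have "\<exists>n F. n > k \<and> F \<in> Upsilon n a \<and> 1 - \<alpha> - 1 / real (Suc k) < type2_error n F (K n)" for k
  proof (rule ccontr)
    assume no: "\<not> ?thesis"
    have "limsup ?S \<le> ereal (1 - \<alpha> - 1 / real (Suc k))"
    proof (rule Limsup_bounded)
      show "\<forall>\<^sub>F n in sequentially. ?S n \<le> ereal (1 - \<alpha> - 1 / real (Suc k))"
        using eventually_gt_at_top[of k]
      proof eventually_elim
        fix n assume "k < n"
        show "?S n \<le> ereal (1 - \<alpha> - 1 / real (Suc k))"
        proof (rule SUP_least)
          fix F assume "F \<in> Upsilon n a"
          then have "\<not> 1 - \<alpha> - 1 / real (Suc k) < type2_error n F (K n)" using no \<open>k < n\<close> by blast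
          then show "ereal (type2_error n F (K n)) \<le> ereal (1 - \<alpha> - 1 / real (Suc k))"
            by (simp only: ereal_less_eq not_less)
        qed
      qed
    qed
    also have "\<dots> < ereal (1 - \<alpha>)" by simp
    finally show False using neg by simp
  qed
  then obtain m F where mF: "\<And>k. m k > k" "\<And>k. F k \<in> Upsilon (m k) a"
    "\<And>k. 1 - \<alpha> - 1 / real (Suc k) < type2_error (m k) (F k) (K (m k))" by metis
  have m0: "m k > 0" for k using mF(1)[of k] by simp
  have m_lim: "filterlim m at_top sequentially"
    by (rule filterlim_at_top_mono[OF filterlim_ident]) (auto intro!: always_eventually less_imp_le mF(1))
  have F: "F k \<in> dist_funs01" and d: "a \<le> real (m k) * dist2 (F k)" for k
    using mF(2)[of k] m0[of k] by (auto simp: Upsilon_def field_simps)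
  have "(\<lambda>k. 1 - type1_error (m k) (K (m k))) \<longlonglongrightarrow> 1 - \<alpha>"
    by (intro tendsto_intros filterlim_compose[OF lim m_lim])
  then have "(\<lambda>k. cvm_cdf (m k) F0 (real (m k) * c (m k))) \<longlonglongrightarrow> 1 - \<alpha>"
    using c(1)[OF m0] by simp
  from alternatives_frequently_detected[OF F m0 m_lim a d _ _ this] \<alpha>
  obtain \<beta> where \<beta>: "\<beta> < 1 - \<alpha>" "\<exists>\<^sub>F k in sequentially. cvm_cdf (m k) (F k) (real (m k) * c (m k)) \<le> \<beta>" by auto
  have "(\<lambda>k. 1 - \<alpha> - 1 / real (Suc k)) \<longlonglongrightarrow> 1 - \<alpha> - 0"
    by (intro tendsto_diff tendsto_const LIMSEQ_Suc[OF lim_1_over_n])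
  then have "\<forall>\<^sub>F k in sequentially. \<beta> < 1 - \<alpha> - 1 / real (Suc k)"
    using \<beta>(1) by (intro order_tendstoD(1)) auto
  then have "\<forall>\<^sub>F k in sequentially. \<not> cvm_cdf (m k) (F k) (real (m k) * c (m k)) \<le> \<beta>"
  proof eventually_elim
    fix k assume "\<beta> < 1 - \<alpha> - 1 / real (Suc k)"
    then show "\<not> cvm_cdf (m k) (F k) (real (m k) * c (m k)) \<le> \<beta>"
      using mF(3)[of k] c(2)[OF m0[of k] F[of k]] by linarith
  qed
  then show False using \<beta>(2) by (simp add: frequently_def)
qed

text \<open>Both distribution functions of the statistic approach the same limit uniformly, so the type II error
  and the complement of the type I error agree in the limit, whatever the thresholds are.\<close>

lemma indistinguishable_if_distance_vanishes:
  assumes F: "\<And>n. F n \<in> dist_funs01" and b: "(\<lambda>n. real n * dist2 (F n)) \<longlonglongrightarrow> 0"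
    and K: "\<forall>n. cvm_test n (K n)"
  shows "errors F K \<longlonglongrightarrow> 1"
proof -
  obtain c where c: "\<And>n. n > 0 \<Longrightarrow> type1_error n (K n) = 1 - cvm_cdf n F0 (real n * c n)"
    "\<And>n F. n > 0 \<Longrightarrow> F \<in> dist_funs01 \<Longrightarrow> type2_error n F (K n) = cvm_cdf n F (real n * c n)"
    using cvm_tests_thresholds[OF K] by metis
  let ?t = "\<lambda>n. real n * c n"
  have "(\<lambda>n. 1 + ((cvm_cdf n (F n) (?t n) - G0 (?t n)) - (cvm_cdf n F0 (?t n) - G0 (?t n)))) \<longlonglongrightarrow> 1 + (0 - 0)"
    by (intro tendsto_intros cvm_cdf_lim_near_seq cvm_cdf_lim_null_seq F b)
  moreover have "\<forall>\<^sub>F n in sequentially. 1 + ((cvm_cdf n (F n) (?t n) - G0 (?t n)) - (cvm_cdf n F0 (?t n) - G0 (?t n))) =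
      errors F K n"
    using eventually_gt_at_top[of 0] by eventually_elim (simp add: c F)
  ultimately show ?thesis by (simp add: tendsto_cong)
qed

text \<open>It suffices to look at the scaled threshold \<open>1\<close>: its type I error has a limit strictly between \<open>0\<close> and
  \<open>1\<close>, and on a subsequence with distances bounded below the sum of errors stays below \<open>1\<close>.\<close>

lemma distance_vanishes_if_indistinguishable:
  assumes F: "\<And>n. F n \<in> dist_funs01"
    and all: "\<And>K. \<forall>n. cvm_test n (K n) \<Longrightarrow>
      \<exists>L\<ge>1. errors F K \<longlonglongrightarrow> L"
  shows "(\<lambda>n. real n * dist2 (F n)) \<longlonglongrightarrow> 0"
proof (rule ccontr)
  let ?b = "\<lambda>n. real n * dist2 (F n)"
  assume "\<not> ?b \<longlonglongrightarrow> 0"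
  then obtain a where a: "a > 0" "\<exists>\<^sub>F n in sequentially. a \<le> ?b n"
    unfolding tendsto_iff not_all not_imp not_eventually by (auto simp: dist_real_def T2_nonneg not_less)
  then have "\<exists>n>k. a \<le> ?b n" for k
    by (auto simp: frequently_sequentially) (metis Suc_le_eq)
  then obtain m where m: "\<And>k. m k > k" "\<And>k. a \<le> ?b (m k)" by metis
  have m0: "m k > 0" for k using m(1)[of k] by simp
  have m_lim: "filterlim m at_top sequentially"
    by (rule filterlim_at_top_mono[OF filterlim_ident]) (auto intro!: always_eventually less_imp_le m(1))
  define K where "K n = (\<lambda>X. T2 (\<lambda>x. emp_cdf n X x - F0 x) > 1 / real n)" for n
  have "\<forall>n. cvm_test n (K n)" unfolding cvm_test_def K_def by blast
  from all[OF this] obtain L where L: "L \<ge> 1" "errors F K \<longlonglongrightarrow> L" by blast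
  have err: "type1_error n (K n) = 1 - cvm_cdf n F0 1" "type2_error n (F n) (K n) = cvm_cdf n (F n) 1" if "n > 0" for n
    using type_errors[OF K_def that F[of n]] that by simp_all
  have g: "0 < G0 1" "G0 1 < 1" using G0_properties(3,4)[of 1] by auto
  have null: "(\<lambda>k. cvm_cdf (m k) F0 1) \<longlonglongrightarrow> G0 1"
    using cvm_cdf_lim_null[OF m0 m_lim, of "\<lambda>_. 1"] by (simp add: LIM_zero_iff)
  from alternatives_frequently_detected[OF F m0 m_lim a(1) m(2) g null]
  obtain \<beta> where \<beta>: "\<beta> < G0 1" "\<exists>\<^sub>F k in sequentially. cvm_cdf (m k) (F (m k)) 1 \<le> \<beta>" by blast
  have "(\<lambda>k. type1_error (m k) (K (m k)) + type2_error (m k) (F (m k)) (K (m k)) - (1 - cvm_cdf (m k) F0 1)) \<longlonglongrightarrow> L - (1 - G0 1)"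
    by (intro tendsto_diff tendsto_const null filterlim_compose[OF L(2) m_lim])
  then have "(\<lambda>k. cvm_cdf (m k) (F (m k)) 1) \<longlonglongrightarrow> L - (1 - G0 1)"
    using err[OF m0] by simp
  moreover have "\<beta> < L - (1 - G0 1)" using \<beta>(1) L(1) by simp
  ultimately have "\<forall>\<^sub>F k in sequentially. \<beta> < cvm_cdf (m k) (F (m k)) 1" by (rule order_tendstoD)
  then show False using \<beta>(2) by (simp add: frequently_def not_le)
qed

theorem theorem7p1:
  shows
    "(\<forall>F :: nat \<Rightarrow> real \<Rightarrow> real. (\<forall>n. F n \<in> dist_funs01) \<longrightarrow>
        ((\<exists>K. (\<forall>n. cvm_test n (K n)) \<and>
              (\<lambda>n. type1_error n (K n) + type2_error n (F n) (K n)) \<longlonglongrightarrow> 0)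
         \<longleftrightarrow> filterlim (\<lambda>n. real n * T2 (\<lambda>x. F n x - F0 x)) at_top sequentially))
     \<and>
     (\<forall>(a::real) (\<alpha>::real) K. a > 0 \<longrightarrow> 0 < \<alpha> \<longrightarrow> \<alpha> < 1 \<longrightarrow>
        (\<forall>n. cvm_test n (K n)) \<longrightarrow> (\<lambda>n. type1_error n (K n)) \<longlonglongrightarrow> \<alpha> \<longrightarrow>
        limsup (\<lambda>n. SUP F \<in> Upsilon n a. ereal (type2_error n F (K n))) < ereal (1 - \<alpha>))
     \<and>
     (\<forall>F :: nat \<Rightarrow> real \<Rightarrow> real. (\<forall>n. F n \<in> dist_funs01) \<longrightarrow>
        ((\<forall>K. (\<forall>n. cvm_test n (K n)) \<longrightarrow>
              (\<exists>L\<ge>1. (\<lambda>n. type1_error n (K n) + type2_error n (F n) (K n)) \<longlonglongrightarrow> L))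
         \<longleftrightarrow> (\<lambda>n. real n * T2 (\<lambda>x. F n x - F0 x)) \<longlonglongrightarrow> 0))"
proof (intro conjI allI impI)
  fix F :: "nat \<Rightarrow> real \<Rightarrow> real" assume "\<forall>n. F n \<in> dist_funs01"
  then have F: "\<And>n. F n \<in> dist_funs01" by blast
  show "(\<exists>K. (\<forall>n. cvm_test n (K n)) \<and>
              errors F K \<longlonglongrightarrow> 0)
         \<longleftrightarrow> filterlim (\<lambda>n. real n * T2 (\<lambda>x. F n x - F0 x)) at_top sequentially"
  proof
    assume "\<exists>K. (\<forall>n. cvm_test n (K n)) \<and> errors F K \<longlonglongrightarrow> 0"
    then obtain K where K: "\<forall>n. cvm_test n (K n)" "errors F K \<longlonglongrightarrow> 0"
      by (elim exE conjE)
    show "filterlim (\<lambda>n. real n * T2 (\<lambda>x. F n x - F0 x)) at_top sequentially"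
      by (rule distance_diverges_if_consistent[OF F K])
  next
    assume "filterlim (\<lambda>n. real n * T2 (\<lambda>x. F n x - F0 x)) at_top sequentially"
    then show "\<exists>K. (\<forall>n. cvm_test n (K n)) \<and> errors F K \<longlonglongrightarrow> 0"
      by (rule consistent_if_distance_diverges[OF F])
  qed
next
  fix a \<alpha> :: real and K :: "nat \<Rightarrow> (nat \<Rightarrow> real) \<Rightarrow> bool"
  assume "a > 0" "0 < \<alpha>" "\<alpha> < 1" "\<forall>n. cvm_test n (K n)" "(\<lambda>n. type1_error n (K n)) \<longlonglongrightarrow> \<alpha>"
  then show "limsup (\<lambda>n. SUP F \<in> Upsilon n a. ereal (type2_error n F (K n))) < ereal (1 - \<alpha>)"
    by (rule asymptotically_unbiased)
next
  fix F :: "nat \<Rightarrow> real \<Rightarrow> real" assume "\<forall>n. F n \<in> dist_funs01"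
  then have F: "\<And>n. F n \<in> dist_funs01" by blast
  show "(\<forall>K. (\<forall>n. cvm_test n (K n)) \<longrightarrow>
              (\<exists>L\<ge>1. errors F K \<longlonglongrightarrow> L))
         \<longleftrightarrow> (\<lambda>n. real n * T2 (\<lambda>x. F n x - F0 x)) \<longlonglongrightarrow> 0"
  proof
    assume "\<forall>K. (\<forall>n. cvm_test n (K n)) \<longrightarrow>
      (\<exists>L\<ge>1. errors F K \<longlonglongrightarrow> L)"
    note all = this
    have "\<exists>L\<ge>1. errors F K \<longlonglongrightarrow> L"
      if "\<forall>n. cvm_test n (K n)" for K :: "nat \<Rightarrow> (nat \<Rightarrow> real) \<Rightarrow> bool"
      by (rule spec[OF all, of K, THEN mp, OF that])
    then show "(\<lambda>n. real n * T2 (\<lambda>x. F n x - F0 x)) \<longlonglongrightarrow> 0"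
      by (rule distance_vanishes_if_indistinguishable[OF F])
  next
    assume b: "(\<lambda>n. real n * T2 (\<lambda>x. F n x - F0 x)) \<longlonglongrightarrow> 0"
    show "\<forall>K. (\<forall>n. cvm_test n (K n)) \<longrightarrow>
      (\<exists>L\<ge>1. errors F K \<longlonglongrightarrow> L)"
    proof (intro allI impI exI[of _ 1] conjI order_refl)
      fix K :: "nat \<Rightarrow> (nat \<Rightarrow> real) \<Rightarrow> bool" assume "\<forall>n. cvm_test n (K n)"
      then show "errors F K \<longlonglongrightarrow> 1"
        by (rule indistinguishable_if_distance_vanishes[OF F b])
    qed
  qed
qed

end
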